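(* Assume that the basic conditions on the data (listed in the context) hold, with $\mu_0>0$, let $k_r,k_d,k_a,k_v\ge 0$ be any nonnegative boundary spring and damper constants, let $u$ be a regular weak solution of the beam problem, and let $\mathcal{E}(t)$ be its energy, with initial energy $\mathcal{E}(0)>0$. Then the system is exponentially stable in the following sense. For every $\lambda$ with $$0<\lambda<\min\left(\frac{1}{\beta_0},\ \frac{\mu_0}{2\rho_1}\right),$$ setting $$M_d=\frac{1+\beta_1\lambda}{1-\beta_0\lambda},\qquad \sigma=\frac{2\lambda}{1+\beta_1\lambda},$$ one has $$\mathcal{E}(t)\le M_d\,e^{-\sigma t}\,\mathcal{E}(0),\qquad t\in[0,T],$$ where $$\beta_0=\frac{\ell^2}{2}\sqrt{\frac{\rho_1}{r_0}},\qquad \beta_1=\beta_0\left[1+\frac{1}{\sqrt{\rho_1 r_0}}\left(\frac{\ell^2}{2}\,\mu_1+\frac{2}{\ell}\,k_a+\ell\,k_v\right)\right].$$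
   Context: Let $\ell>0$, $T>0$, $\Omega_T=(0,\ell)\times(0,T)$. The beam problem is $$\rho(x)u_{tt}+\mu(x)u_t+(r(x)u_{xx})_{xx}=0,\quad (x,t)\in\Omega_T,$$ $$u(x,0)=u_0(x),\quad u_t(x,0)=u_1(x),\quad x\in(0,\ell),$$ $$u(0,t)=u_x(0,t)=0,\quad \left(-r(x)u_{xx}\right)_{x=\ell}=k_r u_x(\ell,t)+k_a u_{xt}(\ell,t),$$ $$\left(-(r(x)u_{xx})_x\right)_{x=\ell}=-k_d u(\ell,t)-k_v u_t(\ell,t),\quad t\in[0,T].$$ Basic conditions on the data: $\rho,\mu\in L^\infty(0,\ell)$, $r\in H^2(0,\ell)$, $u_0\in H^2(0,\ell)$, $u_1\in L^2(0,\ell)$; there are constants such that for $x\in(0,\ell)$, $0<\rho_0\le\rho(x)\le\rho_1$, $0<r_0\le r(x)\le r_1$, $0\le\mu_0\le\mu(x)\le\mu_1$; the constants $k_r,k_a,k_d,k_v\ge0$ satisfy $k_a+k_v+\mu_0>0$. A regular weak solution is a solution $u$ of the beam problem with $u\in L^2(0,T;H^4(0,\ell))$, $u_t\in L^2(0,T;\mathcal{V}^2(0,\ell))$, $u_{tt}\in L^2(0,T;L^2(0,\ell))$, where $\mathcal{V}^2(0,\ell)=\{v\in H^2(0,\ell): v(0)=v'(0)=0\}$. The differential equation holds almost everywhere, and boundary conditions hold in the sense of traces for almost every $t$. The energy is $$\mathcal{E}(t)=\frac12\int_0^\ell\left[\rho(x)u_t^2(x,t)+r(x)u_{xx}^2(x,t)\right]dx+\frac12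 k_r u_x^2(\ell,t)+\frac12 k_d u^2(\ell,t),$$ with initial value $$\mathcal{E}(0)=\frac12\int_0^\ell\left[\rho(x)(u_1(x))^2+r(x)(u_0''(x))^2\right]dx+\frac12 k_r(u_0'(\ell))^2+\frac12 k_d(u_0(\ell))^2.$$ *)

theory Defs
  imports "HOL-Analysis.Analysis"
begin

text \<open>
  Elements of function spaces on the interval from 0 to l are represented by functions
  real => real, only their values on the open interval mattering, up to null sets. A
  function of space and time is curried with time first: u t x stands for u(x,t).
\<close>

abbreviation leb :: "real \<Rightarrow> real measure" where
  "leb b \<equiv> lebesgue_on {0<..<b}"

definition test_function :: "real \<Rightarrow> (real \<Rightarrow> real) \<Rightarrow> bool" where
  "test_function b \<phi> \<longleftrightarrow>
     (\<forall>n. (deriv ^^ n) \<phi> differentiable_on UNIV) \<and>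
     (\<exists>c d. 0 < c \<and> d < b \<and> (\<forall>x. x \<notin> {c..d} \<longrightarrow> \<phi> x = 0))"

definition locally_integrable :: "real \<Rightarrow> (real \<Rightarrow> real) \<Rightarrow> bool" where
  "locally_integrable b f \<longleftrightarrow> (\<forall>c d. 0 < c \<longrightarrow> d < b \<longrightarrow> integrable (lebesgue_on {c..d}) f)"

definition has_weak_deriv :: "real \<Rightarrow> nat \<Rightarrow> (real \<Rightarrow> real) \<Rightarrow> (real \<Rightarrow> real) \<Rightarrow> bool" where
  "has_weak_deriv l j f g \<longleftrightarrow>
     locally_integrable l f \<and> locally_integrable l g \<and>
     (\<forall>\<phi>. test_function l \<phi> \<longrightarrow>
        (\<integral>x. f x * (deriv ^^ j) \<phi> x \<partial>leb l) = (-1) ^ j * (\<integral>x. g x * \<phi> x \<partial>leb l))"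

text \<open>Some representative of the weak derivative of order j, which is unique up to null sets.\<close>

definition wderiv :: "real \<Rightarrow> nat \<Rightarrow> (real \<Rightarrow> real) \<Rightarrow> real \<Rightarrow> real" where
  "wderiv l j f = (SOME g. has_weak_deriv l j f g)"

definition Linfty :: "real \<Rightarrow> (real \<Rightarrow> real) set" where
  "Linfty l = {f \<in> borel_measurable (leb l). \<exists>C. AE x in leb l. \<bar>f x\<bar> \<le> C}"

definition L2 :: "real \<Rightarrow> (real \<Rightarrow> real) set" where
  "L2 l = {f \<in> borel_measurable (leb l). integrable (leb l) (\<lambda>x. (f x)\<^sup>2)}"

definition L2norm :: "real \<Rightarrow> (real \<Rightarrow> real) \<Rightarrow> real" where
  "L2norm l f = sqrt (\<integral>x. (f x)\<^sup>2 \<partial>leb l)"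

definition Sobolev :: "real \<Rightarrow> nat \<Rightarrow> (real \<Rightarrow> real) set" where
  "Sobolev l k = {f \<in> L2 l. \<forall>j\<le>k. \<exists>g\<in>L2 l. has_weak_deriv l j f g}"

definition Sobolev_norm :: "real \<Rightarrow> nat \<Rightarrow> (real \<Rightarrow> real) \<Rightarrow> real" where
  "Sobolev_norm l k f = sqrt (\<Sum>j\<le>k. (L2norm l (wderiv l j f))\<^sup>2)"

text \<open>
  The trace of f at an end point c of the interval: the value at c of the representative
  of f that is continuous up to the boundary, which exists for every f in Sobolev l 1.
\<close>

definition trace :: "real \<Rightarrow> (real \<Rightarrow> real) \<Rightarrow> real \<Rightarrow> real" where
  "trace l f c =
     (THE y. \<exists>F. continuous_on {0..l} F \<and> (AE x in leb l. F x = f x) \<and> F c = y)"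

definition V2 :: "real \<Rightarrow> (real \<Rightarrow> real) set" where
  "V2 l = {v \<in> Sobolev l 2. trace l v 0 = 0 \<and> trace l (wderiv l 1 v) 0 = 0}"

text \<open>
  Bochner spaces of square integrable maps from (0,T) to a space X of functions with
  norm N; strong measurability is approximation by X-valued simple functions.
\<close>

definition strongly_measurable ::
    "real \<Rightarrow> (real \<Rightarrow> real) set \<Rightarrow> ((real \<Rightarrow> real) \<Rightarrow> real) \<Rightarrow> (real \<Rightarrow> real \<Rightarrow> real) \<Rightarrow> bool" where
  "strongly_measurable T X N f \<longleftrightarrow>
     (\<exists>s :: nat \<Rightarrow> real \<Rightarrow> real \<Rightarrow> real.
        (\<forall>n. simple_function (leb T) (s n) \<and> (\<forall>t\<in>{0<..<T}. s n t \<in> X)) \<and>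
        (AE t in leb T. (\<lambda>n. N (\<lambda>x. f t x - s n t x)) \<longlonglongrightarrow> 0))"

definition Bochner_L2 ::
    "real \<Rightarrow> (real \<Rightarrow> real) set \<Rightarrow> ((real \<Rightarrow> real) \<Rightarrow> real) \<Rightarrow> (real \<Rightarrow> real \<Rightarrow> real) set" where
  "Bochner_L2 T X N =
     {f. strongly_measurable T X N f \<and> (AE t in leb T. f t \<in> X) \<and>
         integrable (leb T) (\<lambda>t. (N (f t))\<^sup>2)}"

text \<open>
  g is the weak derivative of f with respect to time: the equality of the Bochner integrals
  of \<phi>' f and - \<phi> g over (0,T), for all test functions \<phi>, is tested against all \<psi> in L2 l.
\<close>

definition has_weak_time_deriv ::
    "real \<Rightarrow> real \<Rightarrow> (real \<Rightarrow> real \<Rightarrow> real) \<Rightarrow> (real \<Rightarrow> real \<Rightarrow> real) \<Rightarrow> bool" where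
  "has_weak_time_deriv l T f g \<longleftrightarrow>
     f \<in> Bochner_L2 T (L2 l) (L2norm l) \<and> g \<in> Bochner_L2 T (L2 l) (L2norm l) \<and>
     (\<forall>\<phi>. test_function T \<phi> \<longrightarrow> (\<forall>\<psi>\<in>L2 l.
        (\<integral>t. deriv \<phi> t * (\<integral>x. f t x * \<psi> x \<partial>leb l) \<partial>leb T) =
        - (\<integral>t. \<phi> t * (\<integral>x. g t x * \<psi> x \<partial>leb l) \<partial>leb T)))"

definition L2_continuous :: "real \<Rightarrow> real \<Rightarrow> (real \<Rightarrow> real \<Rightarrow> real) \<Rightarrow> bool" where
  "L2_continuous l T F \<longleftrightarrow>
     (\<forall>t\<in>{0..T}. F t \<in> L2 l \<and>
        ((\<lambda>s. L2norm l (\<lambda>x. F s x - F t x)) \<longlongrightarrow> 0) (at t within {0..T}))"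

text \<open>
  Values at individual times are those of the representative that is continuous from [0,T]
  to L2 l. It exists as soon as f has a weak time derivative, and its value at each t in
  [0,T] is unique up to null sets. A representative continuous into V2 l is also one into L2 l.
\<close>

definition continuous_rep ::
    "real \<Rightarrow> real \<Rightarrow> (real \<Rightarrow> real \<Rightarrow> real) \<Rightarrow> real \<Rightarrow> real \<Rightarrow> real" where
  "continuous_rep l T f =
     (SOME F. L2_continuous l T F \<and> (AE t in leb T. AE x in leb l. F t x = f t x))"

definition basic_conditions ::
    "real \<Rightarrow> (real \<Rightarrow> real) \<Rightarrow> (real \<Rightarrow> real) \<Rightarrow> (real \<Rightarrow> real) \<Rightarrow> (real \<Rightarrow> real) \<Rightarrow> (real \<Rightarrow> real) \<Rightarrow>
     real \<Rightarrow> real \<Rightarrow> real \<Rightarrow> real \<Rightarrow> real \<Rightarrow> real \<Rightarrow> real \<Rightarrow> real \<Rightarrow> real \<Rightarrow> real \<Rightarrow> bool" where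
  "basic_conditions l \<rho> \<mu> r u0 u1 \<rho>0 \<rho>1 \<mu>0 \<mu>1 r0 r1 kr ka kd kv \<longleftrightarrow>
     \<rho> \<in> Linfty l \<and> \<mu> \<in> Linfty l \<and> r \<in> Sobolev l 2 \<and> u0 \<in> Sobolev l 2 \<and> u1 \<in> L2 l \<and>
     0 < \<rho>0 \<and> (AE x in leb l. \<rho>0 \<le> \<rho> x \<and> \<rho> x \<le> \<rho>1) \<and>
     0 < r0 \<and> (AE x in leb l. r0 \<le> r x \<and> r x \<le> r1) \<and>
     0 \<le> \<mu>0 \<and> (AE x in leb l. \<mu>0 \<le> \<mu> x \<and> \<mu> x \<le> \<mu>1) \<and>
     0 \<le> kr \<and> 0 \<le> ka \<and> 0 \<le> kd \<and> 0 \<le> kv \<and> ka + kv + \<mu>0 > 0"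

definition regular_weak_solution ::
    "real \<Rightarrow> real \<Rightarrow> (real \<Rightarrow> real) \<Rightarrow> (real \<Rightarrow> real) \<Rightarrow> (real \<Rightarrow> real) \<Rightarrow> (real \<Rightarrow> real) \<Rightarrow> (real \<Rightarrow> real) \<Rightarrow>
     real \<Rightarrow> real \<Rightarrow> real \<Rightarrow> real \<Rightarrow>
     (real \<Rightarrow> real \<Rightarrow> real) \<Rightarrow> (real \<Rightarrow> real \<Rightarrow> real) \<Rightarrow> (real \<Rightarrow> real \<Rightarrow> real) \<Rightarrow> bool" where
  "regular_weak_solution l T \<rho> \<mu> r u0 u1 kr ka kd kv u ut utt \<longleftrightarrow>
     has_weak_time_deriv l T u ut \<and> has_weak_time_deriv l T ut utt \<and>
     u \<in> Bochner_L2 T (Sobolev l 4) (Sobolev_norm l 4) \<and>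
     ut \<in> Bochner_L2 T (V2 l) (Sobolev_norm l 2) \<and>
     utt \<in> Bochner_L2 T (L2 l) (L2norm l) \<and>
     (AE t in leb T. AE x in leb l.
        \<rho> x * utt t x + \<mu> x * ut t x + wderiv l 2 (\<lambda>y. r y * wderiv l 2 (u t) y) x = 0) \<and>
     (AE x in leb l. continuous_rep l T u 0 x = u0 x) \<and>
     (AE x in leb l. continuous_rep l T ut 0 x = u1 x) \<and>
     (AE t in leb T.
        trace l (u t) 0 = 0 \<and>
        trace l (wderiv l 1 (u t)) 0 = 0 \<and>
        - trace l (\<lambda>x. r x * wderiv l 2 (u t) x) l =
          kr * trace l (wderiv l 1 (u t)) l + ka * trace l (wderiv l 1 (ut t)) l \<and>
        - trace l (wderiv l 1 (\<lambda>x. r x * wderiv l 2 (u t) x)) l =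
          - kd * trace l (u t) l - kv * trace l (ut t) l)"

text \<open>The energy of the state with displacement w and velocity v.\<close>

definition state_energy ::
    "real \<Rightarrow> (real \<Rightarrow> real) \<Rightarrow> (real \<Rightarrow> real) \<Rightarrow> real \<Rightarrow> real \<Rightarrow> (real \<Rightarrow> real) \<Rightarrow> (real \<Rightarrow> real) \<Rightarrow> real" where
  "state_energy l \<rho> r kr kd w v =
     1/2 * (\<integral>x. \<rho> x * (v x)\<^sup>2 + r x * (wderiv l 2 w x)\<^sup>2 \<partial>leb l) +
     1/2 * kr * (trace l (wderiv l 1 w) l)\<^sup>2 + 1/2 * kd * (trace l w l)\<^sup>2"

definition energy ::
    "real \<Rightarrow> real \<Rightarrow> (real \<Rightarrow> real) \<Rightarrow> (real \<Rightarrow> real) \<Rightarrow> real \<Rightarrow> real \<Rightarrow>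
     (real \<Rightarrow> real \<Rightarrow> real) \<Rightarrow> (real \<Rightarrow> real \<Rightarrow> real) \<Rightarrow> real \<Rightarrow> real" where
  "energy l T \<rho> r kr kd u ut t =
     state_energy l \<rho> r kr kd (continuous_rep l T u t) (continuous_rep l T ut t)"

end

theory Submission
  imports Defs
begin

text \<open>
  Multiplying the equation by the velocity and by the displacement shows that the Lyapunov function
  L = E + lam * J, with J = \<integral> \<rho> u u_t + (1/2) \<integral> \<mu> u^2 + (1/2) ka u_x(l)^2 + (1/2) kv u(l)^2, satisfies
  L' \<le> - 2 lam E as soon as 2 lam \<rho>1 \<le> \<mu>0. Since - \<beta>0 E \<le> J \<le> \<beta>1 E, this is at most - \<sigma> L, and
  Gronwall's inequality gives the decay.

  The time derivative of L is justified for the weak regularity at hand by a product rule for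
  L2-valued functions that are absolutely continuous in the weak sense. It is applied to the state
  (u, u_xx, u_t); the clamped end makes u and its end point traces recoverable from u_xx.
\<close>

text \<open>The obstacle is the choice of a time. The energy is wanted at every \<open>t\<close>,
  while a solution is given only for almost every \<open>t\<close>, and
  \<open>continuous_rep\<close> is continuous merely into \<open>L2 l\<close>: that its value at a
  given time has a second space derivative and end point traces has to be proved. Hence the second
  derivative is made an unknown with a weak time derivative of its own. Twofold integration is
  bounded on L2, so identities between the state components spread from almost every time to every
  time, and the energy becomes a quadratic expression in weakly absolutely continuous functions of
  time. The damping terms in J are there so that testing with the displacement leaves no product of
  displacement and velocity. The constants come from one estimate: integrating twice from the
  clamped end bounds the integral of u^2 by l^4/8 times that of u_xx^2. Young's inequality with
  weight \<beta>0 then controls the mixed term of J, and the excess of \<beta>1 over \<beta>0 its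
  damping terms. The bound lam < 1/\<beta>0 makes E + lam * J at least a positive multiple of E,
  which is where the denominator of M_d comes from.\<close>

abbreviation ip :: "real \<Rightarrow> (real \<Rightarrow> real) \<Rightarrow> (real \<Rightarrow> real) \<Rightarrow> real" where
  "ip b f g \<equiv> \<integral>x. f x * g x \<partial>leb b"

abbreviation dist2 :: "real \<Rightarrow> (real \<Rightarrow> real) \<Rightarrow> (real \<Rightarrow> real) \<Rightarrow> real" where
  "dist2 b f g \<equiv> L2norm b (\<lambda>x. f x - g x)"

abbreviation wip :: "real \<Rightarrow> (real \<Rightarrow> real) \<Rightarrow> (real \<Rightarrow> real) \<Rightarrow> (real \<Rightarrow> real) \<Rightarrow> real" where
  "wip b a f g \<equiv> \<integral>x. a x * f x * g x \<partial>leb b"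

section \<open>Square integrable functions\<close>

lemma finite_measure_leb [simp]: "finite_measure (leb b)"
  by (rule finite_measure_lebesgue_on) auto

lemma const_integrable_leb [simp]: "integrable (leb b) (\<lambda>x. c :: real)"
  by (simp add: finite_measure.integrable_const)

text \<open>Weak derivatives and representatives are determined only up to null sets, so
  measurability has to survive such changes. Extension by zero reduces this to the completeness of
  Lebesgue measure on the line.\<close>

lemma borel_measurable_lebesgue_on_AE:
  fixes f g :: "real \<Rightarrow> real"
  assumes "f \<in> borel_measurable (lebesgue_on S)" "AE x in lebesgue_on S. f x = g x" "S \<in> sets lebesgue"
  shows "g \<in> borel_measurable (lebesgue_on S)"
proof (rule borel_measurable_if_D, rule borel_measurable_AE)
  show "(\<lambda>x. if x \<in> S then f x else 0) \<in> borel_measurable lebesgue"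
    using assms by (intro borel_measurable_if_I)
  show "AE x in lebesgue. (if x \<in> S then f x else 0) = (if x \<in> S then g x else 0)"
    using assms(2,3) by (auto simp: AE_restrict_space_iff)
qed

lemma borel_measurable_leb_AE:
  fixes f g :: "real \<Rightarrow> real"
  assumes "f \<in> borel_measurable (leb b)" "AE x in leb b. f x = g x"
  shows "g \<in> borel_measurable (leb b)"
  using borel_measurable_lebesgue_on_AE[OF assms] by simp

lemma L2_measurable: "f \<in> L2 l \<Longrightarrow> f \<in> borel_measurable (leb l)"
  by (simp add: L2_def)

lemma L2_sq_integrable: "f \<in> L2 l \<Longrightarrow> integrable (leb l) (\<lambda>x. (f x)\<^sup>2)"
  by (simp add: L2_def)

lemma L2_mult_integrable:
  assumes "f \<in> L2 l" "g \<in> L2 l"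
  shows "integrable (leb l) (\<lambda>x. f x * g x)"
proof (rule Bochner_Integration.integrable_bound)
  show "integrable (leb l) (\<lambda>x. (f x)\<^sup>2 + (g x)\<^sup>2)"
    using assms by (simp add: L2_sq_integrable)
  show "(\<lambda>x. f x * g x) \<in> borel_measurable (leb l)"
    using assms by (auto dest!: L2_measurable)
  have "\<bar>a * b\<bar> \<le> a\<^sup>2 + b\<^sup>2" for a b :: real
  proof -
    have "2 * (\<bar>a\<bar> * \<bar>b\<bar>) \<le> a\<^sup>2 + b\<^sup>2"
      using sum_squares_bound[of "\<bar>a\<bar>" "\<bar>b\<bar>"] by simp
    moreover have "0 \<le> \<bar>a\<bar> * \<bar>b\<bar>" by simp
    ultimately show ?thesis by (simp only: abs_mult)
  qed
  then show "AE x in leb l. norm (f x * g x) \<le> norm ((f x)\<^sup>2 + (g x)\<^sup>2)"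
    by (intro AE_I2) (simp add: abs_of_nonneg)
qed

lemma L2_const [simp]: "(\<lambda>x. c) \<in> L2 l"
  by (simp add: L2_def)

lemma L2_integrable: "f \<in> L2 l \<Longrightarrow> integrable (leb l) f"
  using L2_mult_integrable[of f l "\<lambda>x. 1"] by simp

lemma L2_mult_bounded:
  assumes "f \<in> L2 l" "a \<in> borel_measurable (leb l)" "AE x in leb l. \<bar>a x\<bar> \<le> C"
  shows "(\<lambda>x. a x * f x) \<in> L2 l"
proof -
  have "integrable (leb l) (\<lambda>x. (a x * f x)\<^sup>2)"
  proof (rule Bochner_Integration.integrable_bound)
    show "integrable (leb l) (\<lambda>x. C\<^sup>2 * (f x)\<^sup>2)"
      using assms by (simp add: L2_sq_integrable)
    show "(\<lambda>x. (a x * f x)\<^sup>2) \<in> borel_measurable (leb l)"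
      using assms by (auto dest!: L2_measurable)
    show "AE x in leb l. norm ((a x * f x)\<^sup>2) \<le> norm (C\<^sup>2 * (f x)\<^sup>2)"
      using assms(3)
    proof eventually_elim
      case (elim x)
      then have "(a x)\<^sup>2 \<le> C\<^sup>2" by (rule abs_le_square_iff[THEN iffD1, OF order_trans[OF _ abs_ge_self]])
      then show ?case by (simp add: power_mult_distrib mult_right_mono abs_mult)
    qed
  qed
  then show ?thesis using assms by (auto simp: L2_def)
qed

lemma L2_bounded:
  assumes "a \<in> borel_measurable (leb l)" "AE x in leb l. \<bar>a x\<bar> \<le> C"
  shows "a \<in> L2 l"
  using L2_mult_bounded[OF L2_const assms, of 1] by simp

lemma L2_scale: "f \<in> L2 l \<Longrightarrow> (\<lambda>x. c * f x) \<in> L2 l"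
  by (rule L2_mult_bounded[where C = "\<bar>c\<bar>"]) auto

lemma L2_add:
  assumes "f \<in> L2 l" "g \<in> L2 l"
  shows "(\<lambda>x. f x + g x) \<in> L2 l"
proof -
  have "(\<lambda>x. (f x + g x)\<^sup>2) = (\<lambda>x. (f x)\<^sup>2 + 2 * (f x * g x) + (g x)\<^sup>2)"
    by (auto simp: power2_eq_square algebra_simps)
  moreover have "integrable (leb l) \<dots>"
    using assms by (intro Bochner_Integration.integrable_add integrable_mult_right L2_mult_integrable L2_sq_integrable)
  ultimately show ?thesis using assms by (auto simp: L2_def)
qed

lemma L2_diff: "f \<in> L2 l \<Longrightarrow> g \<in> L2 l \<Longrightarrow> (\<lambda>x. f x - g x) \<in> L2 l"
  using L2_add[OF _ L2_scale[of g l "-1"], of f] by simp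

lemma L2_cong_AE:
  assumes "f \<in> L2 l" "AE x in leb l. f x = g x"
  shows "g \<in> L2 l"
proof -
  have g: "g \<in> borel_measurable (leb l)"
    using assms borel_measurable_leb_AE L2_measurable by blast
  have "integrable (leb l) (\<lambda>x. (g x)\<^sup>2)"
    by (rule integrable_cong_AE_imp[OF L2_sq_integrable[OF assms(1)]]) (use g assms(2) in auto)
  with g show ?thesis by (simp add: L2_def)
qed

lemma L2norm_nonneg [simp]: "0 \<le> L2norm l f"
  by (simp add: L2norm_def)

lemma L2norm_power2: "(L2norm l f)\<^sup>2 = (\<integral>x. (f x)\<^sup>2 \<partial>leb l)"
  by (simp add: L2norm_def)

lemma L2norm_cong_AE:
  assumes "f \<in> L2 l" "AE x in leb l. f x = g x"
  shows "L2norm l f = L2norm l g"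
  unfolding L2norm_def
  by (intro arg_cong[where f = sqrt] integral_cong_AE)
     (use assms L2_cong_AE[OF assms] in \<open>auto dest!: L2_measurable\<close>)

lemma L2norm_minus_commute: "dist2 l f g = dist2 l g f"
  by (simp add: L2norm_def power2_commute)

text \<open>A quadratic polynomial in \<open>s\<close> that is never negative: the Cauchy-Schwarz
  inequality is its discriminant condition, and \<open>s = 1\<close> yields the triangle
  inequality.\<close>

lemma L2norm_sum_power2:
  assumes "f \<in> L2 l" "g \<in> L2 l"
  shows "(L2norm l (\<lambda>x. f x + s * g x))\<^sup>2 =
    (L2norm l f)\<^sup>2 + 2 * s * ip l f g + s\<^sup>2 * (L2norm l g)\<^sup>2"
proof -
  have "(L2norm l (\<lambda>x. f x + s * g x))\<^sup>2 = (\<integral>x. (f x)\<^sup>2 + 2 * s * (f x * g x) + s\<^sup>2 * (g x)\<^sup>2 \<partial>leb l)"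
    unfolding L2norm_power2 by (simp add: power2_eq_square algebra_simps)
  then show ?thesis
    using assms by (simp add: L2norm_power2 L2_mult_integrable L2_sq_integrable)
qed

lemma L2_Cauchy_Schwarz:
  assumes "f \<in> L2 l" "g \<in> L2 l"
  shows "\<bar>ip l f g\<bar> \<le> L2norm l f * L2norm l g"
proof -
  define A B C where "A = L2norm l f" and "B = ip l f g" and "C = L2norm l g"
  have ge: "0 \<le> A\<^sup>2 + 2 * s * B + s\<^sup>2 * C\<^sup>2" for s
    using L2norm_sum_power2[OF assms, of s] unfolding A_def B_def C_def by (metis zero_le_power2)
  have "B\<^sup>2 \<le> (A * C)\<^sup>2"
  proof (cases "C = 0")
    case True
    have "B = 0"
    proof (rule ccontr)
      assume "B \<noteq> 0"
      \<comment> \<open>With \<open>C = 0\<close> the polynomial is affine in \<open>s\<close>, and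
        this choice of \<open>s\<close> gives it the value -1.\<close>
      with ge[of "- (A\<^sup>2 + 1) / (2 * B)"] True show False by (simp add: field_simps)
    qed
    then show ?thesis by simp
  next
    case False
    \<comment> \<open>The polynomial is evaluated at its minimum,
      \<open>s = - B / C^2\<close>.\<close>
    then have "A\<^sup>2 + 2 * (- B / C\<^sup>2) * B + (- B / C\<^sup>2)\<^sup>2 * C\<^sup>2 = (A\<^sup>2 * C\<^sup>2 - B\<^sup>2) / C\<^sup>2"
      by (simp add: field_simps power2_eq_square)
    with ge[of "- B / C\<^sup>2"] False have "0 \<le> A\<^sup>2 * C\<^sup>2 - B\<^sup>2"
      by (simp add: zero_le_divide_iff)
    then show ?thesis by (simp add: power_mult_distrib)
  qed
  then have "\<bar>B\<bar> \<le> \<bar>A * C\<bar>" by (simp add: abs_le_square_iff)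
  then show ?thesis by (simp add: A_def B_def C_def abs_mult)
qed

lemma L2norm_triangle:
  assumes "f \<in> L2 l" "g \<in> L2 l"
  shows "L2norm l (\<lambda>x. f x + g x) \<le> L2norm l f + L2norm l g"
proof (rule power2_le_imp_le)
  show "(L2norm l (\<lambda>x. f x + g x))\<^sup>2 \<le> (L2norm l f + L2norm l g)\<^sup>2"
    using L2norm_sum_power2[OF assms, of 1] L2_Cauchy_Schwarz[OF assms]
    by (simp add: power2_sum)
qed simp

lemma L2norm_diff_triangle:
  assumes "f \<in> L2 l" "g \<in> L2 l" "h \<in> L2 l"
  shows "dist2 l f h \<le> dist2 l f g + dist2 l g h"
  using L2norm_triangle[OF L2_diff[OF assms(1,2)] L2_diff[OF assms(2,3)]] by simp

lemma L2norm_mult_bounded: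
  assumes "f \<in> L2 l" "a \<in> borel_measurable (leb l)" "AE x in leb l. \<bar>a x\<bar> \<le> C" "0 \<le> C"
  shows "L2norm l (\<lambda>x. a x * f x) \<le> C * L2norm l f"
proof (rule power2_le_imp_le)
  have "(\<integral>x. (a x * f x)\<^sup>2 \<partial>leb l) \<le> (\<integral>x. C\<^sup>2 * (f x)\<^sup>2 \<partial>leb l)"
  proof (rule integral_mono_AE)
    show "AE x in leb l. (a x * f x)\<^sup>2 \<le> C\<^sup>2 * (f x)\<^sup>2"
      using assms(3)
    proof eventually_elim
      case (elim x)
      then have "(a x)\<^sup>2 \<le> C\<^sup>2" by (rule abs_le_square_iff[THEN iffD1, OF order_trans[OF _ abs_ge_self]])
      then show ?case by (simp add: power_mult_distrib mult_right_mono)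
    qed
  qed (use assms in \<open>auto intro!: L2_sq_integrable L2_mult_bounded\<close>)
  then show "(L2norm l (\<lambda>x. a x * f x))\<^sup>2 \<le> (C * L2norm l f)\<^sup>2"
    by (simp add: L2norm_power2 power_mult_distrib)
qed (use assms in simp)

lemma L2norm_zero_imp_AE:
  assumes "f \<in> L2 l" "g \<in> L2 l" "dist2 l f g = 0"
  shows "AE x in leb l. f x = g x"
proof -
  have "(\<integral>x. (f x - g x)\<^sup>2 \<partial>leb l) = 0"
    using assms(3) by (simp add: L2norm_def)
  then have "AE x in leb l. (f x - g x)\<^sup>2 = 0"
    using integral_nonneg_eq_0_iff_AE[of "leb l" "\<lambda>x. (f x - g x)\<^sup>2"] L2_sq_integrable[OF L2_diff[OF assms(1,2)]] by simp
  then show ?thesis by simp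
qed

section \<open>Test functions\<close>

text \<open>Smoothness of finite order, so that closure under products and substitutions can be
  proved by induction on the order; \<open>test_function\<close> asks for all orders at
  once.\<close>

definition smooth_upto :: "nat \<Rightarrow> (real \<Rightarrow> real) \<Rightarrow> bool" where
  "smooth_upto n f \<longleftrightarrow> (\<forall>m\<le>n. (deriv ^^ m) f differentiable_on UNIV)"

lemma smooth_upto_0: "smooth_upto 0 f \<longleftrightarrow> f differentiable_on UNIV"
  by (simp add: smooth_upto_def)

lemma smooth_upto_Suc: "smooth_upto (Suc n) f \<longleftrightarrow> f differentiable_on UNIV \<and> smooth_upto n (deriv f)"
proof -
  have "(\<forall>m\<le>Suc n. P m) \<longleftrightarrow> P 0 \<and> (\<forall>m\<le>n. P (Suc m))" for P :: "nat \<Rightarrow> bool"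
    by (metis Suc_le_mono le0 not0_implies_Suc)
  then show ?thesis
    unfolding smooth_upto_def by (simp del: funpow.simps add: funpow_Suc_right)
qed

lemma smooth_upto_lower: "smooth_upto (Suc n) f \<Longrightarrow> smooth_upto n f"
  by (simp add: smooth_upto_def)

lemma smooth_upto_differentiable: "smooth_upto n f \<Longrightarrow> f differentiable_on UNIV"
  by (auto simp: smooth_upto_def dest!: spec[of _ 0])

lemma differentiable_on_UNIV_DERIV:
  "f differentiable_on UNIV \<longleftrightarrow> (\<forall>x::real. (f has_real_derivative deriv f x) (at x))"
  by (metis DERIV_deriv_iff_real_differentiable differentiable_on_def iso_tuple_UNIV_I)

lemma differentiable_on_UNIV_I:
  "(\<And>x::real. (f has_real_derivative f' x) (at x)) \<Longrightarrow> f differentiable_on UNIV"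
  by (metis DERIV_imp_deriv differentiable_on_UNIV_DERIV)

lemma deriv_eqI: "(\<And>x::real. (f has_real_derivative f' x) (at x)) \<Longrightarrow> deriv f = f'"
  by (rule ext) (rule DERIV_imp_deriv)

lemma smooth_upto_add:
  "smooth_upto n f \<Longrightarrow> smooth_upto n g \<Longrightarrow> smooth_upto n (\<lambda>x. f x + g x)"
proof (induction n arbitrary: f g)
  case 0
  then show ?case by (auto simp: smooth_upto_0 intro: differentiable_on_add)
next
  case (Suc n)
  have "(f has_real_derivative deriv f x) (at x)" "(g has_real_derivative deriv g x) (at x)" for x
    using Suc.prems by (auto simp: smooth_upto_Suc differentiable_on_UNIV_DERIV)
  then have D: "((\<lambda>x. f x + g x) has_real_derivative deriv f x + deriv g x) (at x)" for x
    by (auto intro: derivative_intros)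
  then have "deriv (\<lambda>x. f x + g x) = (\<lambda>x. deriv f x + deriv g x)"
    by (rule deriv_eqI)
  then show ?case
    using Suc differentiable_on_UNIV_I[OF D] by (simp add: smooth_upto_Suc)
qed

lemma smooth_upto_mult:
  "smooth_upto n f \<Longrightarrow> smooth_upto n g \<Longrightarrow> smooth_upto n (\<lambda>x. f x * g x)"
proof (induction n arbitrary: f g)
  case 0
  then show ?case by (auto simp: smooth_upto_0 intro: differentiable_on_mult)
next
  case (Suc n)
  have "(f has_real_derivative deriv f x) (at x)" "(g has_real_derivative deriv g x) (at x)" for x
    using Suc.prems by (auto simp: smooth_upto_Suc differentiable_on_UNIV_DERIV)
  then have D: "((\<lambda>x. f x * g x) has_real_derivative deriv f x * g x + f x * deriv g x) (at x)" for x
    by (auto intro!: derivative_eq_intros)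
  then have "deriv (\<lambda>x. f x * g x) = (\<lambda>x. deriv f x * g x + f x * deriv g x)"
    by (rule deriv_eqI)
  moreover have "smooth_upto n (\<lambda>x. deriv f x * g x + f x * deriv g x)"
    using Suc by (intro smooth_upto_add Suc.IH) (auto simp: smooth_upto_Suc intro: smooth_upto_lower)
  ultimately show ?case
    using differentiable_on_UNIV_I[OF D] by (simp add: smooth_upto_Suc)
qed

lemma smooth_upto_const: "smooth_upto n (\<lambda>x. c)"
proof (induction n arbitrary: c)
  case 0
  then show ?case by (simp add: smooth_upto_0)
next
  case (Suc n)
  have "deriv (\<lambda>x::real. c) = (\<lambda>x. 0)" by (rule deriv_eqI) auto
  with Suc show ?case by (simp add: smooth_upto_Suc)
qed

lemma smooth_upto_affine:
  "smooth_upto n f \<Longrightarrow> smooth_upto n (\<lambda>x. f (a * x + c))"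
proof (induction n arbitrary: f)
  case 0
  then have "(f has_real_derivative deriv f x) (at x)" for x
    by (auto simp: smooth_upto_0 differentiable_on_UNIV_DERIV)
  then have "((\<lambda>x. f (a * x + c)) has_real_derivative deriv f (a * x + c) * a) (at x)" for x
    by (auto intro!: derivative_eq_intros DERIV_chain2[where f = f])
  then show ?case unfolding smooth_upto_0 by (rule differentiable_on_UNIV_I)
next
  case (Suc n)
  have "(f has_real_derivative deriv f x) (at x)" for x
    using Suc.prems by (auto simp: smooth_upto_Suc differentiable_on_UNIV_DERIV)
  then have D: "((\<lambda>x. f (a * x + c)) has_real_derivative deriv f (a * x + c) * a) (at x)" for x
    by (auto intro!: derivative_eq_intros DERIV_chain2[where f = f])
  then have "deriv (\<lambda>x. f (a * x + c)) = (\<lambda>x. deriv f (a * x + c) * a)"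
    by (rule deriv_eqI)
  then show ?case
    using Suc differentiable_on_UNIV_I[OF D] by (auto simp: smooth_upto_Suc intro: smooth_upto_mult smooth_upto_const)
qed

text \<open>The classical smooth function exp(-1/x), extended by zero, with a polynomial in 1/x as a
  factor. The factor makes the family closed under differentiation, so a single induction gives
  smoothness.\<close>

definition flat :: "real poly \<Rightarrow> real \<Rightarrow> real" where
  "flat p x = (if 0 < x then poly p (1 / x) * exp (- (1 / x)) else 0)"

text \<open>With y = 1/x this is the flatness of every \<open>flat p\<close> at 0 from the
  right.\<close>

lemma poly_div_exp_tendsto_0: "((\<lambda>y::real. poly p y * exp (- y)) \<longlongrightarrow> 0) at_top"
proof (induction p)
  case 0
  then show ?case by simp
next
  case (pCons a p)
  have "((\<lambda>y::real. poly p y * y * exp (- y)) \<longlongrightarrow> 0) at_top" for p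
  proof -
    have "poly p y * y * exp (- y) = (\<Sum>i\<le>degree p. coeff p i * (y ^ Suc i / exp y))" for y :: real
      by (simp add: poly_altdef sum_distrib_right sum_distrib_left exp_minus divide_simps ac_simps)
    moreover have "((\<lambda>y::real. \<Sum>i\<le>degree p. coeff p i * (y ^ Suc i / exp y)) \<longlongrightarrow> (\<Sum>i\<le>degree p. coeff p i * 0)) at_top"
      by (intro tendsto_sum tendsto_mult tendsto_const tendsto_power_div_exp_0)
    ultimately show ?thesis by simp
  qed
  moreover have "((\<lambda>y::real. a * (y ^ 0 / exp y)) \<longlongrightarrow> a * 0) at_top"
    by (intro tendsto_mult tendsto_const tendsto_power_div_exp_0)
  ultimately have "((\<lambda>y::real. a * (y ^ 0 / exp y) + poly p y * y * exp (- y)) \<longlongrightarrow> 0 + 0) at_top"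
    by (intro tendsto_add) auto
  moreover have "(\<lambda>y::real. poly (pCons a p) y * exp (- y)) = (\<lambda>y. a * (y ^ 0 / exp y) + poly p y * y * exp (- y))"
    by (auto simp: fun_eq_iff exp_minus divide_simps algebra_simps)
  ultimately show ?case by simp
qed

text \<open>With y = 1/x, the chain rule gives y^2 (p(y) - p'(y)) exp(-y) on the positive half line,
  and \<open>[:0, 0, 1:]\<close> is the polynomial y^2.\<close>

lemma flat_has_derivative:
  "(flat p has_real_derivative flat ([:0, 0, 1:] * (p - pderiv p)) x) (at x)"
proof (cases x "0::real" rule: linorder_cases)
  case less
  have "((\<lambda>x. 0) has_real_derivative 0) (at x)" by simp
  moreover have "\<forall>\<^sub>F y in nhds x. (0::real) = flat p y"
    using less eventually_nhds_in_open[of "{..<0}" x] by (auto simp: flat_def elim!: eventually_mono)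
  ultimately have "(flat p has_real_derivative 0) (at x)"
    by (subst (asm) DERIV_cong_ev[OF refl _ refl])
  with less show ?thesis by (simp add: flat_def)
next
  case greater
  define D where "D = flat ([:0, 0, 1:] * (p - pderiv p)) x"
  have "((\<lambda>x. poly p (1 / x) * exp (- (1 / x))) has_real_derivative D) (at x)"
    unfolding D_def flat_def using greater
    by (auto intro!: derivative_eq_intros DERIV_chain2[OF poly_DERIV] simp: field_simps power2_eq_square)
  moreover have "\<forall>\<^sub>F y in nhds x. poly p (1 / y) * exp (- (1 / y)) = flat p y"
    using greater eventually_nhds_in_open[of "{0<..}" x] by (auto simp: flat_def elim!: eventually_mono)
  ultimately show ?thesis
    unfolding D_def by (subst (asm) DERIV_cong_ev[OF refl _ refl])
next
  case equal
  \<comment> \<open>From the right the difference quotient at 0 is y p(y) exp(-y) with y = 1/h,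
    again a polynomial times a decaying exponential.\<close>
  have "((\<lambda>h. flat p h / h) \<longlongrightarrow> 0) (at_right 0)"
  proof -
    have "((\<lambda>h. poly ([:0, 1:] * p) (inverse h) * exp (- inverse h)) \<longlongrightarrow> 0) (at_right 0)"
      by (rule filterlim_compose[OF poly_div_exp_tendsto_0 filterlim_inverse_at_top_right])
    moreover have "\<forall>\<^sub>F h in at_right 0. poly ([:0, 1:] * p) (inverse h) * exp (- inverse h) = flat p h / h"
      by (auto simp: eventually_at_filter flat_def field_simps)
    ultimately show ?thesis by (rule Lim_transform_eventually)
  qed
  moreover have "((\<lambda>h. flat p h / h) \<longlongrightarrow> 0) (at_left 0)"
    by (rule tendsto_eventually) (auto simp: eventually_at_filter flat_def)
  ultimately have "((\<lambda>h. flat p h / h) \<longlongrightarrow> 0) (at 0)"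
    by (simp add: filterlim_split_at)
  then show ?thesis using equal by (simp add: DERIV_def flat_def)
qed

lemma smooth_upto_flat: "smooth_upto n (flat p)"
proof (induction n arbitrary: p)
  case 0
  show ?case using flat_has_derivative by (auto simp: smooth_upto_0 intro: differentiable_on_UNIV_I)
next
  case (Suc n)
  have "deriv (flat p) = flat ([:0, 0, 1:] * (p - pderiv p))"
    by (rule deriv_eqI) (rule flat_has_derivative)
  with Suc show ?case using flat_has_derivative by (auto simp: smooth_upto_Suc intro: differentiable_on_UNIV_I)
qed

lemma test_function_iff:
  "test_function b \<phi> \<longleftrightarrow> (\<forall>n. smooth_upto n \<phi>) \<and> (\<exists>c d. 0 < c \<and> d < b \<and> (\<forall>x. x \<notin> {c..d} \<longrightarrow> \<phi> x = 0))"
  unfolding test_function_def smooth_upto_def by auto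

lemma test_functionI:
  assumes "\<And>n. smooth_upto n \<phi>" "0 < c" "d < b" "\<And>x. x \<notin> {c..d} \<Longrightarrow> \<phi> x = 0"
  shows "test_function b \<phi>"
  using assms unfolding test_function_iff by blast

lemma test_function_bounds:
  assumes "test_function b \<phi>" "0 < b"
  obtains c d where "0 < c" "c < d" "d < b" "\<And>x. x \<notin> {c..d} \<Longrightarrow> \<phi> x = 0"
proof -
  from assms obtain c d where cd: "0 < c" "d < b" "\<And>x. x \<notin> {c..d} \<Longrightarrow> \<phi> x = 0"
    by (auto simp: test_function_def)
  \<comment> \<open>The interval \<open>{c..d}\<close> in the definition may be empty;
    \<open>b / 3\<close> and \<open>b / 2\<close> widen it to a proper one.\<close>
  show ?thesis
  proof (rule that[of "min c (b / 3)" "max d (b / 2)"])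
    show "\<phi> x = 0" if "x \<notin> {min c (b / 3)..max d (b / 2)}" for x
      using that by (intro cd(3)) (auto simp: min_def max_def split: if_splits)
  qed (use cd assms in auto)
qed

lemma test_function_deriv:
  assumes "test_function b \<phi>"
  shows "test_function b (deriv \<phi>)"
proof -
  from assms obtain c d where cd: "0 < c" "d < b" "\<And>x. x \<notin> {c..d} \<Longrightarrow> \<phi> x = 0"
    by (auto simp: test_function_def)
  have "deriv \<phi> x = 0" if "x \<notin> {c..d}" for x
  proof -
    have "\<forall>\<^sub>F y in nhds x. y \<in> - {c..d}"
      using that by (intro eventually_nhds_in_open) auto
    then have "\<forall>\<^sub>F y in nhds x. \<phi> y = 0"
      by (rule eventually_mono) (use cd in auto)
    then have "deriv \<phi> x = deriv (\<lambda>y. 0) x"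
      by (intro deriv_cong_ev) auto
    then show ?thesis by simp
  qed
  then show ?thesis
    using assms cd unfolding test_function_iff by (meson smooth_upto_Suc)
qed

lemma test_function_DERIV:
  "test_function b \<phi> \<Longrightarrow> (\<phi> has_real_derivative deriv \<phi> x) (at x)"
  unfolding test_function_iff by (meson smooth_upto_differentiable differentiable_on_UNIV_DERIV)

lemma test_function_continuous: "test_function b \<phi> \<Longrightarrow> continuous_on A \<phi>"
  by (meson DERIV_continuous_on has_field_derivative_at_within test_function_DERIV)

lemma test_function_lincomb:
  assumes "test_function b \<phi>" "test_function b \<psi>"
  shows "test_function b (\<lambda>x. s * \<phi> x + t * \<psi> x)"
proof -
  from assms obtain c d c' d' where cd: "0 < c" "d < b" "\<And>x. x \<notin> {c..d} \<Longrightarrow> \<phi> x = 0"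
     "0 < c'" "d' < b" "\<And>x. x \<notin> {c'..d'} \<Longrightarrow> \<psi> x = 0"
    by (auto simp: test_function_def)
  have "s * \<phi> x + t * \<psi> x = 0" if "x \<notin> {min c c'..max d d'}" for x
  proof -
    from that have "\<phi> x = 0" "\<psi> x = 0"
      by (auto intro!: cd(3,6) simp: min_def max_def split: if_splits)
    then show ?thesis by simp
  qed
  moreover have "0 < min c c'" "max d d' < b" using cd by auto
  ultimately show ?thesis
    using assms by (intro test_functionI[of _ "min c c'" "max d d'"])
      (auto simp: test_function_iff intro!: smooth_upto_add smooth_upto_mult smooth_upto_const)
qed

lemma test_function_mult:
  assumes "test_function b \<phi>" "\<And>n. smooth_upto n \<psi>"
  shows "test_function b (\<lambda>x. \<psi> x * \<phi> x)"
proof -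
  from assms obtain c d where cd: "0 < c" "d < b" "\<And>x. x \<notin> {c..d} \<Longrightarrow> \<phi> x = 0"
    by (auto simp: test_function_def)
  then show ?thesis
    using assms by (intro test_functionI[of _ c d]) (auto simp: test_function_iff intro!: smooth_upto_mult)
qed

text \<open>Two opposed copies of exp(-1/x). The shift by 1/n moves the support into the interior of
  the interval from \<open>a\<close> to \<open>c\<close>, and the scaling by n makes both factors
  tend to 1 inside, so the bumps converge pointwise to the indicator of the open interval.\<close>

definition bump :: "real \<Rightarrow> real \<Rightarrow> nat \<Rightarrow> real \<Rightarrow> real" where
  "bump a c n x = flat 1 (real n * (x - (a + 1 / real n))) * flat 1 (real n * ((c - 1 / real n) - x))"

lemma flat_one_bounds: "0 \<le> flat 1 x" "flat 1 x \<le> 1"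
  by (auto simp: flat_def)

lemma bump_bounds: "0 \<le> bump a c n x" "bump a c n x \<le> 1"
  by (auto simp: bump_def flat_one_bounds intro!: mult_nonneg_nonneg mult_le_one)

lemma bump_zero: "x \<notin> {a + 1 / real n <..< c - 1 / real n} \<Longrightarrow> bump a c n x = 0"
  by (auto simp: bump_def flat_def zero_less_mult_iff)

lemma smooth_upto_bump: "smooth_upto m (bump a c n)"
proof -
  have *: "bump a c n = (\<lambda>x. flat 1 (real n * x + (- real n * (a + 1 / real n))) * flat 1 ((- real n) * x + real n * (c - 1 / real n)))"
    by (auto simp: bump_def fun_eq_iff algebra_simps)
  show ?thesis unfolding * by (intro smooth_upto_mult smooth_upto_affine smooth_upto_flat)
qed

lemma test_function_bump:
  assumes "0 \<le> a" "c \<le> b" "0 < b"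
  shows "test_function b (bump a c n)"
proof (cases "n = 0")
  case True
  \<comment> \<open>Division by zero leaves the support unshifted here, but both factors are
    \<open>flat 1 0 = 0\<close>.\<close>
  then have "bump a c n = (\<lambda>x. 0)" by (auto simp: bump_def flat_def)
  then show ?thesis
    using assms by (auto simp: test_function_iff smooth_upto_const intro!: exI[of _ "b/2"])
next
  case False
  have "bump a c n x = 0" if "x \<notin> {a + 1 / real n .. c - 1 / real n}" for x
    using that by (intro bump_zero) auto
  moreover have "0 < a + 1 / real n" "c - 1 / real n < b"
  proof -
    have "0 < 1 / real n" using False by simp
    then show "0 < a + 1 / real n" "c - 1 / real n < b" using assms by linarith+
  qed
  ultimately show ?thesis using smooth_upto_bump by (intro test_functionI[of _ "a + 1 / real n" "c - 1 / real n"])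
qed

lemma flat_one_tendsto:
  assumes "0 < y"
  shows "(\<lambda>n. flat 1 (real n * (y - 1 / real n))) \<longlonglongrightarrow> 1"
proof -
  have lim: "LIM n sequentially. -1 + y * real n :> at_top"
    by (rule filterlim_tendsto_add_at_top[OF tendsto_const] filterlim_tendsto_pos_mult_at_top[OF tendsto_const assms] filterlim_real_sequentially)+
  have "(\<lambda>n. exp (- inverse (-1 + y * real n))) \<longlonglongrightarrow> exp (- 0)"
    by (intro tendsto_exp tendsto_minus tendsto_inverse_0_at_top lim)
  moreover have "\<forall>\<^sub>F n in sequentially. exp (- inverse (-1 + y * real n)) = flat 1 (real n * (y - 1 / real n))"
    using filterlim_at_top_dense[THEN iffD1, OF lim, rule_format, of 0] eventually_gt_at_top[of 0]
    by eventually_elim (auto simp: flat_def field_simps)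
  ultimately show ?thesis by (simp add: tendsto_cong)
qed

lemma bump_tendsto: "(\<lambda>n. bump a c n x) \<longlonglongrightarrow> indicator {a<..<c} x"
proof (cases "x \<in> {a<..<c}")
  case True
  have "(\<lambda>n. flat 1 (real n * ((x - a) - 1 / real n)) * flat 1 (real n * ((c - x) - 1 / real n))) \<longlonglongrightarrow> 1 * 1"
    using True by (intro tendsto_mult flat_one_tendsto) auto
  then show ?thesis using True by (simp add: bump_def algebra_simps)
next
  case False
  have "bump a c n x = 0" for n
  proof -
    have "0 \<le> 1 / real n" by simp
    then have "x \<notin> {a + 1 / real n <..< c - 1 / real n}"
      using False unfolding greaterThanLessThan_iff by linarith
    then show ?thesis by (rule bump_zero)
  qed
  then show ?thesis using False by simp
qed

section \<open>Test functions as a dense class\<close>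

lemma continuous_measurable_leb:
  fixes f :: "real \<Rightarrow> real"
  assumes "continuous_on {0<..<b} f" shows "f \<in> borel_measurable (leb b)"
  by (rule continuous_imp_measurable_on_sets_lebesgue[OF assms]) simp

lemma test_function_measurable: "test_function b \<phi> \<Longrightarrow> \<phi> \<in> borel_measurable (leb c)"
  by (intro continuous_measurable_leb test_function_continuous)

lemma test_function_bounded:
  assumes "test_function b \<phi>"
  obtains C where "\<And>x. \<bar>\<phi> x\<bar> \<le> C" "0 \<le> C"
proof -
  from assms obtain c d where cd: "\<And>x. x \<notin> {c..d} \<Longrightarrow> \<phi> x = 0"
    by (auto simp: test_function_def)
  have "bounded (\<phi> ` {c..d})"
    by (intro compact_imp_bounded compact_continuous_image test_function_continuous[OF assms]) auto
  then obtain C where C: "\<And>x. x \<in> {c..d} \<Longrightarrow> \<bar>\<phi> x\<bar> \<le> C"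
    by (auto simp: bounded_iff simp del: atLeastAtMost_iff)
  have "\<bar>\<phi> x\<bar> \<le> max C 0" for x
    using C[of x] cd[of x] by (cases "x \<in> {c..d}") auto
  then show ?thesis by (rule that) simp
qed

lemma test_function_L2:
  assumes "test_function b \<phi>" shows "\<phi> \<in> L2 c"
proof -
  obtain C where "\<And>x. \<bar>\<phi> x\<bar> \<le> C" by (rule test_function_bounded[OF assms]) blast
  then show ?thesis by (intro L2_bounded[where C = C] test_function_measurable[OF assms]) simp
qed

text \<open>Density of test functions in the form of an induction rule. Bumps reach the open
  intervals, which are stable under intersection and generate the Borel sets, so Dynkin's argument
  covers all Borel sets. The hypotheses \<open>lin\<close> and \<open>lim\<close> carry uniform
  bounds, so that dominated convergence with a constant majorant can discharge them.\<close>

lemma indicator_density_induct: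
  fixes P :: "(real \<Rightarrow> real) \<Rightarrow> bool"
  assumes b: "0 < b" and A: "A \<in> sets (leb b)"
    and test: "\<And>\<phi>. test_function b \<phi> \<Longrightarrow> P \<phi>"
    and lin: "\<And>f g s t C. f \<in> borel_measurable (leb b) \<Longrightarrow> g \<in> borel_measurable (leb b) \<Longrightarrow>
        (\<And>x. \<bar>f x\<bar> \<le> C) \<Longrightarrow> (\<And>x. \<bar>g x\<bar> \<le> C) \<Longrightarrow> P f \<Longrightarrow> P g \<Longrightarrow> P (\<lambda>x. s * f x + t * g x)"
    and lim: "\<And>f F C. (\<And>i::nat. F i \<in> borel_measurable (leb b)) \<Longrightarrow> (\<And>i x. \<bar>F i x\<bar> \<le> C) \<Longrightarrow>
        (\<And>i. P (F i)) \<Longrightarrow> f \<in> borel_measurable (leb b) \<Longrightarrow> (\<And>x. \<bar>f x\<bar> \<le> C) \<Longrightarrow>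
        AE x in leb b. (\<lambda>i. F i x) \<longlonglongrightarrow> f x \<Longrightarrow> P f"
  shows "P (indicator A)"
proof -
  define I where "I = {0<..<b}"
  define G where "G = range (\<lambda>(a, c). {a<..<c::real})"
  define Q where "Q A = P (indicator (A \<inter> I))" for A
  have ind_meas [simp]: "(indicator (A \<inter> I) :: real \<Rightarrow> real) \<in> borel_measurable (leb b)" if "A \<in> sets borel" for A
    using that by (intro borel_measurable_indicator) (auto simp: sets_restrict_space I_def)
  have ind_le: "\<bar>indicator A x :: real\<bar> \<le> 1" for A and x :: real
    by (auto split: split_indicator)
  have interval: "P (indicator {a<..<c})" if "0 \<le> a" "c \<le> b" for a c
  proof (rule lim)
    show "P (bump a c i)" for i
      using that b by (intro test test_function_bump)
    show "bump a c i \<in> borel_measurable (leb b)" for i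
      using that b test_function_bump test_function_measurable by blast
    show "AE x in leb b. (\<lambda>i. bump a c i x) \<longlonglongrightarrow> indicator {a<..<c} x"
      by (simp add: bump_tendsto)
    show "\<bar>bump a c i x\<bar> \<le> 1" for i x
      using bump_bounds[of a c i x] by auto
    have "{a<..<c} \<inter> I = {a<..<c}" using that by (auto simp: I_def)
    with ind_meas[of "{a<..<c}"] show "(indicator {a<..<c} :: real \<Rightarrow> real) \<in> borel_measurable (leb b)" by simp
  qed (rule ind_le)
  have Q_interval: "Q {a<..<c}" for a c
  proof -
    have "{a<..<c} \<inter> I = {max a 0<..<min c b}" by (auto simp: I_def)
    then show ?thesis unfolding Q_def by (simp add: interval)
  qed
  have Q_borel: "Q B" if "B \<in> sets borel" for B
  proof -
    have B: "B \<in> sigma_sets UNIV G"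
      using that by (simp add: borel_eq_box G_def box_real case_prod_beta)
    have sets: "C \<in> sets borel" if "C \<in> sigma_sets UNIV G" for C
      using that by (simp add: borel_eq_box G_def box_real case_prod_beta)
    have "Int_stable G"
    proof (rule Int_stableI)
      fix A B assume "A \<in> G" "B \<in> G"
      then obtain a c a' c' where "A = {a<..<c}" "B = {a'<..<c'}" by (auto simp: G_def)
      then have "A \<inter> B = {max a a'<..<min c c'}" by auto
      then show "A \<inter> B \<in> G" by (auto simp: G_def)
    qed
    moreover have subset_Pow_UNIV: "G \<subseteq> Pow UNIV" by simp
    ultimately show ?thesis
      using B
    proof (induction rule: sigma_sets_induct_disjoint)
      case (basic A) then show ?case using Q_interval by (auto simp: G_def)
    next
      case empty
      have "P (indicator {b<..<b})" using b by (intro interval) auto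
      then show ?case by (simp add: Q_def)
    next
      case (compl A)
      have "P (\<lambda>x. 1 * indicator (UNIV \<inter> I) x + (-1) * indicator (A \<inter> I) x)"
      proof (rule lin[where C = 1])
        show "P (indicator (UNIV \<inter> I))" using interval[of 0 b] by (simp add: I_def)
        show "P (indicator (A \<inter> I))" using compl(2) by (simp add: Q_def)
        show "(indicator (A \<inter> I) :: real \<Rightarrow> real) \<in> borel_measurable (leb b)"
          by (rule ind_meas[OF sets[OF compl(1)]])
        show "(indicator (UNIV \<inter> I) :: real \<Rightarrow> real) \<in> borel_measurable (leb b)"
          by (rule ind_meas) simp
      qed (rule ind_le)+
      moreover have "(\<lambda>x. 1 * indicator (UNIV \<inter> I) x + (-1) * indicator (A \<inter> I) x) = (indicator ((UNIV - A) \<inter> I) :: real \<Rightarrow> real)"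
        by (auto simp: fun_eq_iff split: split_indicator)
      ultimately show ?case by (simp add: Q_def)
    next
      case (union A)
      have s: "A i \<in> sets borel" for i using union(2) by (intro sets) auto
      \<comment> \<open>A countable disjoint union is the bounded pointwise limit of finite ones,
        and these are sums of indicators.\<close>
      have "Q (\<Union>i<n. A i)" for n
      proof (induction n)
        case 0
        have "P (indicator {b<..<b})" using b by (intro interval) auto
        then show ?case by (simp add: Q_def)
      next
        case (Suc n)
        have "P (\<lambda>x. 1 * indicator ((\<Union>i<n. A i) \<inter> I) x + 1 * indicator (A n \<inter> I) x)"
        proof (rule lin[where C = 1])
          show "P (indicator ((\<Union>i<n. A i) \<inter> I))" using Suc by (simp add: Q_def)
          show "P (indicator (A n \<inter> I))" using union(3)[of n] by (simp add: Q_def)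
          show "(indicator ((\<Union>i<n. A i) \<inter> I) :: real \<Rightarrow> real) \<in> borel_measurable (leb b)"
            using s by (intro ind_meas) auto
        qed (rule ind_le ind_meas s)+
        moreover have "(\<Union>i<n. A i) \<inter> A n = {}"
        proof -
          have "A i \<inter> A n = {}" if "i < n" for i
            using union(1) that unfolding disjoint_family_on_def by auto
          then show ?thesis by auto
        qed
        then have "(\<lambda>x. 1 * indicator ((\<Union>i<n. A i) \<inter> I) x + 1 * indicator (A n \<inter> I) x) = (indicator ((\<Union>i<Suc n. A i) \<inter> I) :: real \<Rightarrow> real)"
          by (auto simp: fun_eq_iff lessThan_Suc split: split_indicator)
        ultimately show ?case by (simp add: Q_def)
      qed
      then show ?case
        unfolding Q_def
      proof (rule lim[rotated 2])
        have "(\<lambda>n. indicator (\<Union>i<n. A i) x * indicator I x) \<longlonglongrightarrow> (indicator (\<Union>i. A i) x * indicator I x :: real)" for x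
          by (intro tendsto_mult LIMSEQ_indicator_UN tendsto_const)
        then show "AE x in leb b. (\<lambda>n. indicator ((\<Union>i<n. A i) \<inter> I) x) \<longlonglongrightarrow> (indicator ((\<Union>i. A i) \<inter> I) x :: real)"
          by (simp add: indicator_inter_arith)
        show "(indicator ((\<Union>i<n. A i) \<inter> I) :: real \<Rightarrow> real) \<in> borel_measurable (leb b)" for n
          using s by (intro ind_meas) auto
        show "(indicator ((\<Union>i. A i) \<inter> I) :: real \<Rightarrow> real) \<in> borel_measurable (leb b)"
          using s by (intro ind_meas) auto
      qed (rule ind_le)+
    qed
  qed
  obtain A' where A': "A' \<in> sets lebesgue" "A = A' \<inter> I"
    using A by (auto simp: sets_restrict_space I_def)
  \<comment> \<open>A Lebesgue set is a Borel set up to a null set; a constant sequence in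
    \<open>lim\<close> passes from the indicator of the one to that of the other.\<close>
  then obtain S N N' where SN: "A' = S \<union> N" "N \<subseteq> N'" "N' \<in> null_sets lborel" "S \<in> sets lborel"
    by (auto elim: sets_completionE)
  have "AE x in lebesgue. x \<notin> N'"
    using SN(3) by (intro AE_not_in) (auto intro: null_sets_completionI)
  then have "AE x in leb b. x \<notin> N'"
    by (auto simp: AE_restrict_space_iff elim: eventually_mono)
  then have "AE x in leb b. (\<lambda>i::nat. indicator (S \<inter> I) x) \<longlonglongrightarrow> (indicator A x :: real)"
    by eventually_elim (use SN A' in \<open>auto split: split_indicator\<close>)
  moreover have "P (indicator (S \<inter> I))" using Q_borel[of S] SN by (simp add: Q_def)
  moreover have "(indicator (S \<inter> I) :: real \<Rightarrow> real) \<in> borel_measurable (leb b)"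
    using SN by (intro ind_meas) simp
  ultimately show ?thesis
    by (rule_tac lim[OF _ ind_le _ borel_measurable_indicator[OF A] ind_le])
qed

text \<open>The closure condition \<open>lim\<close> asks for almost everywhere convergence under
  one majorant in \<open>L2 b\<close>. That is weaker than closure under norm limits, and it is
  checked directly by dominated convergence.\<close>

lemma L2_density_induct:
  fixes P :: "(real \<Rightarrow> real) \<Rightarrow> bool"
  assumes b: "0 < b" and \<psi>: "\<psi> \<in> L2 b"
    and test: "\<And>\<phi>. test_function b \<phi> \<Longrightarrow> P \<phi>"
    and lin: "\<And>f g s t. f \<in> L2 b \<Longrightarrow> g \<in> L2 b \<Longrightarrow> P f \<Longrightarrow> P g \<Longrightarrow> P (\<lambda>x. s * f x + t * g x)"
    and lim: "\<And>f F M. (\<And>i::nat. F i \<in> L2 b) \<Longrightarrow> M \<in> L2 b \<Longrightarrow> (\<And>i x. x \<in> {0<..<b} \<Longrightarrow> \<bar>F i x\<bar> \<le> M x) \<Longrightarrow>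
        (\<And>i. P (F i)) \<Longrightarrow> f \<in> L2 b \<Longrightarrow> AE x in leb b. (\<lambda>i. F i x) \<longlonglongrightarrow> f x \<Longrightarrow> P f"
  shows "P \<psi>"
proof -
  have bL2: "f \<in> L2 b" if "f \<in> borel_measurable (leb b)" "\<And>x. \<bar>f x\<bar> \<le> C" for f C
    using that by (intro L2_bounded) auto
  have ind: "P (indicator A)" if A: "A \<in> sets (leb b)" for A
    using b A test
  proof (rule indicator_density_induct)
    fix f g s t C
    assume f: "f \<in> borel_measurable (leb b)" and g: "g \<in> borel_measurable (leb b)"
      and b: "\<And>x. \<bar>f x\<bar> \<le> C" "\<And>x. \<bar>g x\<bar> \<le> C" and P: "P f" "P g"
    show "P (\<lambda>x. s * f x + t * g x)" by (rule lin[OF bL2[OF f b(1)] bL2[OF g b(2)] P])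
  next
    fix f F and C :: real
    assume F: "\<And>i::nat. F i \<in> borel_measurable (leb b)" "\<And>i x. \<bar>F i x\<bar> \<le> C" "\<And>i. P (F i)"
      and f: "f \<in> borel_measurable (leb b)" "\<And>x. \<bar>f x\<bar> \<le> C" "AE x in leb b. (\<lambda>i. F i x) \<longlonglongrightarrow> f x"
    show "P f" by (rule lim[OF bL2[OF F(1,2)] L2_const F(2,3) bL2[OF f(1,2)] f(3)])
  qed
  have "(indicator {} :: real \<Rightarrow> real) = (\<lambda>x. 0)" by (auto simp: fun_eq_iff)
  then have zero: "P (\<lambda>x. 0)" using ind[of "{}"] by simp
  \<comment> \<open>Membership in \<open>L2 b\<close> is a premise inside the induction: summands
    and monotone approximations inherit it because the function itself dominates them.\<close>
  have nonneg: "u \<in> L2 b \<longrightarrow> P u" if "u \<in> borel_measurable (leb b)" "\<And>x. 0 \<le> u x" for u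
    using that
  proof (induction rule: borel_measurable_induct_real)
    case (set A) then show ?case using ind by simp
  next
    case (mult u c)
    show ?case
    proof (cases "c = 0")
      case True then show ?thesis using zero by simp
    next
      case False
      show ?thesis
      proof
        assume cu: "(\<lambda>x. c * u x) \<in> L2 b"
        have u: "u \<in> L2 b" using L2_scale[OF cu, of "1 / c"] False by simp
        with mult have "P u" by simp
        with u lin[of u u c 0] show "P (\<lambda>x. c * u x)" by simp
      qed
    qed
  next
    case (add u v)
    show ?case
    proof
      assume uv: "(\<lambda>x. v x + u x) \<in> L2 b"
      have sm: "w \<in> L2 b" if w: "w \<in> borel_measurable (leb b)" "\<And>x. 0 \<le> w x" "\<And>x. w x \<le> v x + u x" for w
      proof -
        have "integrable (leb b) (\<lambda>x. (w x)\<^sup>2)"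
          by (rule Bochner_Integration.integrable_bound[OF L2_sq_integrable[OF uv]])
             (use w in \<open>auto intro!: power_mono AE_I2\<close>)
        with w show ?thesis by (simp add: L2_def)
      qed
      have "u \<in> L2 b" "v \<in> L2 b" using add by (auto intro!: sm)
      with add lin[of v u 1 1] show "P (\<lambda>x. v x + u x)" by simp
    qed
  next
    case (seq U)
    show ?case
    proof
      assume u: "u \<in> L2 b"
      have le: "U i x \<le> u x" if "x \<in> {0<..<b}" for i x
      proof -
        have "incseq (\<lambda>i. U i x)" using \<open>incseq U\<close> by (auto simp: incseq_def le_fun_def)
        moreover have "(\<lambda>i. U i x) \<longlonglongrightarrow> u x" using seq that by simp
        ultimately show ?thesis by (rule incseq_le)
      qed
      have UL2: "U i \<in> L2 b" for i
      proof -
        have "integrable (leb b) (\<lambda>x. (U i x)\<^sup>2)"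
          by (rule Bochner_Integration.integrable_bound[OF L2_sq_integrable[OF u]])
             (use seq le in \<open>auto intro!: power_mono AE_I2\<close>)
        with seq show ?thesis by (simp add: L2_def)
      qed
      show "P u"
        by (rule lim[of U u u, OF UL2 u _ _ u]) (use seq UL2 le in auto)
    qed
  qed
  \<comment> \<open>Positive and negative part, both dominated by \<psi> in absolute value.\<close>
  define p n where "p = (\<lambda>x. max 0 (\<psi> x))" and "n = (\<lambda>x. max 0 (- \<psi> x))"
  have pm: "p \<in> borel_measurable (leb b)" "n \<in> borel_measurable (leb b)"
    using L2_measurable[OF \<psi>] by (auto simp: p_def n_def)
  have pn: "p \<in> L2 b" "n \<in> L2 b"
  proof -
    have "integrable (leb b) (\<lambda>x. (p x)\<^sup>2)" "integrable (leb b) (\<lambda>x. (n x)\<^sup>2)"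
      by (rule Bochner_Integration.integrable_bound[OF L2_sq_integrable[OF \<psi>]];
          use pm in \<open>auto simp: p_def n_def max_def\<close>)+
    with pm show "p \<in> L2 b" "n \<in> L2 b" by (auto simp: L2_def)
  qed
  have "P (\<lambda>x. 1 * p x + (-1) * n x)"
  proof (rule lin[OF pn])
    show "P p" using nonneg[OF pm(1)] pn by (auto simp: p_def)
    show "P n" using nonneg[OF pm(2)] pn by (auto simp: n_def)
  qed
  moreover have "(\<lambda>x. 1 * p x + (-1) * n x) = \<psi>" by (auto simp: p_def n_def fun_eq_iff)
  ultimately show ?thesis by simp
qed

lemma integrable_leb_Icc:
  fixes f :: "real \<Rightarrow> real"
  assumes "integrable (leb b) f" "0 < c" "d < b"
  shows "integrable (lebesgue_on {c..d}) f"
proof -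
  have "integrable lebesgue (\<lambda>x. indicator {c..d} x * (if x \<in> {0<..<b} then f x else 0))"
    using Lebesgue_Measure.integrable_restrict_UNIV[THEN iffD2, OF _ assms(1)]
    by (intro integrable_mult_indicator[where 'b = real, unfolded real_scaleR_def]) simp_all
  also have "(\<lambda>x. indicator {c..d} x * (if x \<in> {0<..<b} then f x else 0)) = (\<lambda>x. if x \<in> {c..d} then f x else 0)"
    using assms by (auto simp: fun_eq_iff split: split_indicator)
  finally show ?thesis by (rule Lebesgue_Measure.integrable_restrict_UNIV[THEN iffD1, rotated]) simp
qed

lemma integrable_imp_locally_integrable: "integrable (leb b) f \<Longrightarrow> locally_integrable b f"
  by (auto simp: locally_integrable_def intro: integrable_leb_Icc)

lemma locally_integrable_mult_test:
  assumes "locally_integrable b f" "test_function b \<phi>"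
  shows "integrable (leb b) (\<lambda>x. f x * \<phi> x)"
proof -
  from assms(2) obtain c d where cd: "0 < c" "d < b" "\<And>x. x \<notin> {c..d} \<Longrightarrow> \<phi> x = 0"
    by (auto simp: test_function_def)
  obtain C where C: "\<And>x. \<bar>\<phi> x\<bar> \<le> C" using test_function_bounded[OF assms(2)] by auto
  have f: "integrable (lebesgue_on {c..d}) f" using assms cd by (auto simp: locally_integrable_def)
  have m: "\<phi> \<in> borel_measurable (lebesgue_on {c..d})"
    by (intro continuous_imp_measurable_on_sets_lebesgue test_function_continuous[OF assms(2)]) auto
  have "integrable (lebesgue_on {c..d}) (\<lambda>x. f x * \<phi> x)"
  proof (rule Bochner_Integration.integrable_bound)
    show "integrable (lebesgue_on {c..d}) (\<lambda>x. C * \<bar>f x\<bar>)" using f by auto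
    show "(\<lambda>x. f x * \<phi> x) \<in> borel_measurable (lebesgue_on {c..d})" using f m by auto
    have "\<bar>f x * \<phi> x\<bar> \<le> \<bar>C * \<bar>f x\<bar>\<bar>" for x
      using mult_left_mono[OF C[of x] abs_ge_zero[of "f x"]]
      by (intro order_trans[OF _ abs_ge_self]) (simp add: abs_mult mult.commute)
    then show "AE x in lebesgue_on {c..d}. norm (f x * \<phi> x) \<le> norm (C * \<bar>f x\<bar>)" by simp
  qed
  then have "integrable lebesgue (\<lambda>x. if x \<in> {c..d} then f x * \<phi> x else 0)"
    by (rule Lebesgue_Measure.integrable_restrict_UNIV[THEN iffD2, rotated]) simp
  also have "(\<lambda>x. if x \<in> {c..d} then f x * \<phi> x else 0) = (\<lambda>x. if x \<in> {0<..<b} then f x * \<phi> x else 0)"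
    using cd by (auto simp: fun_eq_iff)
  finally show ?thesis by (rule Lebesgue_Measure.integrable_restrict_UNIV[THEN iffD1, rotated]) simp
qed

text \<open>A locally integrable \<open>f\<close> need not be integrable, but \<open>f\<close> times
  a bump is. A bump times a test function is a test function, so the density induction shows that
  the integral of this product over every measurable set vanishes. The product is therefore zero
  almost everywhere, and the bumps tend to 1.\<close>

lemma fundamental_lemma_calculus_variations:
  assumes "0 < b" "locally_integrable b f"
    and zero: "\<And>\<phi>. test_function b \<phi> \<Longrightarrow> (ip b f \<phi>) = 0"
  shows "AE x in leb b. f x = 0"
proof -
  have "AE x in leb b. f x * bump 0 b n x = 0" for n
  proof (rule density_unique_real)
    have tb: "test_function b (bump 0 b n)" using assms(1) by (intro test_function_bump) auto
    show int: "integrable (leb b) (\<lambda>x. f x * bump 0 b n x)"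
      by (rule locally_integrable_mult_test[OF assms(2) tb])
    show "integrable (leb b) (\<lambda>x. 0 :: real)" by simp
    have ib: "integrable (leb b) (\<lambda>x. f x * bump 0 b n x * g x)"
      if "g \<in> borel_measurable (leb b)" "\<And>x. \<bar>g x\<bar> \<le> C" for g C
    proof (rule Bochner_Integration.integrable_bound)
      show "integrable (leb b) (\<lambda>x. C * \<bar>f x * bump 0 b n x\<bar>)" using int by auto
      show "(\<lambda>x. f x * bump 0 b n x * g x) \<in> borel_measurable (leb b)" using int that by auto
      have "\<bar>f x * bump 0 b n x * g x\<bar> \<le> \<bar>C * \<bar>f x * bump 0 b n x\<bar>\<bar>" for x
        using mult_left_mono[OF that(2)[of x] abs_ge_zero[of "f x * bump 0 b n x"]]
        by (intro order_trans[OF _ abs_ge_self]) (simp add: abs_mult mult.commute mult.left_commute)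
      then show "AE x in leb b. norm (f x * bump 0 b n x * g x) \<le> norm (C * \<bar>f x * bump 0 b n x\<bar>)" by simp
    qed
    fix A assume A: "A \<in> sets (leb b)"
    have "(\<integral>x. f x * bump 0 b n x * indicator A x \<partial>leb b) = 0"
      using assms(1) A
    proof (rule indicator_density_induct)
      fix \<phi> assume "test_function b \<phi>"
      then have "test_function b (\<lambda>x. bump 0 b n x * \<phi> x)"
        by (rule test_function_mult) (rule smooth_upto_bump)
      from zero[OF this] show "(\<integral>x. f x * bump 0 b n x * \<phi> x \<partial>leb b) = 0"
        by (simp add: mult.assoc)
    next
      fix h g s t C
      assume h: "h \<in> borel_measurable (leb b)" "\<And>x. \<bar>h x\<bar> \<le> C"
        and g: "g \<in> borel_measurable (leb b)" "\<And>x. \<bar>g x\<bar> \<le> C"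
        and eq: "(\<integral>x. f x * bump 0 b n x * h x \<partial>leb b) = 0" "(\<integral>x. f x * bump 0 b n x * g x \<partial>leb b) = 0"
      have "(\<integral>x. s * (f x * bump 0 b n x * h x) + t * (f x * bump 0 b n x * g x) \<partial>leb b) = 0"
        using ib[OF h] ib[OF g] eq by simp
      then show "(\<integral>x. f x * bump 0 b n x * (s * h x + t * g x) \<partial>leb b) = 0"
        by (simp add: algebra_simps)
    next
      fix h F and C :: real
      assume F: "\<And>i::nat. F i \<in> borel_measurable (leb b)" "\<And>i x. \<bar>F i x\<bar> \<le> C"
        and eq: "\<And>i. (\<integral>x. f x * bump 0 b n x * F i x \<partial>leb b) = 0"
        and h: "h \<in> borel_measurable (leb b)" "\<And>x. \<bar>h x\<bar> \<le> C" "AE x in leb b. (\<lambda>i. F i x) \<longlonglongrightarrow> h x"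
      have "(\<lambda>i. \<integral>x. f x * bump 0 b n x * F i x \<partial>leb b) \<longlonglongrightarrow> (\<integral>x. f x * bump 0 b n x * h x \<partial>leb b)"
      proof (rule integral_dominated_convergence)
        show "integrable (leb b) (\<lambda>x. C * \<bar>f x * bump 0 b n x\<bar>)" using int by auto
        show "AE x in leb b. (\<lambda>i. f x * bump 0 b n x * F i x) \<longlonglongrightarrow> f x * bump 0 b n x * h x"
          using h(3) by eventually_elim (intro tendsto_mult tendsto_const)
        have "\<bar>f x * bump 0 b n x * F i x\<bar> \<le> C * \<bar>f x * bump 0 b n x\<bar>" for x i
          using mult_left_mono[OF F(2)[of i x] abs_ge_zero[of "f x * bump 0 b n x"]]
          by (simp add: abs_mult mult.commute mult.left_commute)
        then show "AE x in leb b. norm (f x * bump 0 b n x * F i x) \<le> C * \<bar>f x * bump 0 b n x\<bar>" for i by simp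
      qed (use int F h in auto)
      then show "(\<integral>x. f x * bump 0 b n x * h x \<partial>leb b) = 0"
        by (simp add: eq LIMSEQ_const_iff)
    qed
    then show "(\<integral>x\<in>A. f x * bump 0 b n x \<partial>leb b) = (\<integral>x\<in>A. 0 \<partial>leb b)"
      by (simp add: set_lebesgue_integral_def mult.commute)
  qed
  then have "AE x in leb b. \<forall>n. f x * bump 0 b n x = 0" unfolding AE_all_countable by blast
  moreover have "f x = 0" if "\<forall>n. f x * bump 0 b n x = 0" "x \<in> {0<..<b}" for x
  proof -
    have "(\<lambda>n. f x * bump 0 b n x) \<longlonglongrightarrow> f x * indicator {0<..<b} x"
      by (intro tendsto_mult tendsto_const bump_tendsto)
    moreover have "(\<lambda>n. f x * bump 0 b n x) = (\<lambda>n. 0)" by (rule ext) (rule that(1)[rule_format])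
    ultimately show ?thesis using that by (simp add: LIMSEQ_const_iff)
  qed
  moreover have "AE x in leb b. x \<in> {0<..<b}"
    using AE_space[of "leb b"] by simp
  ultimately show ?thesis by (auto elim: eventually_elim2)
qed

section \<open>Indefinite integrals and weak derivatives\<close>

text \<open>Truncating by an indicator keeps the measure space fixed and the function total: it is 0
  to the left of 0 and constant to the right of \<open>b\<close>, so continuity holds on the whole
  line.\<close>

definition prim :: "real \<Rightarrow> (real \<Rightarrow> real) \<Rightarrow> real \<Rightarrow> real" where
  "prim b g x = (\<integral>s. indicator {..<x} s * g s \<partial>leb b)"

lemma indicator_measurable_leb:
  assumes "A \<in> sets borel"
  shows "(indicator A :: real \<Rightarrow> real) \<in> borel_measurable (leb b)"
  using assms by (intro measurable_restrict_space1 measurable_completion) simp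

lemma integrable_mult_bounded_leb:
  fixes f h :: "real \<Rightarrow> real"
  assumes "integrable (leb b) f" "h \<in> borel_measurable (leb b)" "\<And>x. x \<in> {0<..<b} \<Longrightarrow> \<bar>h x\<bar> \<le> C"
  shows "integrable (leb b) (\<lambda>x. h x * f x)"
proof (rule Bochner_Integration.integrable_bound)
  show "integrable (leb b) (\<lambda>x. C * \<bar>f x\<bar>)" using assms(1) by auto
  show "(\<lambda>x. h x * f x) \<in> borel_measurable (leb b)" using assms(1,2) by auto
  have "\<bar>h x * f x\<bar> \<le> \<bar>C * \<bar>f x\<bar>\<bar>" if "x \<in> {0<..<b}" for x
    using mult_right_mono[OF assms(3)[OF that] abs_ge_zero[of "f x"]]
    by (intro order_trans[OF _ abs_ge_self]) (simp add: abs_mult)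
  then show "AE x in leb b. norm (h x * f x) \<le> norm (C * \<bar>f x\<bar>)"
    by (intro AE_I2) simp
qed

lemma integrable_prim:
  fixes g :: "real \<Rightarrow> real"
  assumes "integrable (leb b) g"
  shows "integrable (leb b) (\<lambda>s. indicator {..<x} s * g s)"
  using assms by (rule integrable_mult_bounded_leb[where C = 1]) 
     (auto intro: indicator_measurable_leb split: split_indicator)

lemma prim_nonpos: "x \<le> 0 \<Longrightarrow> prim b g x = 0"
  unfolding prim_def by (rule integral_eq_zero_AE) (auto intro!: AE_I2 split: split_indicator)

lemma prim_full: "b \<le> x \<Longrightarrow> prim b g x = (\<integral>s. g s \<partial>leb b)"
  unfolding prim_def by (rule Bochner_Integration.integral_cong) (auto split: split_indicator)

lemma prim_cong: "(\<And>s. s \<in> {0<..<b} \<Longrightarrow> s < x \<Longrightarrow> f s = g s) \<Longrightarrow> prim b f x = prim b g x"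
  unfolding prim_def by (rule Bochner_Integration.integral_cong) (auto split: split_indicator)

lemma prim_cong_AE:
  assumes "f \<in> borel_measurable (leb b)" "g \<in> borel_measurable (leb b)" "AE s in leb b. f s = g s"
  shows "prim b f x = prim b g x"
  unfolding prim_def
  by (rule integral_cong_AE) (use assms indicator_measurable_leb[of "{..<x}" b] in auto)

lemma prim_add:
  assumes "integrable (leb b) f" "integrable (leb b) g"
  shows "prim b (\<lambda>s. f s + g s) x = prim b f x + prim b g x"
  using integrable_prim[OF assms(1), of x] integrable_prim[OF assms(2), of x]
  by (simp add: prim_def distrib_left)

lemma prim_scale: "prim b (\<lambda>s. c * f s) x = c * prim b f x"
  unfolding prim_def by (subst integral_mult_right_zero[symmetric]) (simp add: mult.left_commute)

lemma prim_diff: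
  assumes "integrable (leb b) f" "integrable (leb b) g"
  shows "prim b (\<lambda>s. f s - g s) x = prim b f x - prim b g x"
  using integrable_prim[OF assms(1), of x] integrable_prim[OF assms(2), of x]
  by (simp add: prim_def right_diff_distrib)

lemma prim_increment:
  assumes "integrable (leb b) g" "x \<le> y"
  shows "prim b g y - prim b g x = (\<integral>s. indicator {x..<y} s * g s \<partial>leb b)"
proof -
  have "prim b g y - prim b g x = (\<integral>s. indicator {..<y} s * g s - indicator {..<x} s * g s \<partial>leb b)"
    unfolding prim_def using integrable_prim[OF assms(1), of x] integrable_prim[OF assms(1), of y] by simp
  also have "\<dots> = (\<integral>s. indicator {x..<y} s * g s \<partial>leb b)"
    using assms(2) by (intro Bochner_Integration.integral_cong) (auto split: split_indicator)
  finally show ?thesis .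
qed

text \<open>Turns a pointwise bound on a density into a modulus of continuity; later the bound is
  the L2 norm of a time derivative.\<close>

lemma prim_increment_mono:
  assumes "integrable (leb b) f" "integrable (leb b) g" "AE s in leb b. \<bar>f s\<bar> \<le> g s"
  shows "\<bar>prim b f x - prim b f y\<bar> \<le> \<bar>prim b g x - prim b g y\<bar>"
proof -
  have *: "\<bar>prim b f y - prim b f x\<bar> \<le> \<bar>prim b g y - prim b g x\<bar>" if "x \<le> y" for x y
  proof -
    have I: "integrable (leb b) (\<lambda>s. indicator {x..<y} s * h s)" if "integrable (leb b) h" for h :: "real \<Rightarrow> real"
      using that by (rule integrable_mult_bounded_leb[where C = 1]) 
        (auto intro: indicator_measurable_leb split: split_indicator)
    have "\<bar>prim b f y - prim b f x\<bar> \<le> (\<integral>s. \<bar>indicator {x..<y} s * f s\<bar> \<partial>leb b)"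
      unfolding prim_increment[OF assms(1) that] by (rule integral_abs_bound)
    also have "\<dots> \<le> (\<integral>s. indicator {x..<y} s * g s \<partial>leb b)"
      using assms(3) I[OF integrable_abs[OF assms(1)]] I[OF assms(2)]
      by (intro integral_mono_AE) (auto simp: abs_mult elim!: eventually_mono split: split_indicator)
    also have "\<dots> = prim b g y - prim b g x"
      using prim_increment[OF assms(2) that] by simp
    finally show ?thesis by linarith
  qed
  show ?thesis
    using *[of x y] *[of y x] by (cases "x \<le> y") (auto simp: abs_minus_commute)
qed

lemma AE_leb_neq: "AE s in leb b. s \<noteq> c"
proof -
  have "AE s in lebesgue. s \<noteq> c"
    by (rule AE_completion[OF AE_lborel_singleton])
  then show ?thesis by (auto simp: AE_restrict_space_iff elim: eventually_mono)
qed

lemma prim_continuous: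
  assumes "integrable (leb b) g"
  shows "continuous_on A (prim b g)"
proof -
  have "(\<lambda>n. prim b g (X n)) \<longlonglongrightarrow> prim b g x" if "X \<longlonglongrightarrow> x" for X :: "nat \<Rightarrow> real" and x
    unfolding prim_def
  proof (rule integral_dominated_convergence)
    show "integrable (leb b) (\<lambda>s. \<bar>g s\<bar>)" using assms by auto
    show "(\<lambda>s. indicator {..<x} s * g s) \<in> borel_measurable (leb b)"
      using integrable_prim[OF assms] by auto
    show "(\<lambda>s. indicator {..<X n} s * g s) \<in> borel_measurable (leb b)" for n
      using integrable_prim[OF assms] by auto
    \<comment> \<open>The indicators of \<open>{..<X n}\<close> may fail to converge at
      \<open>s = x\<close>, and only there.\<close>
    show "AE s in leb b. (\<lambda>n. indicator {..<X n} s * g s) \<longlonglongrightarrow> indicator {..<x} s * g s"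
      using AE_leb_neq[where c = x]
    proof eventually_elim
      case (elim s)
      have "\<forall>\<^sub>F n in sequentially. indicator {..<X n} s * g s = indicator {..<x} s * g s"
      proof (cases "s < x")
        case True
        then show ?thesis using order_tendstoD(1)[OF that, of s] by (auto elim!: eventually_mono split: split_indicator)
      next
        case False
        with elim have "x < s" by simp
        then show ?thesis using order_tendstoD(2)[OF that, of s] by (auto elim!: eventually_mono split: split_indicator)
      qed
      then show ?case by (rule tendsto_eventually)
    qed
  qed (auto split: split_indicator)
  then have "continuous_on UNIV (prim b g)"
    unfolding continuous_on_sequentially by (auto simp: o_def)
  then show ?thesis by (rule continuous_on_subset) simp
qed

lemma prim_measurable: "integrable (leb b) g \<Longrightarrow> prim b g \<in> borel_measurable (leb c)"
  by (intro continuous_measurable_leb prim_continuous)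

lemma prim_bounded: "integrable (leb b) g \<Longrightarrow> \<bar>prim b g x\<bar> \<le> (\<integral>s. \<bar>g s\<bar> \<partial>leb b)"
proof -
  assume g: "integrable (leb b) g"
  have "\<bar>prim b g x\<bar> \<le> (\<integral>s. \<bar>indicator {..<x} s * g s\<bar> \<partial>leb b)"
    unfolding prim_def by (rule integral_abs_bound)
  also have "\<dots> \<le> (\<integral>s. \<bar>g s\<bar> \<partial>leb b)"
    using g integrable_prim[OF g] by (intro integral_mono_AE) (auto split: split_indicator)
  finally show ?thesis .
qed

lemma sigma_finite_leb: "sigma_finite_measure (leb b)"
  using finite_measure_leb finite_measure.axioms(1) by blast

lemma pair_sigma_finite_leb: "pair_sigma_finite (leb b) (leb c)"
  by (intro pair_sigma_finite.intro sigma_finite_leb)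

abbreviation prim2 :: "real \<Rightarrow> (real \<Rightarrow> real) \<Rightarrow> real \<Rightarrow> real" where
  "prim2 b g \<equiv> prim b (prim b g)"

text \<open>Off the diagonal, a null set, the square splits into two triangles.\<close>

lemma integral_triangles:
  fixes k :: "real \<Rightarrow> real \<Rightarrow> real"
  assumes k: "integrable (leb b \<Otimes>\<^sub>M leb b) (case_prod k)"
  shows "(\<integral>s. (\<integral>\<tau>. k s \<tau> \<partial>leb b) \<partial>leb b) =
    (\<integral>s. prim b (k s) s \<partial>leb b) + (\<integral>\<tau>. prim b (\<lambda>s. k s \<tau>) \<tau> \<partial>leb b)"
    "integrable (leb b) (\<lambda>s. prim b (k s) s)" "integrable (leb b) (\<lambda>\<tau>. prim b (\<lambda>s. k s \<tau>) \<tau>)"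
proof -
  interpret pair_sigma_finite "leb b" "leb b" by (rule pair_sigma_finite_leb)
  have id: "(\<lambda>x. x) \<in> borel_measurable (leb b)" by (rule continuous_measurable_leb) (rule continuous_on_id)
  have [measurable]: "fst \<in> borel_measurable (leb b \<Otimes>\<^sub>M leb b)" "snd \<in> borel_measurable (leb b \<Otimes>\<^sub>M leb b)"
    by (rule measurable_compose[OF measurable_fst id]) (rule measurable_compose[OF measurable_snd id])
  have [measurable]: "case_prod k \<in> borel_measurable (leb b \<Otimes>\<^sub>M leb b)" using k by auto
  have c1: "integrable (leb b \<Otimes>\<^sub>M leb b) (\<lambda>p. (if snd p < fst p then 1 else 0) * case_prod k p)"
    by (rule Bochner_Integration.integrable_bound[OF k]) auto
  have c2: "integrable (leb b \<Otimes>\<^sub>M leb b) (\<lambda>p. (if fst p < snd p then 1 else 0) * case_prod k p)"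
    by (rule Bochner_Integration.integrable_bound[OF k]) auto
  have e1: "prim b (k s) s = (\<integral>\<tau>. (if snd (s, \<tau>) < fst (s, \<tau>) then 1 else 0) * case_prod k (s, \<tau>) \<partial>leb b)" for s
    unfolding prim_def by (auto intro!: Bochner_Integration.integral_cong)
  have e2: "prim b (\<lambda>s. k s \<tau>) \<tau> = (\<integral>s. (if fst (s, \<tau>) < snd (s, \<tau>) then 1 else 0) * case_prod k (s, \<tau>) \<partial>leb b)" for \<tau>
    unfolding prim_def by (auto intro!: Bochner_Integration.integral_cong)
  show i1: "integrable (leb b) (\<lambda>s. prim b (k s) s)"
    unfolding e1 by (rule integrable_fst'[OF c1])
  have c2': "integrable (leb b \<Otimes>\<^sub>M leb b) (case_prod (\<lambda>s \<tau>. (if fst (s, \<tau>) < snd (s, \<tau>) then 1 else 0) * case_prod k (s, \<tau>)))"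
    using c2 by (simp add: case_prod_beta')
  show i2: "integrable (leb b) (\<lambda>\<tau>. prim b (\<lambda>s. k s \<tau>) \<tau>)"
    unfolding e2 by (rule integrable_snd[OF c2'])
  have "(\<integral>s. (\<integral>\<tau>. k s \<tau> \<partial>leb b) \<partial>leb b) =
    (\<integral>s. prim b (k s) s + (\<integral>\<tau>. (if fst (s, \<tau>) < snd (s, \<tau>) then 1 else 0) * case_prod k (s, \<tau>) \<partial>leb b) \<partial>leb b)"
  proof (rule integral_cong_AE)
    show "(\<lambda>s. \<integral>\<tau>. k s \<tau> \<partial>leb b) \<in> borel_measurable (leb b)"
      using integrable_fst'[OF k] by auto
    show "(\<lambda>s. prim b (k s) s + (\<integral>\<tau>. (if fst (s, \<tau>) < snd (s, \<tau>) then 1 else 0) * case_prod k (s, \<tau>) \<partial>leb b)) \<in> borel_measurable (leb b)"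
      using i1 integrable_fst'[OF c2] by (intro borel_measurable_add) auto
    show "AE s in leb b. (\<integral>\<tau>. k s \<tau> \<partial>leb b) = prim b (k s) s + (\<integral>\<tau>. (if fst (s, \<tau>) < snd (s, \<tau>) then 1 else 0) * case_prod k (s, \<tau>) \<partial>leb b)"
      using AE_integrable_fst'[OF k] AE_integrable_fst'[OF c1] AE_integrable_fst'[OF c2]
    proof eventually_elim
      case (elim s)
      have "(\<integral>\<tau>. k s \<tau> \<partial>leb b) = (\<integral>\<tau>. (if snd (s, \<tau>) < fst (s, \<tau>) then 1 else 0) * case_prod k (s, \<tau>) +
          (if fst (s, \<tau>) < snd (s, \<tau>) then 1 else 0) * case_prod k (s, \<tau>) \<partial>leb b)"
        by (rule integral_cong_AE)
           (use elim AE_leb_neq[where b = b and c = s] in \<open>auto elim!: eventually_mono\<close>)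
      then show ?case unfolding e1 using elim by simp
    qed
  qed
  also have "\<dots> = (\<integral>s. prim b (k s) s \<partial>leb b) + (\<integral>s. (\<integral>\<tau>. (if fst (s, \<tau>) < snd (s, \<tau>) then 1 else 0) * case_prod k (s, \<tau>) \<partial>leb b) \<partial>leb b)"
    by (rule Bochner_Integration.integral_add[OF i1 integrable_fst'[OF c2]])
  also have "(\<integral>s. (\<integral>\<tau>. (if fst (s, \<tau>) < snd (s, \<tau>) then 1 else 0) * case_prod k (s, \<tau>) \<partial>leb b) \<partial>leb b) = (\<integral>\<tau>. prim b (\<lambda>s. k s \<tau>) \<tau> \<partial>leb b)"
    unfolding e2 by (rule Fubini_integral[OF c2', symmetric])
  finally show "(\<integral>s. (\<integral>\<tau>. k s \<tau> \<partial>leb b) \<partial>leb b) =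
    (\<integral>s. prim b (k s) s \<partial>leb b) + (\<integral>\<tau>. prim b (\<lambda>s. k s \<tau>) \<tau> \<partial>leb b)" .
qed

lemma integrable_pair_bound:
  fixes k :: "real \<Rightarrow> real \<Rightarrow> real"
  assumes k: "case_prod k \<in> borel_measurable (leb b \<Otimes>\<^sub>M leb c)"
    and f: "integrable (leb b) f" and g: "integrable (leb c) g"
    and le: "\<And>s \<tau>. s \<in> {0<..<b} \<Longrightarrow> \<tau> \<in> {0<..<c} \<Longrightarrow> \<bar>k s \<tau>\<bar> \<le> \<bar>f s * g \<tau>\<bar>"
  shows "integrable (leb b \<Otimes>\<^sub>M leb c) (case_prod k)"
proof -
  interpret pair_sigma_finite "leb b" "leb c" by (rule pair_sigma_finite_leb)
  have [measurable]: "f \<in> borel_measurable (leb b)" "g \<in> borel_measurable (leb c)" using f g by auto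
  have "integrable (leb b \<Otimes>\<^sub>M leb c) (\<lambda>p. f (fst p) * g (snd p))"
  proof (rule Fubini_integrable)
    show "AE x in leb b. integrable (leb c) (\<lambda>y. f (fst (x, y)) * g (snd (x, y)))"
      using g by auto
    show "integrable (leb b) (\<lambda>x. \<integral>y. norm (f (fst (x, y)) * g (snd (x, y))) \<partial>leb c)"
      using f by (simp add: abs_mult)
  qed measurable
  then show ?thesis
    by (rule Bochner_Integration.integrable_bound[OF _ k])
       (auto intro!: AE_I2 le simp: space_pair_measure)
qed

text \<open>Integration by parts out of Fubini's theorem: the product is the integral of f(s)
  g(\<tau>) over a square of side \<open>x\<close>, and on each of the two triangles the inner
  integral is again an indefinite integral.\<close>

lemma prim_mult:
  assumes f: "integrable (leb b) f" and g: "integrable (leb b) g"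
  shows "prim b f x * prim b g x = prim b (\<lambda>s. f s * prim b g s + prim b f s * g s) x"
proof -
  define k where "k s \<tau> = (indicator {..<x} s * f s) * (indicator {..<x} \<tau> * g \<tau>)" for s \<tau>
  have fm: "integrable (leb b) (\<lambda>s. indicator {..<x} s * f s)" "integrable (leb b) (\<lambda>s. indicator {..<x} s * g s)"
    by (rule integrable_prim[OF f] integrable_prim[OF g])+
  then have [measurable]: "(\<lambda>s. indicator {..<x} s * f s) \<in> borel_measurable (leb b)" "(\<lambda>s. indicator {..<x} s * g s) \<in> borel_measurable (leb b)"
    by auto
  have k: "integrable (leb b \<Otimes>\<^sub>M leb b) (case_prod k)"
    by (rule integrable_pair_bound[OF _ fm]) (auto simp: k_def case_prod_beta')
  have 1: "(\<integral>s. (\<integral>\<tau>. k s \<tau> \<partial>leb b) \<partial>leb b) = prim b f x * prim b g x"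
    by (simp add: k_def prim_def)
  \<comment> \<open>For \<open>\<tau> < s\<close> the condition \<open>s < x\<close> already implies
    \<open>\<tau> < x\<close>, so one of the two indicators drops out.\<close>
  have 2: "prim b (k s) s = indicator {..<x} s * (f s * prim b g s)" for s
  proof -
    have "prim b (k s) s = prim b (\<lambda>\<tau>. (indicator {..<x} s * f s) * g \<tau>) s"
      by (rule prim_cong) (auto simp: k_def split: split_indicator)
    then show ?thesis by (simp add: prim_scale)
  qed
  have 3: "prim b (\<lambda>s. k s \<tau>) \<tau> = indicator {..<x} \<tau> * (prim b f \<tau> * g \<tau>)" for \<tau>
  proof -
    have "prim b (\<lambda>s. k s \<tau>) \<tau> = prim b (\<lambda>s. (indicator {..<x} \<tau> * g \<tau>) * f s) \<tau>"
      by (rule prim_cong) (auto simp: k_def split: split_indicator)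
    then show ?thesis by (simp add: prim_scale)
  qed
  have "prim b f x * prim b g x = prim b (\<lambda>s. f s * prim b g s) x + prim b (\<lambda>s. prim b f s * g s) x"
    using integral_triangles(1)[OF k] unfolding 1 2 3 prim_def[symmetric] by simp
  also have "\<dots> = prim b (\<lambda>s. f s * prim b g s + prim b f s * g s) x"
  proof (rule prim_add[symmetric])
    show "integrable (leb b) (\<lambda>s. prim b f s * g s)"
      by (rule integrable_mult_bounded_leb[OF g prim_measurable[OF f] prim_bounded[OF f]])
    show "integrable (leb b) (\<lambda>s. f s * prim b g s)"
      using integrable_mult_bounded_leb[OF f prim_measurable[OF g] prim_bounded[OF g]] by (simp add: mult.commute)
  qed
  finally show ?thesis .
qed

section \<open>Absolutely continuous functions\<close>

definition AC :: "real \<Rightarrow> (real \<Rightarrow> real) \<Rightarrow> (real \<Rightarrow> real) \<Rightarrow> bool" where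
  "AC b F f \<longleftrightarrow> integrable (leb b) f \<and> (\<forall>x\<in>{0..b}. F x = F 0 + prim b f x)"

lemma AC_integrable: "AC b F f \<Longrightarrow> integrable (leb b) f"
  unfolding AC_def by blast

lemma AC_eq: "AC b F f \<Longrightarrow> x \<in> {0..b} \<Longrightarrow> F x = F 0 + prim b f x"
  unfolding AC_def by blast

lemma AC_prim: "integrable (leb b) f \<Longrightarrow> AC b (\<lambda>x. c + prim b f x) f"
  by (simp add: AC_def prim_nonpos)

lemma AC_continuous:
  assumes "AC b F f" shows "continuous_on {0..b} F"
proof -
  have "continuous_on {0..b} (\<lambda>x. F 0 + prim b f x)"
    by (intro continuous_intros prim_continuous AC_integrable[OF assms])
  then show ?thesis by (rule continuous_on_eq) (rule AC_eq[OF assms, symmetric])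
qed

lemma AC_measurable: "AC b F f \<Longrightarrow> F \<in> borel_measurable (leb b)"
  by (rule continuous_measurable_leb) (auto intro: continuous_on_subset[OF AC_continuous])

lemma AC_bounded:
  assumes "AC b F f" "0 < b"
  obtains C where "\<And>x. x \<in> {0..b} \<Longrightarrow> \<bar>F x\<bar> \<le> C"
proof -
  have "\<bar>F x\<bar> \<le> \<bar>F 0\<bar> + (\<integral>s. \<bar>f s\<bar> \<partial>leb b)" if "x \<in> {0..b}" for x
    using AC_eq[OF assms(1) that] prim_bounded[OF AC_integrable[OF assms(1)], of x] by linarith
  then show ?thesis using that by blast
qed

lemma AC_integrable_mult:
  assumes "AC b F f" "0 < b" "integrable (leb b) g"
  shows "integrable (leb b) (\<lambda>x. F x * g x)"
proof -
  obtain C where "\<And>x. x \<in> {0..b} \<Longrightarrow> \<bar>F x\<bar> \<le> C" by (rule AC_bounded[OF assms(1,2)]) blast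
  then show ?thesis
    by (intro integrable_mult_bounded_leb[OF assms(3) AC_measurable[OF assms(1)], of C]) simp
qed

lemma AC_L2: 
  assumes "AC b F f" "0 < b" shows "F \<in> L2 b"
proof -
  obtain C where "\<And>x. x \<in> {0..b} \<Longrightarrow> \<bar>F x\<bar> \<le> C" by (rule AC_bounded[OF assms]) blast
  then show ?thesis
    by (intro L2_bounded[OF AC_measurable[OF assms(1)], of C] AE_I2) auto
qed

lemma AC_scale:
  assumes "AC b F f" shows "AC b (\<lambda>x. c * F x) (\<lambda>x. c * f x)"
  unfolding AC_def prim_scale distrib_left[symmetric]
proof (intro conjI ballI)
  show "c * F x = c * (F 0 + prim b f x)" if "x \<in> {0..b}" for x
    by (rule arg_cong[OF AC_eq[OF assms that]])
qed (use AC_integrable[OF assms] in simp)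

lemma AC_add:
  assumes "AC b F f" "AC b G g" shows "AC b (\<lambda>x. F x + G x) (\<lambda>x. f x + g x)"
  unfolding AC_def
proof (intro conjI ballI)
  fix x assume x: "x \<in> {0..b}"
  show "F x + G x = F 0 + G 0 + prim b (\<lambda>x. f x + g x) x"
    unfolding AC_eq[OF assms(1) x] AC_eq[OF assms(2) x]
    using prim_add[OF AC_integrable[OF assms(1)] AC_integrable[OF assms(2)], of x] by simp
qed (intro Bochner_Integration.integrable_add AC_integrable[OF assms(1)] AC_integrable[OF assms(2)])

text \<open>The density matters up to null sets only, and the function on \<open>{0..b}\<close>
  only; this is what lets \<open>AC\<close> pass between representatives.\<close>

lemma AC_cong:
  assumes "AC b F f" "\<And>x. x \<in> {0..b} \<Longrightarrow> F x = G x" "AE x in leb b. f x = g x" "g \<in> borel_measurable (leb b)" "0 < b"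
  shows "AC b G g"
proof -
  have "integrable (leb b) g"
    using AC_integrable[OF assms(1)] assms(3,4) by (intro integrable_cong_AE_imp[of _ f g]) auto
  moreover have "G x = G 0 + prim b g x" if x: "x \<in> {0..b}" for x
  proof -
    have "prim b f x = prim b g x"
      using AC_integrable[OF assms(1)] assms(3,4) by (intro prim_cong_AE) auto
    moreover have "F 0 = G 0" using assms(2,5) by simp
    ultimately show ?thesis using AC_eq[OF assms(1) x] assms(2)[OF x] by linarith
  qed
  ultimately show ?thesis unfolding AC_def by blast
qed

text \<open>Splitting each factor into its initial value and an indefinite integral leaves one
  nontrivial term, the product of two indefinite integrals, which is
  \<open>prim_mult\<close>.\<close>

lemma AC_mult:
  assumes F: "AC b F f" and G: "AC b G g" and b: "0 < b"
  shows "AC b (\<lambda>x. F x * G x) (\<lambda>x. f x * G x + F x * g x)"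
  unfolding AC_def
proof (intro conjI ballI)
  note f = AC_integrable[OF F] and g = AC_integrable[OF G]
  show int: "integrable (leb b) (\<lambda>x. f x * G x + F x * g x)"
    using AC_integrable_mult[OF F b g] AC_integrable_mult[OF G b f] by (simp add: mult.commute)
  fix x assume x: "x \<in> {0..b}"
  have i1: "integrable (leb b) (\<lambda>s. prim b f s * g s)"
    by (rule integrable_mult_bounded_leb[OF g prim_measurable[OF f] prim_bounded[OF f]])
  have i2: "integrable (leb b) (\<lambda>s. f s * prim b g s)"
    using integrable_mult_bounded_leb[OF f prim_measurable[OF g] prim_bounded[OF g]] by (simp add: mult.commute)
  have "prim b (\<lambda>x. f x * G x + F x * g x) x = prim b (\<lambda>s. (G 0 * f s + F 0 * g s) + (f s * prim b g s + prim b f s * g s)) x"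
  proof (rule prim_cong)
    fix s assume "s \<in> {0<..<b}"
    then have "s \<in> {0..b}" by simp
    from AC_eq[OF F this] AC_eq[OF G this]
    show "f s * G s + F s * g s = G 0 * f s + F 0 * g s + (f s * prim b g s + prim b f s * g s)"
      by (simp only:) (simp add: algebra_simps)
  qed
  also have "\<dots> = G 0 * prim b f x + F 0 * prim b g x + prim b f x * prim b g x"
    using f g i1 i2 by (simp add: prim_add prim_scale prim_mult[OF f g])
  finally show "F x * G x = F 0 * G 0 + prim b (\<lambda>x. f x * G x + F x * g x) x"
    unfolding AC_eq[OF F x] AC_eq[OF G x] by (simp add: algebra_simps)
qed

lemma AC_integral:
  assumes "AC b F f" "0 < b"
  shows "(\<integral>x. f x \<partial>leb b) = F b - F 0"
  using AC_eq[OF assms(1), of b] assms(2) by (simp add: prim_full)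

text \<open>The source of all explicit pairs of a function and its density: test functions,
  polynomials, the weight \<open>l - x\<close> and the integrating factor of Gronwall's
  inequality.\<close>

lemma AC_smooth:
  assumes F: "\<And>x. (F has_real_derivative f x) (at x)" and f: "continuous_on UNIV f" and b: "0 < b"
  shows "AC b F f"
proof -
  have "bounded (f ` {0..b})"
    by (intro compact_imp_bounded compact_continuous_image continuous_on_subset[OF f]) auto
  then obtain C where C: "\<And>x. x \<in> {0..b} \<Longrightarrow> \<bar>f x\<bar> \<le> C"
    by (auto simp: bounded_iff simp del: atLeastAtMost_iff)
  have "f \<in> L2 b"
    by (rule L2_bounded[where C = C]) (use C f in \<open>auto intro!: continuous_measurable_leb AE_I2 elim: continuous_on_subset\<close>)
  moreover have "F x = F 0 + prim b f x" if x: "x \<in> {0..b}" for x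
  proof -
    have fl: "f \<in> borel_measurable lborel" using f by (simp add: borel_measurable_continuous_onI)
    have "prim b f x = (\<integral>s. indicator {0<..<b} s *\<^sub>R (indicator {..<x} s * f s) \<partial>lebesgue)"
      unfolding prim_def by (rule integral_restrict_space) simp
    also have "\<dots> = (\<integral>s. indicator {0<..<b} s *\<^sub>R (indicator {..<x} s * f s) \<partial>lborel)"
      by (rule integral_completion) (use fl in auto)
    \<comment> \<open>The truncations differ at most at the end points \<open>0\<close> and
      \<open>x\<close>.\<close>
    also have "\<dots> = (\<integral>s. f s * indicator {0..x} s \<partial>lborel)"
    proof (rule integral_cong_AE)
      show "AE s in lborel. indicator {0<..<b} s *\<^sub>R (indicator {..<x} s * f s) = f s * indicator {0..x} s"
        using AE_lborel_singleton[of 0] AE_lborel_singleton[of x]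
        by eventually_elim (use x in \<open>auto split: split_indicator\<close>)
    qed (use fl in auto)
    also have "\<dots> = F x - F 0"
      by (rule integral_FTC_Icc_real) (use x F f in \<open>auto simp: continuous_on_eq_continuous_at\<close>)
    finally show ?thesis by simp
  qed
  ultimately show ?thesis unfolding AC_def using L2_integrable by blast
qed

lemma AC_test_function: "test_function b \<phi> \<Longrightarrow> 0 < b \<Longrightarrow> AC b \<phi> (deriv \<phi>)"
  by (intro AC_smooth test_function_DERIV test_function_continuous test_function_deriv)

lemma test_function_ends:
  assumes "test_function b \<phi>" shows "\<phi> 0 = 0" "\<phi> b = 0"
  using assms by (auto simp: test_function_def)

section \<open>Weak derivatives and absolute continuity\<close>

lemma AC_has_weak_deriv:
  assumes F: "AC b F f" and b: "0 < b"
  shows "has_weak_deriv b 1 F f"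
  unfolding has_weak_deriv_def
proof (intro conjI allI impI)
  show "locally_integrable b F"
    by (intro integrable_imp_locally_integrable L2_integrable AC_L2[OF F b])
  show lf: "locally_integrable b f"
    by (intro integrable_imp_locally_integrable AC_integrable[OF F])
  fix \<phi> assume \<phi>: "test_function b \<phi>"
  note A = AC_test_function[OF \<phi> b]
  have i: "integrable (leb b) (\<lambda>x. f x * \<phi> x)" "integrable (leb b) (\<lambda>x. F x * deriv \<phi> x)"
    by (rule locally_integrable_mult_test[OF lf \<phi>] AC_integrable_mult[OF F b AC_integrable[OF A]])+
  have "(\<integral>x. f x * \<phi> x + F x * deriv \<phi> x \<partial>leb b) = 0"
    using AC_integral[OF AC_mult[OF F A b] b] test_function_ends[OF \<phi>] by simp
  then show "(\<integral>x. F x * (deriv ^^ 1) \<phi> x \<partial>leb b) = (- 1) ^ 1 * ip b f \<phi>"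
    using i by simp
qed

lemma test_function_funpow_deriv: "test_function b \<phi> \<Longrightarrow> test_function b ((deriv ^^ n) \<phi>)"
  by (induction n) (auto intro: test_function_deriv)

lemma has_weak_deriv_trans:
  assumes "has_weak_deriv b i f g" "has_weak_deriv b j g h"
  shows "has_weak_deriv b (i + j) f h"
  unfolding has_weak_deriv_def
proof (intro conjI allI impI)
  fix \<phi> assume \<phi>: "test_function b \<phi>"
  have "(\<integral>x. f x * (deriv ^^ (i + j)) \<phi> x \<partial>leb b) = (-1) ^ i * (\<integral>x. g x * (deriv ^^ j) \<phi> x \<partial>leb b)"
    using assms(1) test_function_funpow_deriv[OF \<phi>, of j] by (auto simp: has_weak_deriv_def funpow_add)
  also have "\<dots> = (-1) ^ (i + j) * ip b h \<phi>"
    using assms(2) \<phi> by (auto simp: has_weak_deriv_def power_add)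
  finally show "(\<integral>x. f x * (deriv ^^ (i + j)) \<phi> x \<partial>leb b) = (-1) ^ (i + j) * ip b h \<phi>" .
qed (use assms in \<open>auto simp: has_weak_deriv_def\<close>)

text \<open>Derivatives of a test function are test functions, so both hypotheses can be tested on
  derivatives of the same \<phi>, and comparing them eliminates \<open>f\<close>.\<close>

lemma has_weak_deriv_split:
  assumes "has_weak_deriv b i f g" "has_weak_deriv b (i + j) f h"
  shows "has_weak_deriv b j g h"
  unfolding has_weak_deriv_def
proof (intro conjI allI impI)
  fix \<phi> assume \<phi>: "test_function b \<phi>"
  have "(\<integral>x. f x * (deriv ^^ (i + j)) \<phi> x \<partial>leb b) = (-1) ^ i * (\<integral>x. g x * (deriv ^^ j) \<phi> x \<partial>leb b)"
    using assms(1) test_function_funpow_deriv[OF \<phi>, of j] by (auto simp: has_weak_deriv_def funpow_add)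
  moreover have "(\<integral>x. f x * (deriv ^^ (i + j)) \<phi> x \<partial>leb b) = (-1) ^ (i + j) * ip b h \<phi>"
    using assms(2) \<phi> by (auto simp: has_weak_deriv_def)
  ultimately have "(-1) ^ i * (\<integral>x. g x * (deriv ^^ j) \<phi> x \<partial>leb b) = (-1) ^ i * ((-1) ^ j * ip b h \<phi>)"
    by (simp add: power_add mult.assoc)
  then show "(\<integral>x. g x * (deriv ^^ j) \<phi> x \<partial>leb b) = (-1) ^ j * ip b h \<phi>"
    by simp
qed (use assms in \<open>auto simp: has_weak_deriv_def\<close>)

lemma locally_integrable_lincomb:
  "locally_integrable b f \<Longrightarrow> locally_integrable b g \<Longrightarrow> locally_integrable b (\<lambda>x. s * f x + t * g x)"
  by (auto simp: locally_integrable_def)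

lemma has_weak_deriv_lincomb:
  assumes "has_weak_deriv b j f g" "has_weak_deriv b j f' g'"
  shows "has_weak_deriv b j (\<lambda>x. s * f x + t * f' x) (\<lambda>x. s * g x + t * g' x)"
  unfolding has_weak_deriv_def
proof (intro conjI allI impI)
  note L = assms[unfolded has_weak_deriv_def]
  show "locally_integrable b (\<lambda>x. s * f x + t * f' x)" "locally_integrable b (\<lambda>x. s * g x + t * g' x)"
    using L by (auto intro: locally_integrable_lincomb)
  fix \<phi> assume \<phi>: "test_function b \<phi>"
  note \<phi>j = test_function_funpow_deriv[OF \<phi>, of j]
  have i: "integrable (leb b) (\<lambda>x. f x * (deriv ^^ j) \<phi> x)" "integrable (leb b) (\<lambda>x. f' x * (deriv ^^ j) \<phi> x)"
    "integrable (leb b) (\<lambda>x. g x * \<phi> x)" "integrable (leb b) (\<lambda>x. g' x * \<phi> x)"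
    using L \<phi> \<phi>j by (auto intro: locally_integrable_mult_test)
  have "(\<integral>x. (s * f x + t * f' x) * (deriv ^^ j) \<phi> x \<partial>leb b) = s * (\<integral>x. f x * (deriv ^^ j) \<phi> x \<partial>leb b) + t * (\<integral>x. f' x * (deriv ^^ j) \<phi> x \<partial>leb b)"
    using i by (simp add: distrib_right mult.assoc)
  also have "\<dots> = (-1) ^ j * (s * ip b g \<phi> + t * ip b g' \<phi>)"
    using L \<phi> by (simp add: algebra_simps)
  also have "s * ip b g \<phi> + t * ip b g' \<phi> = (\<integral>x. (s * g x + t * g' x) * \<phi> x \<partial>leb b)"
    using i by (simp add: distrib_right mult.assoc)
  finally show "(\<integral>x. (s * f x + t * f' x) * (deriv ^^ j) \<phi> x \<partial>leb b) = (-1) ^ j * (\<integral>x. (s * g x + t * g' x) * \<phi> x \<partial>leb b)" .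
qed

lemma has_weak_deriv_unique:
  assumes "0 < b" "has_weak_deriv b j f g" "has_weak_deriv b j f h"
  shows "AE x in leb b. g x = h x"
proof -
  note L = assms(2,3)[unfolded has_weak_deriv_def]
  have "AE x in leb b. 1 * g x + (-1) * h x = 0"
  proof (rule fundamental_lemma_calculus_variations[OF assms(1)])
    show "locally_integrable b (\<lambda>x. 1 * g x + (-1) * h x)"
      using L by (intro locally_integrable_lincomb) auto
    fix \<phi> assume \<phi>: "test_function b \<phi>"
    have "integrable (leb b) (\<lambda>x. g x * \<phi> x)" "integrable (leb b) (\<lambda>x. h x * \<phi> x)"
      using L \<phi> by (auto intro: locally_integrable_mult_test)
    moreover have "ip b g \<phi> = ip b h \<phi>"
    proof -
      have "(\<integral>x. f x * (deriv ^^ j) \<phi> x \<partial>leb b) = (-1) ^ j * ip b g \<phi>"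
        using L(1) \<phi> by blast
      moreover have "(\<integral>x. f x * (deriv ^^ j) \<phi> x \<partial>leb b) = (-1) ^ j * ip b h \<phi>"
        using L(2) \<phi> by blast
      ultimately show ?thesis by simp
    qed
    ultimately show "(\<integral>x. (1 * g x + (-1) * h x) * \<phi> x \<partial>leb b) = 0"
      by (simp add: left_diff_distrib)
  qed
  then show ?thesis by simp
qed

lemma locally_integrable_cong_AE:
  assumes "locally_integrable b f" "AE x in leb b. f x = g x"
  shows "locally_integrable b g"
  unfolding locally_integrable_def
proof (intro allI impI)
  fix c d :: real assume cd: "0 < c" "d < b"
  have f: "integrable (lebesgue_on {c..d}) f" using assms cd by (auto simp: locally_integrable_def)
  have "AE x in lebesgue. 0 < x \<and> x < b \<longrightarrow> f x = g x"
    using assms(2) by (simp add: AE_restrict_space_iff)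
  then have ae: "AE x in lebesgue_on {c..d}. f x = g x"
    using cd by (auto simp: AE_restrict_space_iff elim!: eventually_mono)
  have "g \<in> borel_measurable (lebesgue_on {c..d})"
    by (rule borel_measurable_lebesgue_on_AE[OF borel_measurable_integrable[OF f] ae]) simp
  with f ae show "integrable (lebesgue_on {c..d}) g"
    by (intro integrable_cong_AE_imp[of _ f g]) (auto elim: eventually_mono)
qed

lemma has_weak_deriv_cong_AE:
  assumes w: "has_weak_deriv b j f g" and f: "AE x in leb b. f x = f' x" and g: "AE x in leb b. g x = g' x"
  shows "has_weak_deriv b j f' g'"
proof -
  note L = w[unfolded has_weak_deriv_def]
  have l: "locally_integrable b f'" "locally_integrable b g'"
    using L f g locally_integrable_cong_AE by blast+
  have eq: "ip b h \<psi> = ip b h' \<psi>"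
    if "locally_integrable b h" "locally_integrable b h'" "AE x in leb b. h x = h' x" "test_function b \<psi>" for h h' \<psi>
    using locally_integrable_mult_test[OF that(1,4)] locally_integrable_mult_test[OF that(2,4)] that(3)
    by (intro integral_cong_AE) (auto elim: eventually_mono)
  show ?thesis
    unfolding has_weak_deriv_def
  proof (intro conjI allI impI l)
    fix \<phi> assume \<phi>: "test_function b \<phi>"
    show "(\<integral>x. f' x * (deriv ^^ j) \<phi> x \<partial>leb b) = (- 1) ^ j * ip b g' \<phi>"
      using L \<phi> eq[OF _ l(1) f test_function_funpow_deriv[OF \<phi>, of j]] eq[OF _ l(2) g \<phi>] by simp
  qed
qed

text \<open>The antiderivative vanishing at 0 is zero to the left of the support of \<psi> and
  equals the total integral of \<psi> to the right of it; mean zero is thus what makes it compactly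
  supported.\<close>

lemma test_function_prim:
  assumes \<psi>: "test_function b \<psi>" and zero: "(\<integral>x. \<psi> x \<partial>leb b) = 0" and b: "0 < b"
  obtains \<phi> where "test_function b \<phi>" "deriv \<phi> = \<psi>"
proof -
  have c: "continuous_on UNIV \<psi>" by (rule test_function_continuous[OF \<psi>])
  then have "\<exists>F. \<forall>x :: real. -\<infinity> < ereal x \<longrightarrow> ereal x < \<infinity> \<longrightarrow> (F has_vector_derivative \<psi> x) (at x)"
    by (intro einterval_antiderivative) (auto simp: continuous_on_eq_continuous_at)
  then obtain F where F: "\<And>x. (F has_real_derivative \<psi> x) (at x)"
    by (auto simp: has_real_derivative_iff_has_vector_derivative)
  define \<phi> where "\<phi> x = F x - F 0" for x
  have D: "(\<phi> has_real_derivative \<psi> x) (at x)" for x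
    unfolding \<phi>_def by (auto intro!: derivative_eq_intros F)
  then have deriv: "deriv \<phi> = \<psi>" by (rule deriv_eqI)
  obtain c d where cd: "0 < c" "c < d" "d < b" "\<And>x. x \<notin> {c..d} \<Longrightarrow> \<psi> x = 0"
    by (rule test_function_bounds[OF \<psi> b]) blast
  have AC: "AC b \<phi> \<psi>" by (rule AC_smooth[OF D c b])
  have left: "\<phi> x = 0" if "x < c" for x
  proof (cases "0 \<le> x")
    case True
    have "\<phi> x = prim b \<psi> x" using AC_eq[OF AC, of x] True that cd by (simp add: \<phi>_def)
    also have "\<dots> = prim b (\<lambda>s. 0) x" by (rule prim_cong) (use that cd in auto)
    finally show ?thesis by (simp add: prim_def)
  next
    case False
    then obtain z where "x < z" "z < 0" "\<phi> 0 - \<phi> x = (0 - x) * \<psi> z"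
      using MVT2[of x 0 \<phi> \<psi>] D by auto
    then show ?thesis using cd by (simp add: \<phi>_def)
  qed
  have end0: "\<phi> b = 0" using AC_integral[OF AC b] zero by (simp add: \<phi>_def)
  have right: "\<phi> x = 0" if "d < x" for x
  proof -
    consider "x < b" | "x = b" | "b < x" by linarith
    then show ?thesis
    proof cases
      case 1
      then obtain z where "x < z" "z < b" "\<phi> b - \<phi> x = (b - x) * \<psi> z"
        using MVT2[of x b \<phi> \<psi>] D by auto
      then show ?thesis using cd that end0 by simp
    next
      case 3
      then obtain z where "b < z" "z < x" "\<phi> x - \<phi> b = (x - b) * \<psi> z"
        using MVT2[of b x \<phi> \<psi>] D by auto
      then show ?thesis using cd that end0 by simp
    qed (use end0 in simp)
  qed
  have "smooth_upto n \<phi>" for n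
  proof (cases n)
    case 0
    then show ?thesis using differentiable_on_UNIV_I[OF D] by (simp add: smooth_upto_0)
  next
    case (Suc m)
    then show ?thesis using \<psi> differentiable_on_UNIV_I[OF D] by (simp add: smooth_upto_Suc deriv test_function_iff)
  qed
  then have "test_function b \<phi>"
    using cd left right by (intro test_functionI[of \<phi> c d b]) (auto simp: not_le)
  then show ?thesis using deriv by (rule that)
qed

text \<open>Fix one test function \<phi>0 of nonzero integral. Every test function minus the right
  multiple of \<phi>0 has mean zero and so is the derivative of a test function, whence
  \<open>h - c\<close> annihilates all test functions, \<open>c\<close> being the average of
  \<open>h\<close> against \<phi>0.\<close>

lemma du_Bois_Reymond:
  assumes b: "0 < b" and h: "locally_integrable b h"
    and zero: "\<And>\<phi>. test_function b \<phi> \<Longrightarrow> (ip b h (deriv \<phi>)) = 0"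
  obtains c where "AE x in leb b. h x = c"
proof -
  \<comment> \<open>The integrals of the bumps tend to \<open>b > 0\<close>, so one of them is
    nonzero.\<close>
  have "(\<lambda>n. \<integral>x. bump 0 b n x \<partial>leb b) \<longlonglongrightarrow> (\<integral>x. indicator {0<..<b} x \<partial>leb b)"
    by (rule integral_dominated_convergence[where w = "\<lambda>x. 1"])
       (use b test_function_bump bump_bounds in \<open>auto intro!: test_function_measurable[of b] indicator_measurable_leb AE_I2 bump_tendsto\<close>)
  moreover have "(\<integral>x. indicator {0<..<b} x \<partial>leb b) = b"
  proof -
    have "(\<integral>x. indicator {0<..<b} x \<partial>leb b) = (\<integral>x. 1 \<partial>leb b)"
      by (rule Bochner_Integration.integral_cong) auto
    then show ?thesis using b by (simp add: measure_restrict_space)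
  qed
  ultimately have lim: "(\<lambda>n. \<integral>x. bump 0 b n x \<partial>leb b) \<longlonglongrightarrow> b" by simp
  obtain n where n: "(\<integral>x. bump 0 b n x \<partial>leb b) \<noteq> 0"
  proof (rule ccontr)
    assume "\<not> thesis"
    with that have "(\<lambda>n. \<integral>x. bump 0 b n x \<partial>leb b) = (\<lambda>n. 0)" by blast
    with lim b show False by (simp add: LIMSEQ_const_iff)
  qed
  define \<phi>0 where "\<phi>0 = bump 0 b n"
  have \<phi>0: "test_function b \<phi>0" unfolding \<phi>0_def using b by (intro test_function_bump) auto
  define I where "I = (\<integral>x. \<phi>0 x \<partial>leb b)"
  define c where "c = ip b h \<phi>0 / I"
  have "AE x in leb b. 1 * h x + (- c) * 1 = 0"
  proof (rule fundamental_lemma_calculus_variations[OF b])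
    have "locally_integrable b (\<lambda>x. 1)" by (rule integrable_imp_locally_integrable) simp
    then show "locally_integrable b (\<lambda>x. 1 * h x + (- c) * 1)"
      by (rule locally_integrable_lincomb[OF h])
    fix \<psi> assume \<psi>: "test_function b \<psi>"
    define m where "m = (\<integral>x. \<psi> x \<partial>leb b) / I"
    have i: "integrable (leb b) \<psi>" "integrable (leb b) \<phi>0"
      "integrable (leb b) (\<lambda>x. h x * \<psi> x)" "integrable (leb b) (\<lambda>x. h x * \<phi>0 x)"
      by (intro L2_integrable test_function_L2[OF \<psi>] test_function_L2[OF \<phi>0]
        locally_integrable_mult_test[OF h \<psi>] locally_integrable_mult_test[OF h \<phi>0])+
    have t: "test_function b (\<lambda>x. 1 * \<psi> x + (- m) * \<phi>0 x)"
      by (rule test_function_lincomb[OF \<psi> \<phi>0])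
    have "(\<integral>x. 1 * \<psi> x + (- m) * \<phi>0 x \<partial>leb b) = 0"
      using i n by (simp add: m_def I_def \<phi>0_def)
    then obtain \<phi> where \<phi>: "test_function b \<phi>" "deriv \<phi> = (\<lambda>x. 1 * \<psi> x + (- m) * \<phi>0 x)"
      by (rule test_function_prim[OF t _ b])
    have "0 = (\<integral>x. h x * \<psi> x - m * (h x * \<phi>0 x) \<partial>leb b)"
      using zero[OF \<phi>(1)] by (simp add: \<phi>(2) algebra_simps)
    also have "\<dots> = ip b h \<psi> - m * ip b h \<phi>0"
      using i by simp
    also have "\<dots> = ip b h \<psi> - c * (\<integral>x. \<psi> x \<partial>leb b)"
      by (simp add: m_def c_def)
    also have "\<dots> = (\<integral>x. (1 * h x + (- c) * 1) * \<psi> x \<partial>leb b)"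
      using i by (simp add: left_diff_distrib)
    finally show "(\<integral>x. (1 * h x + (- c) * 1) * \<psi> x \<partial>leb b) = 0" by simp
  qed
  then show ?thesis using that[of c] by simp
qed

text \<open>The difference of \<open>f\<close> and \<open>prim b g\<close> has weak derivative zero
  and is therefore constant.\<close>

lemma has_weak_deriv_imp_AC:
  assumes b: "0 < b" and w: "has_weak_deriv b 1 f g" and g: "integrable (leb b) g"
  obtains F where "AC b F g" "AE x in leb b. f x = F x"
proof -
  have A: "AC b (prim b g) g" using AC_prim[OF g, of 0] by simp
  note w2 = has_weak_deriv_lincomb[OF w AC_has_weak_deriv[OF A b], of 1 "-1"]
  obtain c where "AE x in leb b. 1 * f x + (-1) * prim b g x = c"
    by (rule du_Bois_Reymond[OF b, of "\<lambda>x. 1 * f x + (-1) * prim b g x"])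
       (use w2 in \<open>auto simp: has_weak_deriv_def\<close>)
  then have "AE x in leb b. f x = c + prim b g x" by (auto elim!: eventually_mono)
  with AC_prim[OF g] show ?thesis by (rule that)
qed

section \<open>Traces and continuous representatives\<close>

lemma AE_leb_dense:
  assumes "AE x in leb b. P x" "0 \<le> a" "a < c" "c \<le> b"
  obtains x where "a < x" "x < c" "P x"
proof -
  have "\<exists>x\<in>{a<..<c}. P x"
  proof (rule ccontr)
    assume "\<not> (\<exists>x\<in>{a<..<c}. P x)"
    moreover have "AE x in lebesgue. 0 < x \<and> x < b \<longrightarrow> P x"
      using assms(1) by (simp add: AE_restrict_space_iff)
    ultimately have "AE x in lebesgue. x \<notin> {a<..<c}"
      using assms by (auto elim!: eventually_mono)
    then have "emeasure lebesgue {a<..<c} = 0"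
      by (subst (asm) AE_iff_measurable[of "{a<..<c}"]) auto
    then show False using assms by simp
  qed
  then show ?thesis using that by auto
qed

text \<open>A set of full measure accumulates at every point of the closed interval, end points
  included; so identities known almost everywhere extend by continuity, also to initial and boundary
  values.\<close>

lemma AE_leb_sequence:
  assumes "AE x in leb b. P x" "0 < b" "x \<in> {0..b}"
  obtains X :: "nat \<Rightarrow> real" where "\<And>n. X n \<in> {0<..<b}" "\<And>n. P (X n)" "X \<longlonglongrightarrow> x"
proof -
  have "\<exists>y. y \<in> {0<..<b} \<and> P y \<and> \<bar>y - x\<bar> \<le> 1 / Suc n" for n
  proof -
    define e where "e = 1 / real (Suc n)"
    have e: "0 < e" by (simp add: e_def)
    obtain y where "max 0 (x - e) < y" "y < min b (x + e)" "P y"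
      by (rule AE_leb_dense[OF assms(1), of "max 0 (x - e)" "min b (x + e)"])
         (use assms(2,3) e in auto)
    then have "y \<in> {0<..<b} \<and> P y \<and> \<bar>y - x\<bar> \<le> e" by auto
    then show ?thesis unfolding e_def by blast
  qed
  then obtain X where X: "\<And>n. X n \<in> {0<..<b}" "\<And>n. P (X n)" "\<And>n. \<bar>X n - x\<bar> \<le> 1 / Suc n"
    by metis
  have "(\<lambda>n. X n - x) \<longlonglongrightarrow> 0"
    by (rule Lim_null_comparison[OF _ LIMSEQ_Suc[OF lim_1_over_n]]) (use X in auto)
  then have "X \<longlonglongrightarrow> x" by (simp add: LIM_zero_iff)
  with X show ?thesis by (intro that)
qed

lemma continuous_AE_eq:
  fixes F G :: "real \<Rightarrow> real"
  assumes "continuous_on {0..b} F" "continuous_on {0..b} G" "AE x in leb b. F x = G x" "0 < b" "x \<in> {0..b}"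
  shows "F x = G x"
proof -
  obtain X where X: "\<And>n. X n \<in> {0<..<b}" "\<And>n. F (X n) = G (X n)" "X \<longlonglongrightarrow> x"
    by (rule AE_leb_sequence[OF assms(3-5)]) blast
  have "(\<lambda>n. F (X n)) \<longlonglongrightarrow> F x" "(\<lambda>n. G (X n)) \<longlonglongrightarrow> G x"
    using X(1) by (intro continuous_on_tendsto_compose[OF assms(1) X(3) assms(5)]
      continuous_on_tendsto_compose[OF assms(2) X(3) assms(5)] always_eventually allI; simp add: less_imp_le)+
  then show ?thesis unfolding X(2) by (rule LIMSEQ_unique)
qed

text \<open>Uniqueness of the continuous representative is what makes the definite description in
  \<open>trace\<close> denote a value.\<close>

lemma trace_eq:
  assumes "continuous_on {0..l} F" "AE x in leb l. F x = f x" "0 < l" "c \<in> {0..l}"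
  shows "trace l f c = F c"
  unfolding trace_def
proof (rule the_equality)
  fix y assume "\<exists>G. continuous_on {0..l} G \<and> (AE x in leb l. G x = f x) \<and> G c = y"
  then obtain G where G: "continuous_on {0..l} G" "AE x in leb l. G x = f x" "G c = y" by blast
  have "AE x in leb l. G x = F x" using G(2) assms(2) by eventually_elim simp
  then show "y = F c" using continuous_AE_eq[OF G(1) assms(1) _ assms(3,4)] G(3) by simp
qed (use assms in blast)

lemma wderivI:
  assumes "0 < l" "has_weak_deriv l j f g"
  shows "has_weak_deriv l j f (wderiv l j f)" "AE x in leb l. wderiv l j f x = g x"
proof -
  show *: "has_weak_deriv l j f (wderiv l j f)"
    unfolding wderiv_def using assms(2) by (rule someI[of "has_weak_deriv l j f"])
  show "AE x in leb l. wderiv l j f x = g x"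
    by (rule has_weak_deriv_unique[OF assms(1) * assms(2)])
qed

lemma Sobolev_wderiv:
  assumes "0 < l" "f \<in> Sobolev l k" "j \<le> k"
  shows "has_weak_deriv l j f (wderiv l j f)" "wderiv l j f \<in> L2 l"
proof -
  obtain g where g: "g \<in> L2 l" "has_weak_deriv l j f g"
    using assms by (auto simp: Sobolev_def)
  show "has_weak_deriv l j f (wderiv l j f)" using wderivI[OF assms(1) g(2)] by simp
  show "wderiv l j f \<in> L2 l"
    by (rule L2_cong_AE[OF g(1)]) (use wderivI(2)[OF assms(1) g(2)] in \<open>auto elim: eventually_mono\<close>)
qed

lemma Sobolev_L2: "f \<in> Sobolev l k \<Longrightarrow> f \<in> L2 l"
  by (simp add: Sobolev_def)

lemma Sobolev_mono: "f \<in> Sobolev l k \<Longrightarrow> j \<le> k \<Longrightarrow> f \<in> Sobolev l j"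
  by (auto simp: Sobolev_def)

text \<open>The passage from a weak derivative to an absolutely continuous representative is made
  twice, from the top derivative downwards.\<close>

lemma Sobolev2_AC:
  assumes l: "0 < l" and f: "f \<in> Sobolev l 2"
  obtains F F1 where "AC l F F1" "AC l F1 (wderiv l 2 f)"
    "AE x in leb l. f x = F x" "AE x in leb l. wderiv l 1 f x = F1 x"
proof -
  have w1: "has_weak_deriv l 1 f (wderiv l 1 f)" by (rule Sobolev_wderiv(1)[OF l f]) simp
  have w2: "has_weak_deriv l 2 f (wderiv l 2 f)" "wderiv l 2 f \<in> L2 l"
    by (rule Sobolev_wderiv[OF l f order_refl])+
  have "has_weak_deriv l 1 (wderiv l 1 f) (wderiv l 2 f)"
    by (rule has_weak_deriv_split[OF w1]) (unfold one_add_one, rule w2)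
  then obtain F1 where F1: "AC l F1 (wderiv l 2 f)" "AE x in leb l. wderiv l 1 f x = F1 x"
    using has_weak_deriv_imp_AC[OF l _ L2_integrable[OF w2(2)]] by blast
  have "has_weak_deriv l 1 f F1"
    by (rule has_weak_deriv_cong_AE[OF w1 _ F1(2)]) simp
  then obtain F where "AC l F F1" "AE x in leb l. f x = F x"
    using has_weak_deriv_imp_AC[OF l _ L2_integrable[OF AC_L2[OF F1(1) l]]] by blast
  with F1 show ?thesis by (intro that)
qed

text \<open>Evaluates the arbitrary choices in \<open>wderiv\<close> and \<open>trace\<close> by
  explicit functions.\<close>

lemma AC_wderiv:
  assumes l: "0 < l" and "AC l F F1" "AC l F1 f2" "AE x in leb l. f x = F x"
  shows "AE x in leb l. wderiv l 1 f x = F1 x" "AE x in leb l. wderiv l 2 f x = f2 x"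
    "\<And>c. c \<in> {0..l} \<Longrightarrow> trace l f c = F c" "\<And>c. c \<in> {0..l} \<Longrightarrow> trace l (wderiv l 1 f) c = F1 c"
proof -
  have F: "AE x in leb l. F x = f x" using assms(4) by (auto elim: eventually_mono)
  have w1: "has_weak_deriv l 1 F F1" and w2: "has_weak_deriv l 1 F1 f2"
    by (rule AC_has_weak_deriv[OF assms(2) l] AC_has_weak_deriv[OF assms(3) l])+
  have "has_weak_deriv l 1 f F1"
    by (rule has_weak_deriv_cong_AE[OF w1 F]) simp
  from wderivI(2)[OF l this] show 1: "AE x in leb l. wderiv l 1 f x = F1 x" .
  have "has_weak_deriv l 2 f f2"
    by (rule has_weak_deriv_cong_AE[OF has_weak_deriv_trans[OF w1 w2, unfolded one_add_one] F]) simp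
  from wderivI(2)[OF l this] show "AE x in leb l. wderiv l 2 f x = f2 x" .
  show "trace l f c = F c" if "c \<in> {0..l}" for c
    by (rule trace_eq[OF AC_continuous[OF assms(2)] F l that])
  show "trace l (wderiv l 1 f) c = F1 c" if "c \<in> {0..l}" for c
    by (rule trace_eq[OF AC_continuous[OF assms(3)] _ l that]) (use 1 in \<open>auto elim: eventually_mono\<close>)
qed

text \<open>Needed for the bending moment, whose two space derivatives are to be integrated by
  parts.\<close>

lemma Sobolev4_wderiv2:
  assumes l: "0 < l" and f: "f \<in> Sobolev l 4"
  shows "wderiv l 2 f \<in> Sobolev l 2"
  unfolding Sobolev_def
proof (intro CollectI conjI allI impI)
  fix j :: nat assume "j \<le> 2"
  then have j: "2 + j \<le> 4" by simp
  have "has_weak_deriv l j (wderiv l 2 f) (wderiv l (2 + j) f)"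
    by (rule has_weak_deriv_split[of l 2 f]) (intro Sobolev_wderiv[OF l f] j; simp)+
  with Sobolev_wderiv(2)[OF l f j] show "\<exists>g\<in>L2 l. has_weak_deriv l j (wderiv l 2 f) g" by blast
qed (use Sobolev_wderiv(2)[OF l f, of 2] in simp)

section \<open>Maps from a time interval to square integrable functions\<close>

lemma L2_integral_abs_le:
  assumes "f \<in> L2 l" shows "(\<integral>x. \<bar>f x\<bar> \<partial>leb l) \<le> L2norm l f * L2norm l (\<lambda>x. 1)"
proof -
  have a: "(\<lambda>x. \<bar>f x\<bar>) \<in> L2 l" using assms by (auto simp: L2_def)
  have "L2norm l (\<lambda>x. \<bar>f x\<bar>) = L2norm l f" by (simp add: L2norm_def)
  then show ?thesis using L2_Cauchy_Schwarz[OF a L2_const, of 1] by simp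
qed

text \<open>The bound is kept in telescoping form: \<open>C * (1/2)^k\<close> is the difference of
  \<open>2 * C * (1/2)^k\<close> and \<open>2 * C * (1/2)^(k+1)\<close>, so the induction closes
  without loss.\<close>

lemma L2norm_geometric_increment:
  assumes f: "\<And>k. f k \<in> L2 l" and d: "\<And>k. dist2 l (f (Suc k)) (f k) \<le> C * (1 / 2) ^ k"
  shows "L2norm l (\<lambda>x. f m x - f (m + p) x) \<le> 2 * C * (1 / 2) ^ m - 2 * C * (1 / 2) ^ (m + p)"
proof (induction p)
  case 0
  then show ?case by (simp add: L2norm_def)
next
  case (Suc p)
  have "L2norm l (\<lambda>x. f m x - f (m + Suc p) x) \<le> L2norm l (\<lambda>x. f m x - f (m + p) x) + L2norm l (\<lambda>x. f (m + p) x - f (m + Suc p) x)"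
    by (rule L2norm_diff_triangle) (rule f)+
  also have "L2norm l (\<lambda>x. f (m + p) x - f (m + Suc p) x) \<le> C * (1 / 2) ^ (m + p)"
    using d[of "m + p"] by (simp add: L2norm_minus_commute)
  finally show ?case using Suc by simp
qed

text \<open>The Riesz-Fischer argument for a sequence with geometric increments: the sum of the
  absolute increments has finite integral, so it is finite almost everywhere and the sequence
  converges there.\<close>

lemma L2_complete:
  assumes f: "\<And>k. f k \<in> L2 l" and d: "\<And>k. dist2 l (f (Suc k)) (f k) \<le> C * (1 / 2) ^ k"
  obtains h where "h \<in> L2 l" "(\<lambda>k. dist2 l (f k) h) \<longlonglongrightarrow> 0"
proof -
  have [measurable]: "f k \<in> borel_measurable (leb l)" for k using L2_measurable[OF f] .
  have "0 \<le> C" using order_trans[OF L2norm_nonneg d[of 0]] by simp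
  define K where "K = L2norm l (\<lambda>x. 1 :: real)"
  define \<delta> where "\<delta> k x = \<bar>f (Suc k) x - f k x\<bar>" for k x
  have \<delta>i: "integrable (leb l) (\<delta> k)" for k
    unfolding \<delta>_def by (intro integrable_abs L2_integrable L2_diff f)
  have sm: "summable (\<lambda>k. C * K * (1 / 2) ^ k)" by (intro summable_mult summable_geometric) simp
  have "(\<integral>\<^sup>+x. (\<Sum>k. ennreal (\<delta> k x)) \<partial>leb l) = (\<Sum>k. \<integral>\<^sup>+x. ennreal (\<delta> k x) \<partial>leb l)"
    by (rule nn_integral_suminf) (simp add: \<delta>_def)
  also have "\<dots> = (\<Sum>k. ennreal (\<integral>x. \<delta> k x \<partial>leb l))"
    by (intro suminf_cong nn_integral_eq_integral \<delta>i) (simp add: \<delta>_def)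
  also have "\<dots> \<le> (\<Sum>k. ennreal (C * K * (1 / 2) ^ k))"
  proof (intro suminf_le summableI ennreal_leI)
    fix k
    have "(\<integral>x. \<delta> k x \<partial>leb l) \<le> dist2 l (f (Suc k)) (f k) * K"
      unfolding \<delta>_def K_def by (intro L2_integral_abs_le L2_diff f)
    also have "\<dots> \<le> C * (1 / 2) ^ k * K" by (intro mult_right_mono d) (simp add: K_def)
    finally show "(\<integral>x. \<delta> k x \<partial>leb l) \<le> C * K * (1 / 2) ^ k" by (simp add: ac_simps)
  qed
  also have "\<dots> = ennreal (\<Sum>k. C * K * (1 / 2) ^ k)"
    using \<open>0 \<le> C\<close> sm by (intro suminf_ennreal2) (auto simp: K_def)
  finally have "(\<integral>\<^sup>+x. (\<Sum>k. ennreal (\<delta> k x)) \<partial>leb l) \<noteq> \<infinity>"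
    by (auto simp: top_unique)
  then have "AE x in leb l. (\<Sum>k. ennreal (\<delta> k x)) \<noteq> \<infinity>"
    by (intro nn_integral_PInf_AE) (auto simp: \<delta>_def)
  then have conv: "AE x in leb l. convergent (\<lambda>k. f k x)"
  proof eventually_elim
    case (elim x)
    then have "summable (\<lambda>k. \<delta> k x)"
      by (intro summable_suminf_not_top) (auto simp: \<delta>_def)
    then have "summable (\<lambda>k. f (Suc k) x - f k x)"
      unfolding \<delta>_def by (rule summable_rabs_cancel)
    then have "convergent (\<lambda>n. (\<Sum>k<n. f (Suc k) x - f k x) + f 0 x)"
      by (intro convergent_add convergent_const) (simp add: summable_iff_convergent)
    then show ?case by (simp add: sum_lessThan_telescope[of "\<lambda>k. f k x"])
  qed
  define h where "h x = lim (\<lambda>k. f k x)" for x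
  have h_meas [measurable]: "h \<in> borel_measurable (leb l)"
    unfolding h_def by (rule borel_measurable_lim_metric) simp
  \<comment> \<open>Fatou's lemma carries the bound on \<open>f m - f (m + p)\<close> to the limit
    in \<open>p\<close>.\<close>
  have dist: "(\<integral>\<^sup>+x. ennreal ((f m x - h x)\<^sup>2) \<partial>leb l) \<le> ennreal ((2 * C * (1 / 2) ^ m)\<^sup>2)" for m
  proof -
    have "(\<integral>\<^sup>+x. ennreal ((f m x - h x)\<^sup>2) \<partial>leb l) = (\<integral>\<^sup>+x. liminf (\<lambda>p. ennreal ((f m x - f (m + p) x)\<^sup>2)) \<partial>leb l)"
    proof (rule nn_integral_cong_AE)
      show "AE x in leb l. ennreal ((f m x - h x)\<^sup>2) = liminf (\<lambda>p. ennreal ((f m x - f (m + p) x)\<^sup>2))"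
        using conv
      proof eventually_elim
        case (elim x)
        then have "(\<lambda>k. f k x) \<longlonglongrightarrow> h x" by (simp add: h_def convergent_LIMSEQ_iff)
        then have "(\<lambda>p. f (m + p) x) \<longlonglongrightarrow> h x"
          using LIMSEQ_ignore_initial_segment[of "\<lambda>k. f k x" "h x" m] by (simp add: add.commute)
        then have "(\<lambda>p. ennreal ((f m x - f (m + p) x)\<^sup>2)) \<longlonglongrightarrow> ennreal ((f m x - h x)\<^sup>2)"
          by (intro tendsto_ennrealI tendsto_intros)
        then show ?case by (intro lim_imp_Liminf[symmetric]) auto
      qed
    qed
    also have "\<dots> \<le> liminf (\<lambda>p. \<integral>\<^sup>+x. ennreal ((f m x - f (m + p) x)\<^sup>2) \<partial>leb l)"
      by (rule nn_integral_liminf) simp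
    also have "\<dots> \<le> liminf (\<lambda>p::nat. ennreal ((2 * C * (1 / 2) ^ m)\<^sup>2))"
    proof (intro Liminf_mono always_eventually allI)
      fix p
      have "(\<integral>\<^sup>+x. ennreal ((f m x - f (m + p) x)\<^sup>2) \<partial>leb l) = ennreal ((L2norm l (\<lambda>x. f m x - f (m + p) x))\<^sup>2)"
        unfolding L2norm_power2 by (intro nn_integral_eq_integral L2_sq_integrable L2_diff f) simp
      also have "\<dots> \<le> ennreal ((2 * C * (1 / 2) ^ m)\<^sup>2)"
      proof (intro ennreal_leI power_mono)
        have "0 \<le> 2 * C * (1 / 2) ^ (m + p)" using \<open>0 \<le> C\<close> by simp
        then show "L2norm l (\<lambda>x. f m x - f (m + p) x) \<le> 2 * C * (1 / 2) ^ m"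
          using L2norm_geometric_increment[of f l C m p, OF f d] by linarith
      qed simp
      finally show "(\<integral>\<^sup>+x. ennreal ((f m x - f (m + p) x)\<^sup>2) \<partial>leb l) \<le> ennreal ((2 * C * (1 / 2) ^ m)\<^sup>2)" .
    qed
    finally show ?thesis by (simp add: Liminf_const)
  qed
  have dL2: "(\<lambda>x. f m x - h x) \<in> L2 l" for m
  proof -
    have "integrable (leb l) (\<lambda>x. (f m x - h x)\<^sup>2)"
      by (rule integrableI_bounded) (use dist[of m] in \<open>auto intro: le_less_trans\<close>)
    then show ?thesis by (simp add: L2_def)
  qed
  have hL2: "h \<in> L2 l" using L2_diff[OF f dL2, of 0 0] by simp
  have le: "dist2 l (f m) h \<le> 2 * C * (1 / 2) ^ m" for m
  proof (rule power2_le_imp_le)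
    have "ennreal ((dist2 l (f m) h)\<^sup>2) = (\<integral>\<^sup>+x. ennreal ((f m x - h x)\<^sup>2) \<partial>leb l)"
      unfolding L2norm_power2 by (intro nn_integral_eq_integral[symmetric] L2_sq_integrable dL2) simp
    with dist[of m] have "ennreal ((dist2 l (f m) h)\<^sup>2) \<le> ennreal ((2 * C * (1 / 2) ^ m)\<^sup>2)"
      by (simp only:)
    then show "(dist2 l (f m) h)\<^sup>2 \<le> (2 * C * (1 / 2) ^ m)\<^sup>2"
      by (subst (asm) ennreal_le_iff) simp_all
  qed (use \<open>0 \<le> C\<close> in simp)
  have "(\<lambda>m. 2 * C * (1 / 2) ^ m) \<longlonglongrightarrow> 2 * C * 0"
    by (intro tendsto_mult tendsto_const LIMSEQ_power_zero) simp
  then have lim0: "(\<lambda>m. 2 * C * (1 / 2) ^ m) \<longlonglongrightarrow> 0" by simp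
  have "(\<lambda>m. dist2 l (f m) h) \<longlonglongrightarrow> 0"
    by (rule Lim_null_comparison[OF _ lim0]) (simp add: le)
  with hL2 show ?thesis by (rule that)
qed

lemma L2_tendsto_integral:
  assumes f: "f \<in> L2 l" "\<And>n. F n \<in> L2 l" "(\<lambda>n. dist2 l f (F n)) \<longlonglongrightarrow> 0"
    and g: "g \<in> L2 l" "\<And>n. G n \<in> L2 l" "(\<lambda>n. dist2 l g (G n)) \<longlonglongrightarrow> 0"
  shows "(\<lambda>n. ip l (F n) (G n)) \<longlonglongrightarrow> ip l f g"
proof (rule LIM_zero_cancel, rule Lim_null_comparison)
  define a b where "a n = dist2 l f (F n)" and "b n = dist2 l g (G n)" for n
  have "(\<lambda>n. L2norm l f * b n + (a n * L2norm l g + a n * b n)) \<longlonglongrightarrow> L2norm l f * 0 + (0 * L2norm l g + 0 * 0)"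
    unfolding a_def b_def by (intro tendsto_intros f(3) g(3))
  then show "(\<lambda>n. L2norm l f * b n + (a n * L2norm l g + a n * b n)) \<longlonglongrightarrow> 0" by simp
  show "\<forall>\<^sub>F n in sequentially. norm (ip l (F n) (G n) - ip l f g) \<le> L2norm l f * b n + (a n * L2norm l g + a n * b n)"
  proof (intro always_eventually allI)
    fix n
    have dF: "(\<lambda>x. f x - F n x) \<in> L2 l" and dG: "(\<lambda>x. g x - G n x) \<in> L2 l"
      using f g by (auto intro: L2_diff)
    \<comment> \<open>Expanding around the limits avoids an a priori bound on the norms of the
      \<open>F n\<close>; each correction is small by Cauchy-Schwarz.\<close>
    have "ip l (F n) (G n) =
      (\<integral>x. f x * g x - f x * (g x - G n x) - (f x - F n x) * g x + (f x - F n x) * (g x - G n x) \<partial>leb l)"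
      by (simp add: algebra_simps)
    also have "\<dots> = ip l f g - (\<integral>x. f x * (g x - G n x) \<partial>leb l) - (\<integral>x. (f x - F n x) * g x \<partial>leb l) + (\<integral>x. (f x - F n x) * (g x - G n x) \<partial>leb l)"
      using L2_mult_integrable[OF f(1) g(1)] L2_mult_integrable[OF f(1) dG] L2_mult_integrable[OF dF g(1)] L2_mult_integrable[OF dF dG]
      by (simp only: Bochner_Integration.integral_add Bochner_Integration.integral_diff Bochner_Integration.integrable_add Bochner_Integration.integrable_diff)
    finally show "norm (ip l (F n) (G n) - ip l f g) \<le> L2norm l f * b n + (a n * L2norm l g + a n * b n)"
      using L2_Cauchy_Schwarz[OF f(1) dG] L2_Cauchy_Schwarz[OF dF g(1)] L2_Cauchy_Schwarz[OF dF dG]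
      unfolding a_def b_def real_norm_def by linarith
  qed
qed

lemma L2_tendsto_norm:
  assumes f: "f \<in> L2 l" "\<And>n. F n \<in> L2 l" "(\<lambda>n. dist2 l f (F n)) \<longlonglongrightarrow> 0"
  shows "(\<lambda>n. L2norm l (F n)) \<longlonglongrightarrow> L2norm l f"
proof -
  have "L2norm l h = sqrt (ip l h h)" for h
    by (simp add: L2norm_def power2_eq_square)
  then show ?thesis
    using tendsto_real_sqrt[OF L2_tendsto_integral[OF f f]] by simp
qed

text \<open>Strong measurability with convergence at every time instead of almost every time, so
  that measurability of derived quantities follows from pointwise limits.\<close>

definition L2_simple_limit :: "real \<Rightarrow> real \<Rightarrow> (nat \<Rightarrow> real \<Rightarrow> real \<Rightarrow> real) \<Rightarrow> (real \<Rightarrow> real \<Rightarrow> real) \<Rightarrow> bool" where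
  "L2_simple_limit l T s f \<longleftrightarrow> (\<forall>n. simple_function (leb T) (s n)) \<and>
     (\<forall>t\<in>{0<..<T}. f t \<in> L2 l \<and> (\<forall>n. s n t \<in> L2 l) \<and> (\<lambda>n. dist2 l (f t) (s n t)) \<longlonglongrightarrow> 0)"

lemma strongly_measurable_representative:
  assumes "strongly_measurable T (L2 l) (L2norm l) f" "AE t in leb T. f t \<in> L2 l"
  obtains s f' where "L2_simple_limit l T s f'" "AE t in leb T. f' t = f t"
proof -
  obtain s where s: "\<And>n. simple_function (leb T) (s n)" "\<And>n t. t \<in> {0<..<T} \<Longrightarrow> s n t \<in> L2 l"
    "AE t in leb T. (\<lambda>n. dist2 l (f t) (s n t)) \<longlonglongrightarrow> 0"
    using assms(1) unfolding strongly_measurable_def by blast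
  have "AE t in leb T. f t \<in> L2 l \<and> (\<lambda>n. dist2 l (f t) (s n t)) \<longlonglongrightarrow> 0"
    using s(3) assms(2) by eventually_elim blast
  then obtain N where N: "N \<in> null_sets (leb T)"
    "\<And>t. t \<in> {0<..<T} - N \<Longrightarrow> f t \<in> L2 l \<and> (\<lambda>n. dist2 l (f t) (s n t)) \<longlonglongrightarrow> 0"
    unfolding eventually_ae_filter space_lebesgue_on by blast
  \<comment> \<open>The map and its approximations are set to zero on the exceptional null set
    alike.\<close>
  define s' where "s' n t = (if t \<in> N then (\<lambda>x. 0) else s n t)" for n t
  define f' where "f' t = (if t \<in> N then (\<lambda>x. 0) else f t)" for t
  have "simple_function (leb T) (s' n)" for n
    unfolding s'_def using N(1) by (intro simple_function_If_set simple_function_const s(1)) auto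
  moreover have "f' t \<in> L2 l \<and> (\<forall>n. s' n t \<in> L2 l) \<and> (\<lambda>n. dist2 l (f' t) (s' n t)) \<longlonglongrightarrow> 0" if "t \<in> {0<..<T}" for t
    using N(2)[of t] s(2) that by (cases "t \<in> N") (auto simp: s'_def f'_def L2norm_def)
  ultimately have "L2_simple_limit l T s' f'" unfolding L2_simple_limit_def by blast
  moreover have "AE t in leb T. f' t = f t"
    using AE_not_in[OF N(1)] by eventually_elim (simp add: f'_def)
  ultimately show ?thesis by (rule that)
qed

text \<open>A simple function composed with any \<Phi> stays simple, so sequential continuity of
  \<Phi> in L2 is the whole input.\<close>

lemma L2_simple_limit_measurable:
  assumes "L2_simple_limit l T s f"
    and \<Phi>: "\<And>h H. h \<in> L2 l \<Longrightarrow> (\<And>n. H n \<in> L2 l) \<Longrightarrow> (\<lambda>n. dist2 l h (H n)) \<longlonglongrightarrow> 0 \<Longrightarrow> (\<lambda>n. \<Phi> (H n)) \<longlonglongrightarrow> (\<Phi> h :: real)"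
  shows "(\<lambda>t. \<Phi> (f t)) \<in> borel_measurable (leb T)"
proof (rule borel_measurable_LIMSEQ_real)
  show "(\<lambda>t. \<Phi> (s n t)) \<in> borel_measurable (leb T)" for n
    by (rule borel_measurable_simple_function[OF simple_function_compose1[of "leb T" "s n" \<Phi>]])
       (use assms(1) in \<open>simp add: L2_simple_limit_def\<close>)
  show "(\<lambda>n. \<Phi> (s n t)) \<longlonglongrightarrow> \<Phi> (f t)" if "t \<in> space (leb T)" for t
    by (rule \<Phi>) (use assms(1) that in \<open>auto simp: L2_simple_limit_def\<close>)
qed

lemma L2_simple_limit_integral_measurable:
  assumes "L2_simple_limit l T s f" "\<psi> \<in> L2 l"
  shows "(\<lambda>t. ip l (f t) \<psi>) \<in> borel_measurable (leb T)"
  by (rule L2_simple_limit_measurable[OF assms(1)], rule L2_tendsto_integral) (use assms(2) in \<open>auto simp: L2norm_def\<close>)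

lemma L2_simple_limit_norm_measurable:
  assumes "L2_simple_limit l T s f"
  shows "(\<lambda>t. L2norm l (f t)) \<in> borel_measurable (leb T)"
  by (rule L2_simple_limit_measurable[OF assms(1)], rule L2_tendsto_norm) auto

text \<open>Joint measurability in two independent times, which Fubini's theorem requires in the
  product rule.\<close>

lemma L2_simple_limit_pair_measurable:
  assumes f: "L2_simple_limit l T s f" and g: "L2_simple_limit l T r g"
  shows "(\<lambda>(t, \<tau>). ip l (f t) (g \<tau>)) \<in> borel_measurable (leb T \<Otimes>\<^sub>M leb T)"
proof (rule borel_measurable_LIMSEQ_real)
  show "(\<lambda>(t, \<tau>). ip l (s n t) (r n \<tau>)) \<in> borel_measurable (leb T \<Otimes>\<^sub>M leb T)" for n
  proof -
    have "simple_function (leb T \<Otimes>\<^sub>M leb T) (\<lambda>p. s n (fst p))" "simple_function (leb T \<Otimes>\<^sub>M leb T) (\<lambda>p. r n (snd p))"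
      using f g by (auto intro!: simple_function_comp[OF measurable_fst] simple_function_comp[OF measurable_snd] simp: L2_simple_limit_def)
    then have "simple_function (leb T \<Otimes>\<^sub>M leb T) (\<lambda>p. ip l (s n (fst p)) (r n (snd p)))"
      by (rule simple_function_compose2)
    then show ?thesis using borel_measurable_simple_function by (simp add: case_prod_beta')
  qed
  fix p assume "p \<in> space (leb T \<Otimes>\<^sub>M leb T)"
  then have "fst p \<in> {0<..<T}" "snd p \<in> {0<..<T}" by (auto simp: space_pair_measure)
  then have "(\<lambda>n. ip l (s n (fst p)) (r n (snd p))) \<longlonglongrightarrow> ip l (f (fst p)) (g (snd p))"
    using f g by (intro L2_tendsto_integral) (auto simp: L2_simple_limit_def)
  then show "(\<lambda>n. case p of (t, \<tau>) \<Rightarrow> ip l (s n t) (r n \<tau>)) \<longlonglongrightarrow> (case p of (t, \<tau>) \<Rightarrow> ip l (f t) (g \<tau>))"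
    by (simp add: case_prod_beta')
qed

section \<open>Square integrable maps into L2 and their time derivatives\<close>

abbreviation BL2 :: "real \<Rightarrow> real \<Rightarrow> (real \<Rightarrow> real \<Rightarrow> real) set" where
  "BL2 l T \<equiv> Bochner_L2 T (L2 l) (L2norm l)"

lemma BL2_AE: "f \<in> BL2 l T \<Longrightarrow> AE t in leb T. f t \<in> L2 l"
  by (simp add: Bochner_L2_def)

lemma BL2_representative:
  assumes "f \<in> BL2 l T"
  obtains s f' where "L2_simple_limit l T s f'" "AE t in leb T. f' t = f t"
  using strongly_measurable_representative[of T l f] assms unfolding Bochner_L2_def by blast

lemma BL2_norm: 
  assumes "f \<in> BL2 l T" shows "(\<lambda>t. L2norm l (f t)) \<in> L2 T"
proof -
  have i: "integrable (leb T) (\<lambda>t. (L2norm l (f t))\<^sup>2)" using assms by (simp add: Bochner_L2_def)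
  then have "(\<lambda>t. sqrt ((L2norm l (f t))\<^sup>2)) \<in> borel_measurable (leb T)"
    by (rule measurable_compose[OF borel_measurable_integrable borel_measurable_sqrt])
  with i show ?thesis by (simp add: L2_def)
qed

lemma BL2I:
  assumes "L2_simple_limit l T s f'" "AE t in leb T. f' t = f t" "integrable (leb T) g" "AE t in leb T. (L2norm l (f t))\<^sup>2 \<le> g t"
  shows "f \<in> BL2 l T"
proof -
  have S: "f' t \<in> L2 l \<and> (\<lambda>n. dist2 l (f' t) (s n t)) \<longlonglongrightarrow> 0" if "t \<in> {0<..<T}" for t
    using assms(1) that unfolding L2_simple_limit_def by blast
  have inT: "AE t in leb T. t \<in> {0<..<T}" using AE_space[of "leb T"] by simp
  have "strongly_measurable T (L2 l) (L2norm l) f"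
    unfolding strongly_measurable_def
  proof (intro exI[of _ s] conjI allI ballI)
    show "AE t in leb T. (\<lambda>n. dist2 l (f t) (s n t)) \<longlonglongrightarrow> 0"
      using inT assms(2)
    proof eventually_elim
      case (elim t) show ?case using S[OF elim(1)] unfolding elim(2) by blast
    qed
  qed (use assms(1) in \<open>auto simp: L2_simple_limit_def\<close>)
  moreover have "AE t in leb T. f t \<in> L2 l"
    using inT assms(2)
  proof eventually_elim
    case (elim t) show ?case using S[OF elim(1)] unfolding elim(2) by blast
  qed
  moreover have "integrable (leb T) (\<lambda>t. (L2norm l (f t))\<^sup>2)"
  proof (rule Bochner_Integration.integrable_bound[OF assms(3)])
    have "(\<lambda>t. (L2norm l (f' t))\<^sup>2) \<in> borel_measurable (leb T)"
      by (intro borel_measurable_power L2_simple_limit_norm_measurable[OF assms(1)])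
    then show "(\<lambda>t. (L2norm l (f t))\<^sup>2) \<in> borel_measurable (leb T)"
      by (rule borel_measurable_leb_AE) (use assms(2) in \<open>auto elim: eventually_mono\<close>)
    show "AE t in leb T. norm ((L2norm l (f t))\<^sup>2) \<le> norm (g t)"
      using assms(4) by eventually_elim auto
  qed
  ultimately show ?thesis by (simp add: Bochner_L2_def)
qed

lemma BL2_cong_AE:
  assumes "f \<in> BL2 l T" "AE t in leb T. f t = f' t"
  shows "f' \<in> BL2 l T"
proof -
  obtain s h where sh: "L2_simple_limit l T s h" "AE t in leb T. h t = f t" by (rule BL2_representative[OF assms(1)])
  show ?thesis
  proof (rule BL2I[OF sh(1)])
    show "AE t in leb T. h t = f' t" using sh(2) assms(2) by eventually_elim simp
    show "integrable (leb T) (\<lambda>t. (L2norm l (f t))\<^sup>2)" using assms(1) by (simp add: Bochner_L2_def)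
    show "AE t in leb T. (L2norm l (f' t))\<^sup>2 \<le> (L2norm l (f t))\<^sup>2" using assms(2) by eventually_elim simp
  qed
qed

lemma BL2_integrable:
  assumes "f \<in> BL2 l T" "\<psi> \<in> L2 l"
  shows "integrable (leb T) (\<lambda>t. ip l (f t) \<psi>)"
    "AE t in leb T. \<bar>ip l (f t) \<psi>\<bar> \<le> L2norm l (f t) * L2norm l \<psi>"
proof -
  obtain s f' where sf: "L2_simple_limit l T s f'" "AE t in leb T. f' t = f t" by (rule BL2_representative[OF assms(1)])
  show ae: "AE t in leb T. \<bar>ip l (f t) \<psi>\<bar> \<le> L2norm l (f t) * L2norm l \<psi>"
    using BL2_AE[OF assms(1)] by eventually_elim (rule L2_Cauchy_Schwarz[OF _ assms(2)])
  show "integrable (leb T) (\<lambda>t. ip l (f t) \<psi>)"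
  proof (rule Bochner_Integration.integrable_bound)
    show "integrable (leb T) (\<lambda>t. L2norm l (f t) * L2norm l \<psi>)"
      by (intro integrable_mult_left L2_integrable BL2_norm[OF assms(1)])
    show "(\<lambda>t. ip l (f t) \<psi>) \<in> borel_measurable (leb T)"
      by (rule borel_measurable_leb_AE[OF L2_simple_limit_integral_measurable[OF sf(1) assms(2)]])
         (use sf(2) in \<open>auto elim: eventually_mono\<close>)
    show "AE t in leb T. norm (ip l (f t) \<psi>) \<le> norm (L2norm l (f t) * L2norm l \<psi>)"
      using ae by eventually_elim (simp add: abs_mult)
  qed
qed

lemma BL2_mult:
  assumes "f \<in> BL2 l T" "a \<in> borel_measurable (leb l)" "AE x in leb l. \<bar>a x\<bar> \<le> C" "0 \<le> C"
  shows "(\<lambda>t x. a x * f t x) \<in> BL2 l T"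
proof -
  obtain s f' where sf: "L2_simple_limit l T s f'" "AE t in leb T. f' t = f t" by (rule BL2_representative[OF assms(1)])
  note S = sf(1)[unfolded L2_simple_limit_def]
  have m: "(\<lambda>x. a x * h x) \<in> L2 l" if "h \<in> L2 l" for h
    by (rule L2_mult_bounded[OF that assms(2,3)])
  have "L2_simple_limit l T (\<lambda>n t x. a x * s n t x) (\<lambda>t x. a x * f' t x)"
    unfolding L2_simple_limit_def
  proof (intro conjI allI ballI)
    show "simple_function (leb T) (\<lambda>t x. a x * s n t x)" for n
      by (rule simple_function_compose1[where g = "\<lambda>h x. a x * h x"]) (use S in simp)
    fix t assume t: "t \<in> {0<..<T}"
    have L: "f' t \<in> L2 l" "\<And>n. s n t \<in> L2 l" using S t by auto
    show "(\<lambda>x. a x * f' t x) \<in> L2 l" "\<And>n. (\<lambda>x. a x * s n t x) \<in> L2 l" using L m by auto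
    show "(\<lambda>n. L2norm l (\<lambda>x. a x * f' t x - a x * s n t x)) \<longlonglongrightarrow> 0"
    proof (rule Lim_null_comparison)
      have "(\<lambda>n. C * dist2 l (f' t) (s n t)) \<longlonglongrightarrow> C * 0"
        using S t by (intro tendsto_mult tendsto_const) auto
      then show "(\<lambda>n. C * dist2 l (f' t) (s n t)) \<longlonglongrightarrow> 0" by simp
      show "\<forall>\<^sub>F n in sequentially. norm (L2norm l (\<lambda>x. a x * f' t x - a x * s n t x)) \<le> C * dist2 l (f' t) (s n t)"
        using L2norm_mult_bounded[OF L2_diff[OF L] assms(2-4)] by (auto simp: right_diff_distrib)
    qed
  qed
  then show ?thesis
  proof (rule BL2I)
    show "AE t in leb T. (\<lambda>x. a x * f' t x) = (\<lambda>x. a x * f t x)" using sf(2) by eventually_elim simp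
    show "integrable (leb T) (\<lambda>t. C\<^sup>2 * (L2norm l (f t))\<^sup>2)"
      using assms(1) by (simp add: Bochner_L2_def)
    show "AE t in leb T. (L2norm l (\<lambda>x. a x * f t x))\<^sup>2 \<le> C\<^sup>2 * (L2norm l (f t))\<^sup>2"
      using BL2_AE[OF assms(1)]
    proof eventually_elim
      case (elim t)
      have "(L2norm l (\<lambda>x. a x * f t x))\<^sup>2 \<le> (C * L2norm l (f t))\<^sup>2"
        by (intro power_mono L2norm_mult_bounded[OF elim assms(2-4)] L2norm_nonneg)
      then show ?case by (simp add: power_mult_distrib)
    qed
  qed
qed

text \<open>Only the scalar pairings are asked to be indefinite integrals, so no integral of an
  L2-valued map has to be formed. \<open>F\<close> has a value in \<open>L2 l\<close> at every time
  of the closed interval; its density \<open>f\<close> is constrained almost everywhere.\<close>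

definition L2_AC :: "real \<Rightarrow> real \<Rightarrow> (real \<Rightarrow> real \<Rightarrow> real) \<Rightarrow> (real \<Rightarrow> real \<Rightarrow> real) \<Rightarrow> bool" where
  "L2_AC l T F f \<longleftrightarrow> f \<in> BL2 l T \<and> (\<forall>t\<in>{0..T}. F t \<in> L2 l) \<and>
     (\<forall>\<psi>\<in>L2 l. AC T (\<lambda>t. ip l (F t) \<psi>) (\<lambda>t. ip l (f t) \<psi>))"

lemma L2_AC_integral:
  assumes "L2_AC l T F f" "\<psi> \<in> L2 l"
  shows "AC T (\<lambda>t. ip l (F t) \<psi>) (\<lambda>t. ip l (f t) \<psi>)"
  by (rule bspec[OF assms(1)[unfolded L2_AC_def, THEN conjunct2, THEN conjunct2] assms(2)])

lemma weak_time_deriv_imp_weak_deriv: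
  assumes "has_weak_time_deriv l T f g" "\<psi> \<in> L2 l"
  shows "has_weak_deriv T 1 (\<lambda>t. ip l (f t) \<psi>) (\<lambda>t. ip l (g t) \<psi>)"
proof -
  have fg: "f \<in> BL2 l T" "g \<in> BL2 l T" using assms(1) by (auto simp: has_weak_time_deriv_def)
  show ?thesis
    unfolding has_weak_deriv_def
  proof (intro conjI allI impI)
    show "locally_integrable T (\<lambda>t. ip l (f t) \<psi>)" "locally_integrable T (\<lambda>t. ip l (g t) \<psi>)"
      by (intro integrable_imp_locally_integrable BL2_integrable(1)[OF _ assms(2)] fg)+
    fix \<phi> assume "test_function T \<phi>"
    then have "(\<integral>t. deriv \<phi> t * ip l (f t) \<psi> \<partial>leb T) = - (\<integral>t. \<phi> t * ip l (g t) \<psi> \<partial>leb T)"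
      using assms unfolding has_weak_time_deriv_def by blast
    then show "(\<integral>t. ip l (f t) \<psi> * (deriv ^^ 1) \<phi> t \<partial>leb T) = (- 1) ^ 1 * (\<integral>t. ip l (g t) \<psi> * \<phi> t \<partial>leb T)"
      by (simp add: mult.commute)
  qed
qed

text \<open>The exceptional null set of times depends on the function tested against. It suffices to test
  with the countably many values of simple functions approximating f, since the increments of f
  are limits of differences of such values.\<close>

lemma weak_time_deriv_increment:
  assumes T: "0 < T" and fg: "has_weak_time_deriv l T f g"
  obtains S where "AE t in leb T. t \<in> S" "\<And>t. t \<in> S \<Longrightarrow> f t \<in> L2 l"
    "\<And>s t. s \<in> S \<Longrightarrow> t \<in> S \<Longrightarrow> (dist2 l (f s) (f t)) \<le>
       \<bar>prim T (\<lambda>t. L2norm l (g t)) s - prim T (\<lambda>t. L2norm l (g t)) t\<bar>"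
proof -
  have f: "f \<in> BL2 l T" and g: "g \<in> BL2 l T" using fg by (auto simp: has_weak_time_deriv_def)
  obtain \<sigma> f' where sf: "L2_simple_limit l T \<sigma> f'" "AE t in leb T. f' t = f t" by (rule BL2_representative[OF f])
  define D where "D = (\<Union>n. \<sigma> n ` {0<..<T})"
  have D: "countable D"
    unfolding D_def using sf(1) by (intro countable_UN countableI_type countable_finite) (auto simp: L2_simple_limit_def simple_function_def)
  have DL2: "c \<in> L2 l" if "c \<in> D" for c using that sf(1) by (auto simp: D_def L2_simple_limit_def)
  have "\<exists>k. AE t in leb T. ip l (f t) c = k + prim T (\<lambda>t. ip l (g t) c) t" if c: "c \<in> D" for c
  proof -
    obtain F where F: "AC T F (\<lambda>t. ip l (g t) c)" "AE t in leb T. ip l (f t) c = F t"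
      by (rule has_weak_deriv_imp_AC[OF T weak_time_deriv_imp_weak_deriv[OF fg DL2[OF c]] BL2_integrable(1)[OF g DL2[OF c]]])
    have "AE t in leb T. t \<in> {0<..<T}" using AE_space[of "leb T"] by simp
    with F(2) have "AE t in leb T. ip l (f t) c = F 0 + prim T (\<lambda>t. ip l (g t) c) t"
    proof eventually_elim
      case (elim t)
      then have "t \<in> {0..T}" by simp
      from AC_eq[OF F(1) this] elim(1) show ?case by (rule trans[rotated])
    qed
    then show ?thesis by blast
  qed
  then have "\<forall>c\<in>D. \<exists>k. AE t in leb T. ip l (f t) c = k + prim T (\<lambda>t. ip l (g t) c) t" by blast
  from bchoice[OF this] obtain k where k: "\<And>c. c \<in> D \<Longrightarrow> AE t in leb T. ip l (f t) c = k c + prim T (\<lambda>t. ip l (g t) c) t"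
    by blast
  \<comment> \<open>One null set of times is discarded for each of the countably many test vectors
    in \<open>D\<close>.\<close>
  define S where "S = {t \<in> {0<..<T}. f' t = f t \<and> (\<forall>c\<in>D. ip l (f t) c = k c + prim T (\<lambda>t. ip l (g t) c) t)}"
  have "AE t in leb T. \<forall>c\<in>D. ip l (f t) c = k c + prim T (\<lambda>t. ip l (g t) c) t"
    unfolding AE_ball_countable[OF D] using k by blast
  moreover have "AE t in leb T. t \<in> {0<..<T}" using AE_space[of "leb T"] by simp
  ultimately have Sae: "AE t in leb T. t \<in> S"
    using sf(2) by eventually_elim (unfold S_def, blast)
  have SL: "f t \<in> L2 l" "\<And>n. \<sigma> n t \<in> L2 l" "\<And>n. \<sigma> n t \<in> D" "(\<lambda>n. dist2 l (f t) (\<sigma> n t)) \<longlonglongrightarrow> 0" if "t \<in> S" for t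
  proof -
    have t: "t \<in> {0<..<T}" "f' t = f t" using that by (auto simp: S_def)
    then have *: "f' t \<in> L2 l" "(\<lambda>n. dist2 l (f' t) (\<sigma> n t)) \<longlonglongrightarrow> 0" "\<And>n. \<sigma> n t \<in> L2 l"
      using sf(1) unfolding L2_simple_limit_def by blast+
    show "f t \<in> L2 l" "(\<lambda>n. dist2 l (f t) (\<sigma> n t)) \<longlonglongrightarrow> 0" using *(1,2) unfolding t(2) .
    show "\<And>n. \<sigma> n t \<in> L2 l" by (rule *(3))
    show "\<sigma> n t \<in> D" for n using t(1) unfolding D_def by blast
  qed
  have "dist2 l (f s) (f t) \<le> \<bar>prim T (\<lambda>t. L2norm l (g t)) s - prim T (\<lambda>t. L2norm l (g t)) t\<bar>" if st: "s \<in> S" "t \<in> S" for s t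
  proof -
    define N where "N = prim T (\<lambda>t. L2norm l (g t))"
    define y where "y x = f s x - f t x" for x
    define y' where "y' n x = \<sigma> n s x - \<sigma> n t x" for n x
    have yL: "y \<in> L2 l" "\<And>n. y' n \<in> L2 l" unfolding y_def y'_def using SL st by (auto intro: L2_diff)
    have "(\<lambda>n. dist2 l (f s) (\<sigma> n s) + dist2 l (f t) (\<sigma> n t)) \<longlonglongrightarrow> 0 + 0"
      using SL(4) st by (intro tendsto_add) auto
    moreover have "dist2 l y (y' n) \<le> dist2 l (f s) (\<sigma> n s) + dist2 l (f t) (\<sigma> n t)" for n
    proof -
      have "L2norm l (\<lambda>x. (f s x - \<sigma> n s x) + (\<sigma> n t x - f t x)) \<le> dist2 l (f s) (\<sigma> n s) + dist2 l (\<sigma> n t) (f t)"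
        using SL st by (intro L2norm_triangle L2_diff)
      then show ?thesis by (simp add: y_def y'_def L2norm_minus_commute[of l "f t"] algebra_simps)
    qed
    ultimately have lim: "(\<lambda>n. dist2 l y (y' n)) \<longlonglongrightarrow> 0"
      by (rule_tac Lim_null_comparison[where g = "\<lambda>n. dist2 l (f s) (\<sigma> n s) + dist2 l (f t) (\<sigma> n t)"]) simp_all
    \<comment> \<open>The increment \<open>y\<close> is tested against \<open>y' n\<close>, a
      difference of two members of \<open>D\<close> that tends to \<open>y\<close>. In the limit
      this bounds the squared norm of \<open>y\<close> by the norm of \<open>y\<close> times
      \<open>\<bar>N s - N t\<bar>\<close>.\<close>
    have le: "ip l y (y' n) \<le> L2norm l (y' n) * \<bar>N s - N t\<bar>" for n
    proof -
      have inc: "ip l y c = prim T (\<lambda>t. ip l (g t) c) s - prim T (\<lambda>t. ip l (g t) c) t" if "c \<in> D" for c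
      proof -
        have "ip l y c = ip l (f s) c - ip l (f t) c"
          using L2_mult_integrable[OF SL(1)[OF st(1)] DL2[OF that]] L2_mult_integrable[OF SL(1)[OF st(2)] DL2[OF that]]
          by (simp add: y_def left_diff_distrib)
        then show ?thesis using st that by (simp add: S_def)
      qed
      define a b where "a = \<sigma> n s" and "b = \<sigma> n t"
      have ab: "a \<in> D" "b \<in> D" using SL(3) st by (auto simp: a_def b_def)
      note abL = DL2[OF ab(1)] DL2[OF ab(2)]
      have G: "prim T (\<lambda>t. ip l (g t) (y' n)) \<tau> = prim T (\<lambda>t. ip l (g t) a) \<tau> - prim T (\<lambda>t. ip l (g t) b) \<tau>" for \<tau>
      proof -
        have "prim T (\<lambda>t. ip l (g t) (y' n)) \<tau> = prim T (\<lambda>t. ip l (g t) a - ip l (g t) b) \<tau>"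
        proof (rule prim_cong_AE)
          show "AE t in leb T. ip l (g t) (y' n) = ip l (g t) a - ip l (g t) b"
            using BL2_AE[OF g]
          proof eventually_elim
            case (elim t)
            then show ?case using L2_mult_integrable[OF elim abL(1)] L2_mult_integrable[OF elim abL(2)]
              by (simp add: y'_def a_def b_def right_diff_distrib)
          qed
        qed (use BL2_integrable(1)[OF g] abL yL(2) in auto)
        then show ?thesis using prim_diff[OF BL2_integrable(1)[OF g abL(1)] BL2_integrable(1)[OF g abL(2)]] by simp
      qed
      have "ip l y (y' n) = ip l y a - ip l y b"
        using L2_mult_integrable[OF yL(1) abL(1)] L2_mult_integrable[OF yL(1) abL(2)]
        by (simp add: y'_def a_def b_def right_diff_distrib)
      also have "\<dots> = prim T (\<lambda>t. ip l (g t) (y' n)) s - prim T (\<lambda>t. ip l (g t) (y' n)) t"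
        unfolding inc[OF ab(1)] inc[OF ab(2)] G by simp
      also have "\<dots> \<le> \<bar>\<dots>\<bar>" by simp
      also have "\<dots> \<le> \<bar>prim T (\<lambda>t. L2norm l (g t) * L2norm l (y' n)) s - prim T (\<lambda>t. L2norm l (g t) * L2norm l (y' n)) t\<bar>"
        by (intro prim_increment_mono BL2_integrable[OF g yL(2)] integrable_mult_left L2_integrable BL2_norm[OF g])
      also have "\<dots> = \<bar>L2norm l (y' n) * (N s - N t)\<bar>"
        by (simp add: N_def mult.commute[of _ "L2norm l (y' n)"] prim_scale right_diff_distrib)
      also have "\<dots> = L2norm l (y' n) * \<bar>N s - N t\<bar>" by (simp add: abs_mult)
      finally show ?thesis .
    qed
    have l1: "(\<lambda>n. ip l y (y' n)) \<longlonglongrightarrow> ip l y y"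
      using L2_tendsto_integral[OF yL(1) yL(1) _ yL lim] by (simp add: L2norm_def)
    have l2: "(\<lambda>n. L2norm l (y' n) * \<bar>N s - N t\<bar>) \<longlonglongrightarrow> L2norm l y * \<bar>N s - N t\<bar>"
      by (intro tendsto_mult tendsto_const L2_tendsto_norm[OF yL lim])
    have "ip l y y \<le> L2norm l y * \<bar>N s - N t\<bar>"
      by (rule LIMSEQ_le[OF l1 l2]) (use le in blast)
    then have "L2norm l y * L2norm l y \<le> L2norm l y * \<bar>N s - N t\<bar>"
      using L2norm_power2[of l y] by (simp add: power2_eq_square)
    then have "L2norm l y \<le> \<bar>N s - N t\<bar>"
      using L2norm_nonneg[of l y] by (cases "L2norm l y = 0") (auto simp: mult_le_cancel_left)
    then show ?thesis unfolding N_def y_def .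
  qed
  with Sae SL(1) show ?thesis by (rule that)
qed

text \<open>At the times of a set of full measure, \<open>f\<close> has the continuous modulus given
  by \<open>N\<close>; by completeness of L2 it extends to the closed interval with the same
  modulus. Existence is what gives meaning to the choice in \<open>continuous_rep\<close>.\<close>

lemma weak_time_deriv_continuous_rep_exists:
  assumes T: "0 < T" and fg: "has_weak_time_deriv l T f g"
  obtains F where "L2_continuous l T F" "AE t in leb T. AE x in leb l. F t x = f t x"
proof -
  have g: "g \<in> BL2 l T" using fg by (auto simp: has_weak_time_deriv_def)
  define N where "N = prim T (\<lambda>t. L2norm l (g t))"
  obtain S where S: "AE t in leb T. t \<in> S" "\<And>t. t \<in> S \<Longrightarrow> f t \<in> L2 l"
    "\<And>s t. s \<in> S \<Longrightarrow> t \<in> S \<Longrightarrow> (dist2 l (f s) (f t)) \<le> \<bar>N s - N t\<bar>"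
    unfolding N_def by (rule weak_time_deriv_increment[OF T fg]) blast
  have N: "continuous_on UNIV N" unfolding N_def by (intro prim_continuous L2_integrable BL2_norm[OF g])
  have Nlim: "(\<lambda>n. N (X n)) \<longlonglongrightarrow> N t" if "X \<longlonglongrightarrow> t" for X :: "nat \<Rightarrow> real" and t
    using continuous_on_tendsto_compose[OF N that] by simp
  have "\<exists>h\<in>L2 l. \<forall>s\<in>S. dist2 l (f s) h \<le> \<bar>N s - N t\<bar>" if t: "t \<in> {0..T}" for t
  proof -
    obtain X where X: "\<And>n. X n \<in> S" "X \<longlonglongrightarrow> t"
      by (rule AE_leb_sequence[OF S(1) T t]) blast
    \<comment> \<open>Indices along which \<open>N\<close> converges at the geometric rate that
      \<open>L2_complete\<close> asks for. Two successive errors add up to at most twice that rate,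
      hence the constant 2 below.\<close>
    have "\<forall>k. \<exists>n. \<bar>N (X n) - N t\<bar> < (1 / 2) ^ k"
    proof
      fix k
      have "0 < (1 / 2 :: real) ^ k" by simp
      from LIMSEQ_D[OF Nlim[OF X(2)] this] show "\<exists>n. \<bar>N (X n) - N t\<bar> < (1 / 2) ^ k"
        unfolding real_norm_def by blast
    qed
    from choice[OF this] obtain r where r: "\<And>k. \<bar>N (X (r k)) - N t\<bar> < (1 / 2) ^ k" by blast
    have "L2norm l (\<lambda>x. f (X (r (Suc k))) x - f (X (r k)) x) \<le> 2 * (1 / 2) ^ k" for k
    proof -
      have "(1 / 2 :: real) ^ Suc k \<le> (1 / 2) ^ k" by simp
      then show ?thesis
        using S(3)[OF X(1)[of "r (Suc k)"] X(1)[of "r k"]] r[of k] r[of "Suc k"] by linarith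
    qed
    then obtain h where h: "h \<in> L2 l" "(\<lambda>k. (dist2 l (f (X (r k))) h)) \<longlonglongrightarrow> 0"
      by (rule L2_complete[of "\<lambda>k. f (X (r k))" l 2, OF S(2)[OF X(1)]])
    have Nr: "(\<lambda>k. N (X (r k))) \<longlonglongrightarrow> N t"
    proof (rule LIM_zero_cancel, rule Lim_null_comparison)
      show "(\<lambda>k. (1 / 2 :: real) ^ k) \<longlonglongrightarrow> 0" by (rule LIMSEQ_power_zero) simp
      show "\<forall>\<^sub>F k in sequentially. norm (N (X (r k)) - N t) \<le> (1 / 2) ^ k"
        using r by (auto intro!: always_eventually less_imp_le)
    qed
    have "dist2 l (f s) h \<le> \<bar>N s - N t\<bar>" if s: "s \<in> S" for s
    proof (rule LIMSEQ_le)
      show "(\<lambda>k. dist2 l (f s) h) \<longlonglongrightarrow> dist2 l (f s) h" by (rule tendsto_const)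
      have "(\<lambda>k. \<bar>N s - N (X (r k))\<bar> + (dist2 l (f (X (r k))) h)) \<longlonglongrightarrow> \<bar>N s - N t\<bar> + 0"
        by (intro tendsto_intros Nr h(2))
      then show "(\<lambda>k. \<bar>N s - N (X (r k))\<bar> + (dist2 l (f (X (r k))) h)) \<longlonglongrightarrow> \<bar>N s - N t\<bar>" by simp
      have "dist2 l (f s) h \<le> \<bar>N s - N (X (r k))\<bar> + (dist2 l (f (X (r k))) h)" for k
        using L2norm_diff_triangle[OF S(2)[OF s] S(2)[OF X(1)] h(1), of "r k"] S(3)[OF s X(1), of "r k"] by linarith
      then show "\<exists>M. \<forall>k\<ge>M. dist2 l (f s) h \<le> \<bar>N s - N (X (r k))\<bar> + (dist2 l (f (X (r k))) h)" by blast
    qed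
    with h(1) show ?thesis by blast
  qed
  then have "\<forall>t\<in>{0..T}. \<exists>h. h \<in> L2 l \<and> (\<forall>s\<in>S. dist2 l (f s) h \<le> \<bar>N s - N t\<bar>)"
    by blast
  from bchoice[OF this] obtain F where F: "\<And>t. t \<in> {0..T} \<Longrightarrow> F t \<in> L2 l"
    "\<And>t s. t \<in> {0..T} \<Longrightarrow> s \<in> S \<Longrightarrow> (dist2 l (f s) (F t)) \<le> \<bar>N s - N t\<bar>"
    by blast
  \<comment> \<open>Values at two arbitrary times are compared through times of \<open>S\<close>
    approaching \<open>t\<close>.\<close>
  have dist: "dist2 l (F s) (F t) \<le> \<bar>N s - N t\<bar>" if st: "s \<in> {0..T}" "t \<in> {0..T}" for s t
  proof -
    obtain X where X: "\<And>n. X n \<in> S" "X \<longlonglongrightarrow> t"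
      by (rule AE_leb_sequence[OF S(1) T st(2)]) blast
    show ?thesis
    proof (rule LIMSEQ_le)
      show "(\<lambda>k. dist2 l (F s) (F t)) \<longlonglongrightarrow> dist2 l (F s) (F t)" by (rule tendsto_const)
      have "(\<lambda>k. \<bar>N (X k) - N s\<bar> + \<bar>N (X k) - N t\<bar>) \<longlonglongrightarrow> \<bar>N t - N s\<bar> + \<bar>N t - N t\<bar>"
        by (intro tendsto_intros Nlim X(2))
      then show "(\<lambda>k. \<bar>N (X k) - N s\<bar> + \<bar>N (X k) - N t\<bar>) \<longlonglongrightarrow> \<bar>N s - N t\<bar>" by (simp add: abs_minus_commute)
      have "dist2 l (F s) (F t) \<le> \<bar>N (X k) - N s\<bar> + \<bar>N (X k) - N t\<bar>" for k
        using L2norm_diff_triangle[OF F(1)[OF st(1)] S(2)[OF X(1)] F(1)[OF st(2)], of k]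
          F(2)[OF st(1) X(1), of k] F(2)[OF st(2) X(1), of k]
        by (simp add: L2norm_minus_commute[of l "F s"])
      then show "\<exists>M. \<forall>k\<ge>M. dist2 l (F s) (F t) \<le> \<bar>N (X k) - N s\<bar> + \<bar>N (X k) - N t\<bar>" by blast
    qed
  qed
  have "L2_continuous l T F"
    unfolding L2_continuous_def
  proof (intro ballI conjI F(1))
    fix t assume t: "t \<in> {0..T}"
    show "((\<lambda>s. dist2 l (F s) (F t)) \<longlongrightarrow> 0) (at t within {0..T})"
    proof (rule Lim_null_comparison)
      have "(N \<longlongrightarrow> N t) (at t within {0..T})"
        using continuous_on_subset[OF N, of "{0..T}"] t by (auto simp: continuous_on_def)
      then have "((\<lambda>s. \<bar>N s - N t\<bar>) \<longlongrightarrow> \<bar>N t - N t\<bar>) (at t within {0..T})"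
        by (intro tendsto_intros)
      then show "((\<lambda>s. \<bar>N s - N t\<bar>) \<longlongrightarrow> 0) (at t within {0..T})" by simp
      show "\<forall>\<^sub>F s in at t within {0..T}. norm (dist2 l (F s) (F t)) \<le> \<bar>N s - N t\<bar>"
        using dist[OF _ t] by (auto simp: eventually_at_filter intro!: always_eventually)
    qed
  qed
  moreover have "AE t in leb T. t \<in> {0<..<T}" using AE_space[of "leb T"] by simp
  with S(1) have "AE t in leb T. AE x in leb l. F t x = f t x"
  proof eventually_elim
    case (elim t)
    then have t: "t \<in> {0..T}" by simp
    have "dist2 l (f t) (F t) = 0"
      using F(2)[OF t elim(1)] L2norm_nonneg[of l "\<lambda>x. f t x - F t x"] by linarith
    then have "dist2 l (F t) (f t) = 0" by (simp only: L2norm_minus_commute[of l "F t"])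
    then show ?case by (rule L2norm_zero_imp_AE[OF F(1)[OF t] S(2)[OF elim(1)]])
  qed
  ultimately show ?thesis by (rule that)
qed

lemma continuous_rep:
  assumes "0 < T" "has_weak_time_deriv l T f g"
  shows "L2_continuous l T (continuous_rep l T f)"
    "AE t in leb T. AE x in leb l. continuous_rep l T f t x = f t x"
proof -
  obtain F where F: "L2_continuous l T F \<and> (AE t in leb T. AE x in leb l. F t x = f t x)"
    by (rule weak_time_deriv_continuous_rep_exists[OF assms]) blast
  have "L2_continuous l T (continuous_rep l T f) \<and> (AE t in leb T. AE x in leb l. continuous_rep l T f t x = f t x)"
    unfolding continuous_rep_def
    by (rule someI[where P = "\<lambda>F. L2_continuous l T F \<and> (AE t in leb T. AE x in leb l. F t x = f t x)", OF F])
  then show "L2_continuous l T (continuous_rep l T f)"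
    "AE t in leb T. AE x in leb l. continuous_rep l T f t x = f t x" by auto
qed

text \<open>Each pairing of the representative is continuous in time and agrees almost everywhere
  with an absolutely continuous function; two continuous functions with this property agree on all
  of \<open>{0..T}\<close>.\<close>

lemma continuous_rep_L2_AC:
  assumes T: "0 < T" and fg: "has_weak_time_deriv l T f g"
  shows "L2_AC l T (continuous_rep l T f) g"
proof -
  define F where "F = continuous_rep l T f"
  note F = continuous_rep[OF T fg, folded F_def]
  have f: "f \<in> BL2 l T" and g: "g \<in> BL2 l T" using fg by (auto simp: has_weak_time_deriv_def)
  have FL: "F t \<in> L2 l" if "t \<in> {0..T}" for t using F(1) that by (simp add: L2_continuous_def)
  have "AC T (\<lambda>t. ip l (F t) \<psi>) (\<lambda>t. ip l (g t) \<psi>)" if \<psi>: "\<psi> \<in> L2 l" for \<psi>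
  proof -
    obtain G where G: "AC T G (\<lambda>t. ip l (g t) \<psi>)" "AE t in leb T. ip l (f t) \<psi> = G t"
      by (rule has_weak_deriv_imp_AC[OF T weak_time_deriv_imp_weak_deriv[OF fg \<psi>] BL2_integrable(1)[OF g \<psi>]])
    have cont: "continuous_on {0..T} (\<lambda>t. ip l (F t) \<psi>)"
      unfolding continuous_on_def
    proof (rule ballI, rule LIM_zero_cancel, rule Lim_null_comparison)
      fix t assume t: "t \<in> {0..T}"
      have "((\<lambda>s. dist2 l (F s) (F t) * L2norm l \<psi>) \<longlongrightarrow> 0 * L2norm l \<psi>) (at t within {0..T})"
        using F(1) t by (intro tendsto_mult tendsto_const) (simp add: L2_continuous_def)
      then show "((\<lambda>s. dist2 l (F s) (F t) * L2norm l \<psi>) \<longlongrightarrow> 0) (at t within {0..T})" by simp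
      have "\<bar>ip l (F s) \<psi> - ip l (F t) \<psi>\<bar> \<le> dist2 l (F s) (F t) * L2norm l \<psi>" if s: "s \<in> {0..T}" for s
        using L2_Cauchy_Schwarz[OF L2_diff[OF FL[OF s] FL[OF t]] \<psi>] L2_mult_integrable[OF FL[OF s] \<psi>] L2_mult_integrable[OF FL[OF t] \<psi>]
        by (simp add: left_diff_distrib)
      then show "\<forall>\<^sub>F s in at t within {0..T}. norm (ip l (F s) \<psi> - ip l (F t) \<psi>) \<le> dist2 l (F s) (F t) * L2norm l \<psi>"
        by (auto simp: eventually_at_filter intro!: always_eventually)
    qed
    have "AE t in leb T. t \<in> {0<..<T}" using AE_space[of "leb T"] by simp
    with F(2) G(2) BL2_AE[OF f] have ae: "AE t in leb T. ip l (F t) \<psi> = G t"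
    proof eventually_elim
      case (elim t)
      have "ip l (F t) \<psi> = ip l (f t) \<psi>"
        by (rule integral_cong_AE) (use elim FL[of t] \<psi> in \<open>auto dest!: L2_measurable elim: eventually_mono\<close>)
      with elim(2) show ?case by simp
    qed
    show ?thesis
    proof (rule AC_cong[OF G(1) _ _ _ T])
      show "G t = ip l (F t) \<psi>" if "t \<in> {0..T}" for t
        by (rule continuous_AE_eq[OF AC_continuous[OF G(1)] cont _ T that]) (use ae in \<open>auto elim: eventually_mono\<close>)
    qed (use AC_integrable[OF G(1)] in auto)
  qed
  then show ?thesis using g FL unfolding L2_AC_def F_def by blast
qed

lemma L2_AC_mult:
  assumes "L2_AC l T F f" "a \<in> borel_measurable (leb l)" "AE x in leb l. \<bar>a x\<bar> \<le> C" "0 \<le> C"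
  shows "L2_AC l T (\<lambda>t x. a x * F t x) (\<lambda>t x. a x * f t x)"
  unfolding L2_AC_def
proof (intro conjI ballI)
  show "(\<lambda>t x. a x * f t x) \<in> BL2 l T"
    using assms by (intro BL2_mult) (auto simp: L2_AC_def)
  show "(\<lambda>x. a x * F t x) \<in> L2 l" if "t \<in> {0..T}" for t
    using assms that by (intro L2_mult_bounded) (auto simp: L2_AC_def)
  fix \<psi> assume "\<psi> \<in> L2 l"
  then have "(\<lambda>x. a x * \<psi> x) \<in> L2 l" by (rule L2_mult_bounded[OF _ assms(2,3)])
  then have "AC T (\<lambda>t. \<integral>x. F t x * (a x * \<psi> x) \<partial>leb l) (\<lambda>t. \<integral>x. f t x * (a x * \<psi> x) \<partial>leb l)"
    by (rule L2_AC_integral[OF assms(1)])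
  then show "AC T (\<lambda>t. wip l a (F t) \<psi>) (\<lambda>t. wip l a (f t) \<psi>)"
    by (simp add: ac_simps)
qed

text \<open>The product of the increments of F and G over (0,t) is a double integral over a square;
  its two triangles give the two terms of the product rule.\<close>

lemma L2_AC_product:
  assumes T: "0 < T" and F: "L2_AC l T F f" and G: "L2_AC l T G g"
  shows "AC T (\<lambda>t. ip l (F t) (G t))
    (\<lambda>t. ip l (f t) (G t) + ip l (F t) (g t))"
proof -
  have f: "f \<in> BL2 l T" and g: "g \<in> BL2 l T" using F G by (auto simp: L2_AC_def)
  have FL: "F t \<in> L2 l" and GL: "G t \<in> L2 l" if "t \<in> {0..T}" for t using F G that by (auto simp: L2_AC_def)
  have z: "0 \<in> {0..T}" using T by simp
  \<comment> \<open>Representatives that lie in L2 at every interior time make the kernel of the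
    double integral jointly measurable and bounded at every point of the square.\<close>
  obtain s f' where sf: "L2_simple_limit l T s f'" "AE t in leb T. f' t = f t" by (rule BL2_representative[OF f])
  obtain r g' where rg: "L2_simple_limit l T r g'" "AE t in leb T. g' t = g t" by (rule BL2_representative[OF g])
  have f': "f' \<in> BL2 l T" by (rule BL2_cong_AE[OF f]) (use sf(2) in \<open>auto elim: eventually_mono\<close>)
  have g': "g' \<in> BL2 l T" by (rule BL2_cong_AE[OF g]) (use rg(2) in \<open>auto elim: eventually_mono\<close>)
  have f'L: "f' t \<in> L2 l" if "t \<in> {0<..<T}" for t using sf(1) that by (simp add: L2_simple_limit_def)
  have g'L: "g' t \<in> L2 l" if "t \<in> {0<..<T}" for t using rg(1) that by (simp add: L2_simple_limit_def)
  define B where "B u v = ip l u v" for u v :: "real \<Rightarrow> real"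
  have Bc: "B u v = B v u" for u v by (simp add: B_def mult.commute)
  have BF: "B (F t) \<psi> = B (F 0) \<psi> + prim T (\<lambda>t. B (f' t) \<psi>) t" if "t \<in> {0..T}" "\<psi> \<in> L2 l" for t \<psi>
  proof -
    have "B (F t) \<psi> = B (F 0) \<psi> + prim T (\<lambda>t. B (f t) \<psi>) t"
      using AC_eq[OF L2_AC_integral[OF F that(2)] that(1)] unfolding B_def .
    also have "prim T (\<lambda>t. B (f t) \<psi>) t = prim T (\<lambda>t. B (f' t) \<psi>) t"
      unfolding B_def using BL2_integrable(1)[OF f that(2)] BL2_integrable(1)[OF f' that(2)] sf(2)
      by (intro prim_cong_AE) (auto elim: eventually_mono)
    finally show ?thesis .
  qed
  have BG: "B (G t) \<psi> = B (G 0) \<psi> + prim T (\<lambda>t. B (g' t) \<psi>) t" if "t \<in> {0..T}" "\<psi> \<in> L2 l" for t \<psi>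
  proof -
    have "B (G t) \<psi> = B (G 0) \<psi> + prim T (\<lambda>t. B (g t) \<psi>) t"
      using AC_eq[OF L2_AC_integral[OF G that(2)] that(1)] unfolding B_def .
    also have "prim T (\<lambda>t. B (g t) \<psi>) t = prim T (\<lambda>t. B (g' t) \<psi>) t"
      unfolding B_def using BL2_integrable(1)[OF g that(2)] BL2_integrable(1)[OF g' that(2)] rg(2)
      by (intro prim_cong_AE) (auto elim: eventually_mono)
    finally show ?thesis .
  qed
  have km: "(\<lambda>(s, \<tau>). B (f' s) (g' \<tau>)) \<in> borel_measurable (leb T \<Otimes>\<^sub>M leb T)"
    unfolding B_def by (rule L2_simple_limit_pair_measurable[OF sf(1) rg(1)])
  have Nf: "integrable (leb T) (\<lambda>t. L2norm l (f' t))" and Ng: "integrable (leb T) (\<lambda>t. L2norm l (g' t))"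
    by (intro L2_integrable BL2_norm f' g')+
  have kb: "\<bar>B (f' s) (g' \<tau>)\<bar> \<le> L2norm l (f' s) * L2norm l (g' \<tau>)" if "s \<in> {0<..<T}" "\<tau> \<in> {0<..<T}" for s \<tau>
    unfolding B_def by (rule L2_Cauchy_Schwarz[OF f'L[OF that(1)] g'L[OF that(2)]])
  have k0: "integrable (leb T \<Otimes>\<^sub>M leb T) (case_prod (\<lambda>s \<tau>. B (f' s) (g' \<tau>)))"
    by (rule integrable_pair_bound[OF km Nf Ng]) (use kb in \<open>simp add: abs_mult\<close>)
  have in1: "prim T (\<lambda>\<tau>. B (f' s) (g' \<tau>)) t = B (f' s) (G t) - B (f' s) (G 0)" if "s \<in> {0<..<T}" "t \<in> {0..T}" for s t
    using BG[OF that(2) f'L[OF that(1)]] by (simp add: Bc[of "f' s"])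
  have in2: "prim T (\<lambda>s. B (f' s) (g' \<tau>)) t = B (F t) (g' \<tau>) - B (F 0) (g' \<tau>)" if "\<tau> \<in> {0<..<T}" "t \<in> {0..T}" for \<tau> t
    using BF[OF that(2) g'L[OF that(1)]] by simp
  have i0: "integrable (leb T) (\<lambda>s. B (f' s) (G 0))" "integrable (leb T) (\<lambda>s. B (F 0) (g' s))"
    unfolding Bc[of "F 0"] unfolding B_def by (intro BL2_integrable f' g' GL FL z)+
  \<comment> \<open>Here both arguments of the pairing move with \<open>s\<close>, and the weak
    definition says nothing about its measurability. Up to an initial value it is the integral of
    the kernel over a slice of a triangle, so Fubini supplies integrability.\<close>
  have i1: "integrable (leb T) (\<lambda>s. B (f' s) (G s))"
  proof -
    have "integrable (leb T) (\<lambda>s. prim T (\<lambda>\<tau>. B (f' s) (g' \<tau>)) s + B (f' s) (G 0))"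
      by (intro Bochner_Integration.integrable_add integral_triangles(2)[OF k0] i0)
    also have "?this \<longleftrightarrow> ?thesis"
      by (rule Bochner_Integration.integrable_cong) (use in1 in auto)
    finally show ?thesis .
  qed
  have i2: "integrable (leb T) (\<lambda>s. B (F s) (g' s))"
  proof -
    have "integrable (leb T) (\<lambda>\<tau>. prim T (\<lambda>s. B (f' s) (g' \<tau>)) \<tau> + B (F 0) (g' \<tau>))"
      by (intro Bochner_Integration.integrable_add integral_triangles(3)[OF k0] i0)
    also have "?this \<longleftrightarrow> ?thesis"
      by (rule Bochner_Integration.integrable_cong) (use in2 in auto)
    finally show ?thesis .
  qed
  have main: "B (F t) (G t) = B (F 0) (G 0) + prim T (\<lambda>s. B (f' s) (G s) + B (F s) (g' s)) t" if t: "t \<in> {0..T}" for t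
  proof -
    \<comment> \<open>Truncated to times before \<open>t\<close> in both variables, the double
      integral becomes the pairing of the increments of \<open>F\<close> and \<open>G\<close> up to
      \<open>t\<close>.\<close>
    define k where "k s \<tau> = indicator {..<t} s * indicator {..<t} \<tau> * B (f' s) (g' \<tau>)" for s \<tau>
    have im: "(indicator {..<t} :: real \<Rightarrow> real) \<in> borel_measurable (leb T)" by (rule indicator_measurable_leb) simp
    have k: "integrable (leb T \<Otimes>\<^sub>M leb T) (case_prod k)"
    proof (rule integrable_pair_bound[OF _ Nf Ng])
      have "(\<lambda>p. indicator {..<t} (fst p) * indicator {..<t} (snd p) * (case p of (s, \<tau>) \<Rightarrow> B (f' s) (g' \<tau>))) \<in> borel_measurable (leb T \<Otimes>\<^sub>M leb T)"
        by (intro borel_measurable_times km measurable_compose[OF measurable_fst im] measurable_compose[OF measurable_snd im])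
      then show "case_prod k \<in> borel_measurable (leb T \<Otimes>\<^sub>M leb T)"
        by (simp add: k_def case_prod_beta')
      show "\<bar>k s \<tau>\<bar> \<le> \<bar>L2norm l (f' s) * L2norm l (g' \<tau>)\<bar>" if "s \<in> {0<..<T}" "\<tau> \<in> {0<..<T}" for s \<tau>
        using kb[OF that] by (auto simp: k_def abs_mult split: split_indicator)
    qed
    have k1: "prim T (k s) s = indicator {..<t} s * (B (f' s) (G s) - B (f' s) (G 0))" if s: "s \<in> {0<..<T}" for s
    proof -
      have "prim T (k s) s = prim T (\<lambda>\<tau>. indicator {..<t} s * B (f' s) (g' \<tau>)) s"
        by (rule prim_cong) (auto simp: k_def split: split_indicator)
      then show ?thesis using in1[OF s, of s] s by (simp add: prim_scale)
    qed
    have k2: "prim T (\<lambda>s. k s \<tau>) \<tau> = indicator {..<t} \<tau> * (B (F \<tau>) (g' \<tau>) - B (F 0) (g' \<tau>))" if \<tau>: "\<tau> \<in> {0<..<T}" for \<tau>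
    proof -
      have "prim T (\<lambda>s. k s \<tau>) \<tau> = prim T (\<lambda>s. indicator {..<t} \<tau> * B (f' s) (g' \<tau>)) \<tau>"
        by (rule prim_cong) (auto simp: k_def split: split_indicator)
      then show ?thesis using in2[OF \<tau>, of \<tau>] \<tau> by (simp add: prim_scale)
    qed
    have k3: "(\<integral>\<tau>. k s \<tau> \<partial>leb T) = indicator {..<t} s * (B (f' s) (G t) - B (f' s) (G 0))" if s: "s \<in> {0<..<T}" for s
    proof -
      have "(\<integral>\<tau>. k s \<tau> \<partial>leb T) = indicator {..<t} s * prim T (\<lambda>\<tau>. B (f' s) (g' \<tau>)) t"
        unfolding prim_def k_def by (subst integral_mult_right_zero[symmetric]) (simp add: mult.assoc)
      then show ?thesis using in1[OF s t] by simp
    qed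
    have it: "integrable (leb T) (\<lambda>s. B (f' s) (G t))"
      unfolding B_def by (intro BL2_integrable f' GL t)
    have "(\<integral>s. (\<integral>\<tau>. k s \<tau> \<partial>leb T) \<partial>leb T) = prim T (\<lambda>s. B (f' s) (G t) - B (f' s) (G 0)) t"
      unfolding prim_def by (rule Bochner_Integration.integral_cong) (simp_all add: k3)
    also have "\<dots> = prim T (\<lambda>s. B (f' s) (G t)) t - prim T (\<lambda>s. B (f' s) (G 0)) t"
      by (rule prim_diff[OF it i0(1)])
    also have "\<dots> = (B (F t) (G t) - B (F 0) (G t)) - (B (F t) (G 0) - B (F 0) (G 0))"
      using BF[OF t GL[OF t]] BF[OF t GL[OF z]] by simp
    finally have e1: "(\<integral>s. (\<integral>\<tau>. k s \<tau> \<partial>leb T) \<partial>leb T) = (B (F t) (G t) - B (F 0) (G t)) - (B (F t) (G 0) - B (F 0) (G 0))" .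
    have "(\<integral>s. prim T (k s) s \<partial>leb T) = prim T (\<lambda>s. B (f' s) (G s) - B (f' s) (G 0)) t"
      unfolding prim_def[of T "\<lambda>s. B (f' s) (G s) - B (f' s) (G 0)"] by (rule Bochner_Integration.integral_cong) (simp_all add: k1)
    also have "\<dots> = prim T (\<lambda>s. B (f' s) (G s)) t - (B (F t) (G 0) - B (F 0) (G 0))"
      using prim_diff[OF i1 i0(1), of t] BF[OF t GL[OF z]] by simp
    finally have e2: "(\<integral>s. prim T (k s) s \<partial>leb T) = prim T (\<lambda>s. B (f' s) (G s)) t - (B (F t) (G 0) - B (F 0) (G 0))" .
    have "(\<integral>\<tau>. prim T (\<lambda>s. k s \<tau>) \<tau> \<partial>leb T) = prim T (\<lambda>s. B (F s) (g' s) - B (F 0) (g' s)) t"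
      unfolding prim_def[of T "\<lambda>s. B (F s) (g' s) - B (F 0) (g' s)"] by (rule Bochner_Integration.integral_cong) (simp_all add: k2)
    also have "\<dots> = prim T (\<lambda>s. B (F s) (g' s)) t - (B (F 0) (G t) - B (F 0) (G 0))"
      using prim_diff[OF i2 i0(2), of t] BG[OF t FL[OF z]] by (simp add: Bc[of _ "F 0"])
    finally have e3: "(\<integral>\<tau>. prim T (\<lambda>s. k s \<tau>) \<tau> \<partial>leb T) = prim T (\<lambda>s. B (F s) (g' s)) t - (B (F 0) (G t) - B (F 0) (G 0))" .
    show ?thesis
      using integral_triangles(1)[OF k] prim_add[OF i1 i2, of t] unfolding e1 e2 e3 by linarith
  qed
  have i: "integrable (leb T) (\<lambda>s. B (f' s) (G s) + B (F s) (g' s))"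
    by (intro Bochner_Integration.integrable_add i1 i2)
  have A: "AC T (\<lambda>t. B (F t) (G t)) (\<lambda>s. B (f' s) (G s) + B (F s) (g' s))"
    unfolding AC_def by (intro conjI ballI main i)
  have ae: "AE t in leb T. B (f' t) (G t) + B (F t) (g' t) = B (f t) (G t) + B (F t) (g t)"
    using sf(2) rg(2) by eventually_elim simp
  have "AC T (\<lambda>t. B (F t) (G t)) (\<lambda>s. B (f s) (G s) + B (F s) (g s))"
    by (rule AC_cong[OF A refl ae borel_measurable_leb_AE[OF borel_measurable_integrable[OF i] ae] T])
  then show ?thesis unfolding B_def .
qed

section \<open>The state of a regular weak solution\<close>

lemma L2norm_wderiv_le: "j \<le> k \<Longrightarrow> L2norm l (wderiv l j f) \<le> Sobolev_norm l k f"
  unfolding Sobolev_norm_def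
  by (rule real_le_rsqrt) (rule member_le_sum[of j "{..k}" "\<lambda>j. (L2norm l (wderiv l j f))\<^sup>2"], auto)

text \<open>Since \<open>wderiv\<close> is an arbitrary choice of representative, it is linear only
  up to null sets.\<close>

lemma wderiv_diff:
  assumes "0 < l" "f \<in> Sobolev l k" "g \<in> Sobolev l k" "j \<le> k"
  shows "AE x in leb l. wderiv l j (\<lambda>x. f x - g x) x = wderiv l j f x - wderiv l j g x"
proof -
  have "has_weak_deriv l j (\<lambda>x. 1 * f x + (-1) * g x) (\<lambda>x. 1 * wderiv l j f x + (-1) * wderiv l j g x)"
    by (intro has_weak_deriv_lincomb Sobolev_wderiv(1)[of l _ k] assms)
  then have "has_weak_deriv l j (\<lambda>x. f x - g x) (\<lambda>x. wderiv l j f x - wderiv l j g x)" by simp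
  then show ?thesis by (rule wderivI(2)[OF assms(1)])
qed

lemma L2norm_wderiv_diff_le:
  assumes "0 < l" "f \<in> Sobolev l k" "g \<in> Sobolev l k" "j \<le> k"
  shows "L2norm l (\<lambda>x. wderiv l j f x - wderiv l j g x) \<le> Sobolev_norm l k (\<lambda>x. f x - g x)"
proof -
  have "(\<lambda>x. wderiv l j f x - wderiv l j g x) \<in> L2 l"
    by (intro L2_diff Sobolev_wderiv(2)[of l _ k] assms)
  then have "L2norm l (\<lambda>x. wderiv l j f x - wderiv l j g x) = L2norm l (wderiv l j (\<lambda>x. f x - g x))"
    by (rule L2norm_cong_AE) (use wderiv_diff[OF assms] in \<open>auto elim: eventually_mono\<close>)
  also have "\<dots> \<le> Sobolev_norm l k (\<lambda>x. f x - g x)" by (rule L2norm_wderiv_le[OF assms(4)])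
  finally show ?thesis .
qed

text \<open>Taking a weak derivative does not increase norms from the Sobolev space to L2, so it
  maps approximating simple functions to approximating simple functions.\<close>

lemma Bochner_Sobolev_wderiv:
  assumes l: "0 < l" and f: "f \<in> Bochner_L2 T X (Sobolev_norm l k)" and X: "X \<subseteq> Sobolev l k" and j: "j \<le> k"
  shows "(\<lambda>t. wderiv l j (f t)) \<in> BL2 l T"
proof -
  have fX: "AE t in leb T. f t \<in> Sobolev l k"
    using f X by (auto simp: Bochner_L2_def elim!: eventually_mono)
  have inT: "AE t in leb T. t \<in> {0<..<T}" using AE_space[of "leb T"] by simp
  obtain s where s: "\<And>n. simple_function (leb T) (s n)" "\<And>n t. t \<in> {0<..<T} \<Longrightarrow> s n t \<in> X"
    "AE t in leb T. (\<lambda>n. Sobolev_norm l k (\<lambda>x. f t x - s n t x)) \<longlonglongrightarrow> 0"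
    using f unfolding Bochner_L2_def strongly_measurable_def by blast
  have "strongly_measurable T (L2 l) (L2norm l) (\<lambda>t. wderiv l j (f t))"
    unfolding strongly_measurable_def
  proof (intro exI[of _ "\<lambda>n t. wderiv l j (s n t)"] conjI allI ballI)
    show "simple_function (leb T) (\<lambda>t. wderiv l j (s n t))" for n
      by (rule simple_function_compose1[OF s(1), where g = "wderiv l j"])
    show "wderiv l j (s n t) \<in> L2 l" if "t \<in> {0<..<T}" for n t
      using s(2)[OF that] X by (intro Sobolev_wderiv(2)[OF l _ j]) auto
    show "AE t in leb T. (\<lambda>n. L2norm l (\<lambda>x. wderiv l j (f t) x - wderiv l j (s n t) x)) \<longlonglongrightarrow> 0"
      using s(3) fX inT
    proof eventually_elim
      case (elim t)
      have "L2norm l (\<lambda>x. wderiv l j (f t) x - wderiv l j (s n t) x) \<le> Sobolev_norm l k (\<lambda>x. f t x - s n t x)" for n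
        using s(2)[OF elim(3)] X by (intro L2norm_wderiv_diff_le[OF l elim(2) _ j]) auto
      then show ?case by (rule_tac Lim_null_comparison[OF _ elim(1)]) simp
    qed
  qed
  moreover have "AE t in leb T. wderiv l j (f t) \<in> L2 l"
    using fX by eventually_elim (rule Sobolev_wderiv(2)[OF l _ j])
  ultimately obtain \<sigma> g where "L2_simple_limit l T \<sigma> g" "AE t in leb T. g t = wderiv l j (f t)"
    by (rule strongly_measurable_representative)
  then show ?thesis
  proof (rule BL2I)
    show "integrable (leb T) (\<lambda>t. (Sobolev_norm l k (f t))\<^sup>2)" using f by (simp add: Bochner_L2_def)
    show "AE t in leb T. (L2norm l (wderiv l j (f t)))\<^sup>2 \<le> (Sobolev_norm l k (f t))\<^sup>2"
      by (intro always_eventually allI power_mono L2norm_wderiv_le[OF j] L2norm_nonneg)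
  qed
qed

text \<open>Dominated convergence on two levels: in space for a fixed time, then in time, where
  Cauchy-Schwarz with \<open>M\<close> supplies the majorant.\<close>

lemma BL2_dominated:
  assumes h: "h \<in> BL2 l T" and \<phi>: "\<phi> \<in> borel_measurable (leb T)" "\<And>t. \<bar>\<phi> t\<bar> \<le> C"
    and F: "\<And>i::nat. F i \<in> L2 l" and M: "M \<in> L2 l" and le: "\<And>i x. x \<in> {0<..<l} \<Longrightarrow> \<bar>F i x\<bar> \<le> M x"
    and \<psi>: "\<psi> \<in> L2 l" "AE x in leb l. (\<lambda>i. F i x) \<longlonglongrightarrow> \<psi> x"
  shows "(\<lambda>i. \<integral>t. \<phi> t * ip l (h t) (F i) \<partial>leb T) \<longlonglongrightarrow> (\<integral>t. \<phi> t * ip l (h t) \<psi> \<partial>leb T)"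
proof (rule integral_dominated_convergence)
  have C: "0 \<le> C" using \<phi>(2)[of 0] by linarith
  have Fn: "L2norm l (F i) \<le> L2norm l M" for i
    unfolding L2norm_def
  proof (intro real_sqrt_le_mono integral_mono_AE L2_sq_integrable F M AE_I2)
    fix x assume "x \<in> space (leb l)"
    then have "\<bar>F i x\<bar> \<le> M x" using le by simp
    then show "(F i x)\<^sup>2 \<le> (M x)\<^sup>2" by (rule abs_le_square_iff[THEN iffD1, OF order_trans[OF _ abs_ge_self]])
  qed
  show "integrable (leb T) (\<lambda>t. C * (L2norm l (h t) * L2norm l M))"
    by (intro integrable_mult_right integrable_mult_left L2_integrable BL2_norm[OF h])
  show "(\<lambda>t. \<phi> t * ip l (h t) \<psi>) \<in> borel_measurable (leb T)"
    by (intro borel_measurable_times \<phi>(1) borel_measurable_integrable BL2_integrable(1)[OF h \<psi>(1)])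
  show "(\<lambda>t. \<phi> t * ip l (h t) (F i)) \<in> borel_measurable (leb T)" for i
    by (intro borel_measurable_times \<phi>(1) borel_measurable_integrable BL2_integrable(1)[OF h F])
  show "AE t in leb T. norm (\<phi> t * ip l (h t) (F i)) \<le> C * (L2norm l (h t) * L2norm l M)" for i
    using BL2_AE[OF h]
  proof eventually_elim
    case (elim t)
    have "\<bar>ip l (h t) (F i)\<bar> \<le> L2norm l (h t) * L2norm l M"
      using L2_Cauchy_Schwarz[OF elim F[of i]] mult_left_mono[OF Fn[of i] L2norm_nonneg[of l "h t"]] by linarith
    then show ?case unfolding real_norm_def abs_mult by (intro mult_mono \<phi>(2) C abs_ge_zero)
  qed
  show "AE t in leb T. (\<lambda>i. \<phi> t * ip l (h t) (F i)) \<longlonglongrightarrow> \<phi> t * ip l (h t) \<psi>"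
    using BL2_AE[OF h]
  proof eventually_elim
    case (elim t)
    have "(\<lambda>i. ip l (h t) (F i)) \<longlonglongrightarrow> ip l (h t) \<psi>"
    proof (rule integral_dominated_convergence)
      show "integrable (leb l) (\<lambda>x. \<bar>h t x * M x\<bar>)" by (intro integrable_abs L2_mult_integrable elim M)
      show "AE x in leb l. (\<lambda>i. h t x * F i x) \<longlonglongrightarrow> h t x * \<psi> x"
        using \<psi>(2) by eventually_elim (intro tendsto_mult tendsto_const)
      show "AE x in leb l. norm (h t x * F i x) \<le> \<bar>h t x * M x\<bar>" for i
      proof (rule AE_I2)
        fix x assume "x \<in> space (leb l)"
        then have "\<bar>F i x\<bar> \<le> \<bar>M x\<bar>" using le[of x i] by simp
        then show "norm (h t x * F i x) \<le> \<bar>h t x * M x\<bar>"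
          unfolding real_norm_def abs_mult by (intro mult_left_mono abs_ge_zero)
      qed
    qed (use L2_mult_integrable[OF elim \<psi>(1)] L2_mult_integrable[OF elim F] in auto)
    then show ?case by (intro tendsto_mult tendsto_const)
  qed
qed

text \<open>Against a test function in space, both space derivatives move onto the test function,
  and the time derivative of \<open>u\<close> applies. Density extends the identity to all of
  \<open>L2 l\<close>. This is what allows the bending energy to be differentiated in time.\<close>

lemma weak_time_deriv_wderiv2:
  assumes l: "0 < l" and w: "has_weak_time_deriv l T u v"
    and u: "u \<in> Bochner_L2 T X (Sobolev_norm l k)" "X \<subseteq> Sobolev l k" "2 \<le> k"
    and v: "v \<in> Bochner_L2 T Y (Sobolev_norm l m)" "Y \<subseteq> Sobolev l m" "2 \<le> m"
  shows "has_weak_time_deriv l T (\<lambda>t. wderiv l 2 (u t)) (\<lambda>t. wderiv l 2 (v t))"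
proof -
  define p q where "p t = wderiv l 2 (u t)" and "q t = wderiv l 2 (v t)" for t
  have p: "p \<in> BL2 l T" unfolding p_def by (rule Bochner_Sobolev_wderiv[OF l u])
  have q: "q \<in> BL2 l T" unfolding q_def by (rule Bochner_Sobolev_wderiv[OF l v])
  have u0: "u \<in> BL2 l T" and v0: "v \<in> BL2 l T" using w by (auto simp: has_weak_time_deriv_def)
  have wp: "AE t in leb T. has_weak_deriv l 2 (u t) (p t)"
    using u by (auto simp: Bochner_L2_def p_def elim!: eventually_mono intro!: Sobolev_wderiv(1)[OF l _ u(3)])
  have wq: "AE t in leb T. has_weak_deriv l 2 (v t) (q t)"
    using v by (auto simp: Bochner_L2_def q_def elim!: eventually_mono intro!: Sobolev_wderiv(1)[OF l _ v(3)])
  have "(\<integral>t. deriv \<phi> t * ip l (p t) \<psi> \<partial>leb T) = - (\<integral>t. \<phi> t * ip l (q t) \<psi> \<partial>leb T)"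
    if \<phi>: "test_function T \<phi>" and \<psi>: "\<psi> \<in> L2 l" for \<phi> \<psi>
  proof -
    note m = test_function_measurable[OF \<phi>, of T] test_function_measurable[OF test_function_deriv[OF \<phi>], of T]
    obtain C1 where C1: "\<And>t. \<bar>\<phi> t\<bar> \<le> C1" by (rule test_function_bounded[OF \<phi>]) blast
    obtain C2 where C2: "\<And>t. \<bar>deriv \<phi> t\<bar> \<le> C2" by (rule test_function_bounded[OF test_function_deriv[OF \<phi>]]) blast
    have i: "integrable (leb T) (\<lambda>t. \<phi> t * ip l (h t) f)" "integrable (leb T) (\<lambda>t. deriv \<phi> t * ip l (h t) f)"
      if "h \<in> BL2 l T" "f \<in> L2 l" for h f
      by (rule integrable_mult_bounded_leb[OF BL2_integrable(1)[OF that] m(1) C1] integrable_mult_bounded_leb[OF BL2_integrable(1)[OF that] m(2) C2])+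
    from l \<psi> show ?thesis
    proof (rule L2_density_induct)
      fix \<theta> assume \<theta>: "test_function l \<theta>"
      have \<theta>L: "\<theta> \<in> L2 l" "(deriv ^^ 2) \<theta> \<in> L2 l"
        by (intro test_function_L2[OF \<theta>] test_function_L2[OF test_function_funpow_deriv[OF \<theta>]])+
      have "(\<integral>t. deriv \<phi> t * ip l (p t) \<theta> \<partial>leb T) = (\<integral>t. deriv \<phi> t * (\<integral>x. u t x * (deriv ^^ 2) \<theta> x \<partial>leb l) \<partial>leb T)"
      proof (rule integral_cong_AE)
        show "AE t in leb T. deriv \<phi> t * ip l (p t) \<theta> = deriv \<phi> t * (\<integral>x. u t x * (deriv ^^ 2) \<theta> x \<partial>leb l)"
          using wp
        proof eventually_elim
          case (elim t)
          have "(\<integral>x. u t x * (deriv ^^ 2) \<theta> x \<partial>leb l) = (-1) ^ 2 * ip l (p t) \<theta>"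
            using elim \<theta> unfolding has_weak_deriv_def by blast
          then show ?case by simp
        qed
      qed (intro borel_measurable_integrable i p u0 \<theta>L)+
      also have "\<dots> = - (\<integral>t. \<phi> t * (\<integral>x. v t x * (deriv ^^ 2) \<theta> x \<partial>leb l) \<partial>leb T)"
        using w \<phi> \<theta>L(2) unfolding has_weak_time_deriv_def by blast
      also have "(\<integral>t. \<phi> t * (\<integral>x. v t x * (deriv ^^ 2) \<theta> x \<partial>leb l) \<partial>leb T) = (\<integral>t. \<phi> t * ip l (q t) \<theta> \<partial>leb T)"
      proof (rule integral_cong_AE)
        show "AE t in leb T. \<phi> t * (\<integral>x. v t x * (deriv ^^ 2) \<theta> x \<partial>leb l) = \<phi> t * ip l (q t) \<theta>"
          using wq
        proof eventually_elim
          case (elim t)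
          have "(\<integral>x. v t x * (deriv ^^ 2) \<theta> x \<partial>leb l) = (-1) ^ 2 * ip l (q t) \<theta>"
            using elim \<theta> unfolding has_weak_deriv_def by blast
          then show ?case by simp
        qed
      qed (intro borel_measurable_integrable i q v0 \<theta>L)+
      finally show "(\<integral>t. deriv \<phi> t * ip l (p t) \<theta> \<partial>leb T) = - (\<integral>t. \<phi> t * ip l (q t) \<theta> \<partial>leb T)" .
    next
      fix f g a b
      assume fg: "f \<in> L2 l" "g \<in> L2 l"
        and eq: "(\<integral>t. deriv \<phi> t * ip l (p t) f \<partial>leb T) = - (\<integral>t. \<phi> t * ip l (q t) f \<partial>leb T)"
          "(\<integral>t. deriv \<phi> t * ip l (p t) g \<partial>leb T) = - (\<integral>t. \<phi> t * ip l (q t) g \<partial>leb T)"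
      have L: "(\<lambda>x. a * f x + b * g x) \<in> L2 l" by (intro L2_add L2_scale fg)
      have lin: "(\<integral>t. \<eta> t * (\<integral>x. h t x * (a * f x + b * g x) \<partial>leb l) \<partial>leb T) =
          a * (\<integral>t. \<eta> t * ip l (h t) f \<partial>leb T) + b * (\<integral>t. \<eta> t * ip l (h t) g \<partial>leb T)"
        if h: "h \<in> BL2 l T" and I: "\<And>f. f \<in> L2 l \<Longrightarrow> integrable (leb T) (\<lambda>t. \<eta> t * ip l (h t) f)" for h \<eta>
      proof -
        have "(\<integral>t. \<eta> t * (\<integral>x. h t x * (a * f x + b * g x) \<partial>leb l) \<partial>leb T) =
          (\<integral>t. a * (\<eta> t * ip l (h t) f) + b * (\<eta> t * ip l (h t) g) \<partial>leb T)"
        proof (rule integral_cong_AE)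
          show "AE t in leb T. \<eta> t * (\<integral>x. h t x * (a * f x + b * g x) \<partial>leb l) =
            a * (\<eta> t * ip l (h t) f) + b * (\<eta> t * ip l (h t) g)"
            using BL2_AE[OF h]
          proof eventually_elim
            case (elim t)
            have "(\<integral>x. h t x * (a * f x + b * g x) \<partial>leb l) = (\<integral>x. a * (h t x * f x) + b * (h t x * g x) \<partial>leb l)"
              by (simp add: algebra_simps)
            also have "\<dots> = a * ip l (h t) f + b * ip l (h t) g"
              using L2_mult_integrable[OF elim fg(1)] L2_mult_integrable[OF elim fg(2)] by simp
            finally show ?case by (simp add: algebra_simps)
          qed
          show "(\<lambda>t. \<eta> t * (\<integral>x. h t x * (a * f x + b * g x) \<partial>leb l)) \<in> borel_measurable (leb T)"
            by (rule borel_measurable_integrable[OF I[OF L]])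
        qed (intro borel_measurable_add borel_measurable_times borel_measurable_const borel_measurable_integrable[OF I] fg)
        also have "\<dots> = a * (\<integral>t. \<eta> t * ip l (h t) f \<partial>leb T) + b * (\<integral>t. \<eta> t * ip l (h t) g \<partial>leb T)"
          using I[OF fg(1)] I[OF fg(2)] by simp
        finally show ?thesis .
      qed
      show "(\<integral>t. deriv \<phi> t * (\<integral>x. p t x * (a * f x + b * g x) \<partial>leb l) \<partial>leb T) = - (\<integral>t. \<phi> t * (\<integral>x. q t x * (a * f x + b * g x) \<partial>leb l) \<partial>leb T)"
      proof -
        have "(\<integral>t. deriv \<phi> t * (\<integral>x. p t x * (a * f x + b * g x) \<partial>leb l) \<partial>leb T) =
          a * (\<integral>t. deriv \<phi> t * ip l (p t) f \<partial>leb T) + b * (\<integral>t. deriv \<phi> t * ip l (p t) g \<partial>leb T)"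
          by (rule lin[OF p]) (rule i(2)[OF p])
        moreover have "(\<integral>t. \<phi> t * (\<integral>x. q t x * (a * f x + b * g x) \<partial>leb l) \<partial>leb T) =
          a * (\<integral>t. \<phi> t * ip l (q t) f \<partial>leb T) + b * (\<integral>t. \<phi> t * ip l (q t) g \<partial>leb T)"
          by (rule lin[OF q]) (rule i(1)[OF q])
        ultimately show ?thesis unfolding eq by simp
      qed
    next
      fix f F M
      assume F: "\<And>i::nat. F i \<in> L2 l" "M \<in> L2 l" "\<And>i x. x \<in> {0<..<l} \<Longrightarrow> \<bar>F i x\<bar> \<le> M x"
        and eq: "\<And>i. (\<integral>t. deriv \<phi> t * ip l (p t) (F i) \<partial>leb T) = - (\<integral>t. \<phi> t * ip l (q t) (F i) \<partial>leb T)"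
        and f: "f \<in> L2 l" "AE x in leb l. (\<lambda>i. F i x) \<longlonglongrightarrow> f x"
      show "(\<integral>t. deriv \<phi> t * ip l (p t) f \<partial>leb T) = - (\<integral>t. \<phi> t * ip l (q t) f \<partial>leb T)"
        using BL2_dominated[OF p m(2) C2 F f] tendsto_minus[OF BL2_dominated[OF q m(1) C1 F f]]
        unfolding eq by (rule LIMSEQ_unique)
    qed
  qed
  then show ?thesis
    using p q unfolding has_weak_time_deriv_def p_def q_def by blast
qed

text \<open>Because of the clamped end, the displacement is the iterated indefinite integral of its second
  derivative, which therefore serves as the state variable.\<close>

lemma prim_power2_le:
  assumes h: "h \<in> L2 l" and x: "x \<in> {0..l}"
  shows "(prim l h x)\<^sup>2 \<le> x * prim l (\<lambda>s. (h s)\<^sup>2) x"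
proof -
  define I where "I = (indicator {..<x} :: real \<Rightarrow> real)"
  have Im: "I \<in> borel_measurable (leb l)" unfolding I_def by (rule indicator_measurable_leb) simp
  have Ib: "\<bar>I s\<bar> \<le> 1" for s by (simp add: I_def split: split_indicator)
  have IL: "I \<in> L2 l" using Im Ib by (intro L2_bounded[of I l 1]) auto
  have IhL: "(\<lambda>s. I s * h s) \<in> L2 l" using Im Ib by (intro L2_mult_bounded[OF h, of I 1]) auto
  have II: "I s * I s = I s" for s by (simp add: I_def split: split_indicator)
  \<comment> \<open>Since \<open>I\<close> is its own square, Cauchy-Schwarz can be restricted to
    the part before \<open>x\<close>, where the integral of \<open>I\<close> contributes the factor
    \<open>x\<close>.\<close>
  have "prim l h x = (\<integral>s. I s * (I s * h s) \<partial>leb l)"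
    unfolding prim_def I_def[symmetric] by (simp add: mult.assoc[symmetric] II)
  then have "\<bar>prim l h x\<bar> \<le> L2norm l I * L2norm l (\<lambda>s. I s * h s)"
    using L2_Cauchy_Schwarz[OF IL IhL] by simp
  then have "(prim l h x)\<^sup>2 \<le> (L2norm l I * L2norm l (\<lambda>s. I s * h s))\<^sup>2"
    by (rule abs_le_square_iff[THEN iffD1, OF order_trans[OF _ abs_ge_self]])
  also have "\<dots> = (\<integral>s. I s \<partial>leb l) * prim l (\<lambda>s. (h s)\<^sup>2) x"
    unfolding power_mult_distrib L2norm_power2 prim_def I_def[symmetric] by (simp add: power2_eq_square II mult.assoc[symmetric])
  also have "(\<integral>s. I s \<partial>leb l) = x"
  proof -
    have "AC l (\<lambda>x. x) (\<lambda>x. 1)" if "0 < l" using that by (intro AC_smooth) auto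
    then have "prim l (\<lambda>s. 1) x = x" using AC_eq[of l "\<lambda>x. x" "\<lambda>x. 1" x] x by (cases "0 < l") (auto simp: prim_nonpos)
    then show ?thesis by (simp add: prim_def I_def)
  qed
  finally show ?thesis .
qed

lemma prim_mono:
  assumes "integrable (leb b) f" "integrable (leb b) g" "\<And>s. s \<in> {0<..<b} \<Longrightarrow> f s \<le> g s"
  shows "prim b f x \<le> prim b g x"
  unfolding prim_def using integrable_prim[OF assms(1)] integrable_prim[OF assms(2)] assms(3)
  by (intro Bochner_Integration.integral_mono) (auto split: split_indicator)

text \<open>Iterating the preceding estimate with \<open>K\<close> the integral of
  \<open>h^2\<close>: the squares are at most x K after one integration and K x^3/2 after two, and
  the latter integrates to K l^4/8.\<close>

lemma prim_iterated_bounds: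
  assumes l: "0 < l" and h: "h \<in> L2 l"
  shows "(prim l h l)\<^sup>2 \<le> l * (\<integral>x. (h x)\<^sup>2 \<partial>leb l)"
    "(prim2 l h l)\<^sup>2 \<le> l ^ 3 / 2 * (\<integral>x. (h x)\<^sup>2 \<partial>leb l)"
    "(\<integral>x. (prim2 l h x)\<^sup>2 \<partial>leb l) \<le> l ^ 4 / 8 * (\<integral>x. (h x)\<^sup>2 \<partial>leb l)"
proof -
  define K where "K = (\<integral>x. (h x)\<^sup>2 \<partial>leb l)"
  have K: "0 \<le> K" by (simp add: K_def)
  have prK: "prim l (\<lambda>s. (h s)\<^sup>2) x \<le> K" for x
    using prim_bounded[OF L2_sq_integrable[OF h], of x] by (simp add: K_def)
  have A1: "AC l (prim l h) h" using AC_prim[OF L2_integrable[OF h], of 0] by simp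
  have L1: "prim l h \<in> L2 l" by (rule AC_L2[OF A1 l])
  have A2: "AC l (prim2 l h) (prim l h)" using AC_prim[OF L2_integrable[OF L1], of 0] by simp
  have L2: "prim2 l h \<in> L2 l" by (rule AC_L2[OF A2 l])
  have b1: "(prim l h x)\<^sup>2 \<le> x * K" if "x \<in> {0..l}" for x
    using prim_power2_le[OF h that] mult_left_mono[OF prK[of x], of x] that by simp
  show "(prim l h l)\<^sup>2 \<le> l * (\<integral>x. (h x)\<^sup>2 \<partial>leb l)" using b1[of l] l by (simp add: K_def)
  have q2: "AC l (\<lambda>x. K * x ^ 2 / 2) (\<lambda>x. x * K)"
    by (rule AC_smooth[OF _ _ l]) (auto intro!: derivative_eq_intros continuous_intros)
  have b2: "(prim2 l h x)\<^sup>2 \<le> K * x ^ 3 / 2" if x: "x \<in> {0..l}" for x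
  proof -
    have "prim l (\<lambda>s. (prim l h s)\<^sup>2) x \<le> prim l (\<lambda>s. s * K) x"
      using b1 by (intro prim_mono L2_sq_integrable L1 AC_integrable[OF q2]) auto
    also have "\<dots> = K * x ^ 2 / 2" using AC_eq[OF q2 x] by simp
    finally have "x * prim l (\<lambda>s. (prim l h s)\<^sup>2) x \<le> x * (K * x ^ 2 / 2)"
      using x by (intro mult_left_mono) auto
    with prim_power2_le[OF L1 x] show ?thesis by (simp add: power2_eq_square power3_eq_cube mult.assoc mult.left_commute)
  qed
  show "(prim2 l h l)\<^sup>2 \<le> l ^ 3 / 2 * (\<integral>x. (h x)\<^sup>2 \<partial>leb l)" using b2[of l] l by (simp add: K_def mult.commute)
  have q4: "AC l (\<lambda>x. K * x ^ 4 / 8) (\<lambda>x. K * x ^ 3 / 2)"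
    by (rule AC_smooth[OF _ _ l]) (auto intro!: derivative_eq_intros continuous_intros)
  have "(\<integral>x. (prim2 l h x)\<^sup>2 \<partial>leb l) \<le> (\<integral>x. K * x ^ 3 / 2 \<partial>leb l)"
    using b2 by (intro integral_mono_AE L2_sq_integrable L2 AC_integrable[OF q4] AE_I2) auto
  also have "\<dots> = K * l ^ 4 / 8" using AC_integral[OF q4 l] by simp
  finally show "(\<integral>x. (prim2 l h x)\<^sup>2 \<partial>leb l) \<le> l ^ 4 / 8 * (\<integral>x. (h x)\<^sup>2 \<partial>leb l)" by (simp add: K_def mult.commute)
qed

lemma prim_AC_L2:
  assumes "0 < l" "h \<in> L2 l"
  shows "AC l (prim l h) h" "AC l (prim2 l h) (prim l h)" "prim l h \<in> L2 l" "prim2 l h \<in> L2 l"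
proof -
  show A1: "AC l (prim l h) h" using AC_prim[OF L2_integrable[OF assms(2)], of 0] by simp
  show L1: "prim l h \<in> L2 l" by (rule AC_L2[OF A1 assms(1)])
  show A2: "AC l (prim2 l h) (prim l h)" using AC_prim[OF L2_integrable[OF L1], of 0] by simp
  show "prim2 l h \<in> L2 l" by (rule AC_L2[OF A2 assms(1)])
qed

text \<open>Slope and displacement at the free end are pairings of \<open>h\<close> with the fixed
  weights 1 and \<open>l - x\<close>, so their dependence on time is read off from
  \<open>L2_AC\<close>.\<close>

lemma prim_iterated_end:
  assumes l: "0 < l" and h: "h \<in> L2 l"
  shows "prim l h l = (\<integral>x. h x * 1 \<partial>leb l)" "prim2 l h l = (\<integral>x. h x * (l - x) \<partial>leb l)"
proof -
  show "prim l h l = (\<integral>x. h x * 1 \<partial>leb l)" by (simp add: prim_full)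
  have A: "AC l (\<lambda>x. l - x) (\<lambda>x. -1)"
    by (rule AC_smooth[OF _ _ l]) (auto intro!: derivative_eq_intros)
  note M = AC_mult[OF prim_AC_L2(1)[OF l h] A l]
  have "(\<integral>x. h x * (l - x) + prim l h x * (-1) \<partial>leb l) = 0"
    using AC_integral[OF M l] by (simp add: prim_nonpos)
  moreover have "integrable (leb l) (\<lambda>x. h x * (l - x))" "integrable (leb l) (\<lambda>x. prim l h x * (-1))"
    by (intro L2_mult_integrable h AC_L2[OF A l] prim_AC_L2(3)[OF l h] L2_const)+
  ultimately have "(\<integral>x. h x * (l - x) \<partial>leb l) = (\<integral>x. prim l h x \<partial>leb l)" by simp
  then show "prim2 l h l = (\<integral>x. h x * (l - x) \<partial>leb l)" by (simp add: prim_full)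
qed

lemma prim_iterated_representation:
  assumes l: "0 < l" and f: "f \<in> Sobolev l 2" and tr: "trace l f 0 = 0" "trace l (wderiv l 1 f) 0 = 0"
  shows "AE x in leb l. f x = prim2 l (wderiv l 2 f) x"
    "trace l f l = prim2 l (wderiv l 2 f) l" "trace l (wderiv l 1 f) l = prim l (wderiv l 2 f) l"
proof -
  obtain F F1 where F: "AC l F F1" "AC l F1 (wderiv l 2 f)" "AE x in leb l. f x = F x"
    by (rule Sobolev2_AC[OF l f])
  have z: "0 \<in> {0..l}" "l \<in> {0..l}" using l by auto
  note W = AC_wderiv[OF l F]
  have F0: "F 0 = 0" "F1 0 = 0" using W(3)[OF z(1)] W(4)[OF z(1)] tr by auto
  have F1: "F1 x = prim l (wderiv l 2 f) x" if "x \<in> {0..l}" for x using AC_eq[OF F(2) that] F0 by simp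
  have FF: "F x = prim2 l (wderiv l 2 f) x" if "x \<in> {0..l}" for x
  proof -
    have "prim l F1 x = prim2 l (wderiv l 2 f) x" by (rule prim_cong) (simp add: F1)
    then show ?thesis using AC_eq[OF F(1) that] F0 by simp
  qed
  have "AE x in leb l. x \<in> {0<..<l}" using AE_space[of "leb l"] by simp
  with F(3) show "AE x in leb l. f x = prim2 l (wderiv l 2 f) x"
    by eventually_elim (simp add: FF)
  show "trace l f l = prim2 l (wderiv l 2 f) l" "trace l (wderiv l 1 f) l = prim l (wderiv l 2 f) l"
    using W(3)[OF z(2)] W(4)[OF z(2)] FF[OF z(2)] F1[OF z(2)] by auto
qed

lemma prim_iterated_wderiv:
  assumes l: "0 < l" and h: "h \<in> L2 l" and f: "AE x in leb l. f x = prim2 l h x"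
  shows "AE x in leb l. wderiv l 2 f x = h x" "trace l f l = prim2 l h l" "trace l (wderiv l 1 f) l = prim l h l"
  using AC_wderiv[OF l prim_AC_L2(2)[OF l h] prim_AC_L2(1)[OF l h] f] l by auto

text \<open>Value and slope of \<open>prim2 l h\<close> vanish at 0, so two integrations by parts
  leave boundary terms at \<open>l\<close> only. The product of \<open>r\<close> and
  \<open>p\<close> is handled through its explicit first and second derivatives \<open>M1\<close>
  and \<open>M2\<close>.\<close>

lemma beam_operator_by_parts:
  assumes l: "0 < l" and r: "r \<in> Sobolev l 2" and p: "p \<in> Sobolev l 2" and h: "h \<in> L2 l"
  shows "(\<integral>x. wderiv l 2 (\<lambda>y. r y * p y) x * prim2 l h x \<partial>leb l) =
      trace l (wderiv l 1 (\<lambda>y. r y * p y)) l * prim2 l h l - trace l (\<lambda>y. r y * p y) l * prim l h l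
      + wip l r p h"
    "integrable (leb l) (\<lambda>x. wderiv l 2 (\<lambda>y. r y * p y) x * prim2 l h x)"
proof -
  obtain R R1 where R: "AC l R R1" "AC l R1 (wderiv l 2 r)" "AE x in leb l. r x = R x"
    by (rule Sobolev2_AC[OF l r])
  obtain P P1 where P: "AC l P P1" "AC l P1 (wderiv l 2 p)" "AE x in leb l. p x = P x"
    by (rule Sobolev2_AC[OF l p])
  define M M1 M2 where "M x = R x * P x" and "M1 x = R1 x * P x + R x * P1 x"
    and "M2 x = (wderiv l 2 r x * P x + R1 x * P1 x) + (R1 x * P1 x + R x * wderiv l 2 p x)" for x
  have A: "AC l M M1" unfolding M_def M1_def by (rule AC_mult[OF R(1) P(1) l])
  have A1: "AC l M1 M2" unfolding M1_def M2_def
    by (rule AC_add[OF AC_mult[OF R(2) P(1) l] AC_mult[OF R(1) P(2) l]])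
  have ae: "AE x in leb l. r x * p x = M x" using R(3) P(3) by eventually_elim (simp add: M_def)
  have z: "l \<in> {0..l}" using l by auto
  note W = AC_wderiv[OF l A A1 ae]
  note H = prim_AC_L2[OF l h]
  have i: "integrable (leb l) (\<lambda>x. M2 x * prim2 l h x)"
    using AC_integrable_mult[OF H(2) l AC_integrable[OF A1]] by (simp add: mult.commute)
  have mw: "wderiv l 2 (\<lambda>y. r y * p y) \<in> borel_measurable (leb l)"
    by (rule borel_measurable_leb_AE[OF borel_measurable_integrable[OF AC_integrable[OF A1]]])
       (use W(2) in \<open>auto elim: eventually_mono\<close>)
  have aeW: "AE x in leb l. wderiv l 2 (\<lambda>y. r y * p y) x * prim2 l h x = M2 x * prim2 l h x"
    using W(2) by eventually_elim simp
  have mwh: "(\<lambda>x. wderiv l 2 (\<lambda>y. r y * p y) x * prim2 l h x) \<in> borel_measurable (leb l)"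
    by (intro borel_measurable_times mw AC_measurable[OF H(2)])
  show "integrable (leb l) (\<lambda>x. wderiv l 2 (\<lambda>y. r y * p y) x * prim2 l h x)"
    by (rule integrable_cong_AE_imp[OF i mwh]) (use aeW in \<open>auto elim: eventually_mono\<close>)
  have e0: "(\<integral>x. wderiv l 2 (\<lambda>y. r y * p y) x * prim2 l h x \<partial>leb l) = ip l M2 (prim2 l h)"
    by (rule integral_cong_AE[OF mwh borel_measurable_integrable[OF i] aeW])
  have i1: "integrable (leb l) (\<lambda>x. M1 x * prim l h x)"
    by (intro L2_mult_integrable AC_L2[OF A1 l] H(3))
  have i2: "integrable (leb l) (\<lambda>x. M x * h x)"
    by (intro L2_mult_integrable AC_L2[OF A l] h)
  have e1: "ip l M2 (prim2 l h) + ip l M1 (prim l h) = M1 l * prim2 l h l"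
    using AC_integral[OF AC_mult[OF A1 H(2) l] l] i i1 by (simp add: prim_nonpos)
  have e2: "ip l M1 (prim l h) + ip l M h = M l * prim l h l"
    using AC_integral[OF AC_mult[OF A H(1) l] l] i1 i2 by (simp add: prim_nonpos)
  have "r \<in> borel_measurable (leb l)" "p \<in> borel_measurable (leb l)" "h \<in> borel_measurable (leb l)"
    using r p h by (auto intro: L2_measurable Sobolev_L2)
  then have e3: "wip l r p h = ip l M h"
    by (intro integral_cong_AE borel_measurable_times borel_measurable_integrable[OF i2])
       (use ae in \<open>auto elim: eventually_mono\<close>)
  show "(\<integral>x. wderiv l 2 (\<lambda>y. r y * p y) x * prim2 l h x \<partial>leb l) =
      trace l (wderiv l 1 (\<lambda>y. r y * p y)) l * prim2 l h l - trace l (\<lambda>y. r y * p y) l * prim l h l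
      + wip l r p h"
    unfolding W(3)[OF z] W(4)[OF z] e0 e3 using e1 e2 by linarith
qed

section \<open>The weak form of the beam problem\<close>

lemma basic_conditionsD:
  assumes "basic_conditions l \<rho> \<mu> r u0 u1 \<rho>0 \<rho>1 \<mu>0 \<mu>1 r0 r1 kr ka kd kv"
  shows "r \<in> Sobolev l 2" "r \<in> borel_measurable (leb l)" "\<rho> \<in> borel_measurable (leb l)" "\<mu> \<in> borel_measurable (leb l)"
    "AE x in leb l. \<bar>\<rho> x\<bar> \<le> \<rho>1" "AE x in leb l. \<bar>\<mu> x\<bar> \<le> \<mu>1" "AE x in leb l. \<bar>r x\<bar> \<le> r1"
proof -
  note B = assms[unfolded basic_conditions_def]
  show r: "r \<in> Sobolev l 2" using B by blast
  show "r \<in> borel_measurable (leb l)" by (intro L2_measurable Sobolev_L2[OF r])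
  show "\<rho> \<in> borel_measurable (leb l)" "\<mu> \<in> borel_measurable (leb l)" using B by (auto simp: Linfty_def)
  have *: "AE x in leb l. \<bar>f x\<bar> \<le> d" if "AE x in leb l. c \<le> f x \<and> f x \<le> d" "0 \<le> c" for f and c d :: real
    using that(1) by eventually_elim (use that(2) in auto)
  show "AE x in leb l. \<bar>\<rho> x\<bar> \<le> \<rho>1" by (rule *[of \<rho>0]) (use B in auto)
  show "AE x in leb l. \<bar>\<mu> x\<bar> \<le> \<mu>1" by (rule *[of \<mu>0]) (use B in auto)
  show "AE x in leb l. \<bar>r x\<bar> \<le> r1" by (rule *[of r0]) (use B in auto)
qed

text \<open>The principle of virtual work. The virtual displacement is the clamped function
  \<open>prim2 l h\<close>, parametrised by its second derivative \<open>h\<close>; \<open>p\<close>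
  and \<open>q\<close> are the second derivatives of displacement and velocity, \<open>v\<close> is
  the velocity and \<open>a\<close> the acceleration. The spring and damper conditions at
  \<open>l\<close> are built in.\<close>

definition weak_beam ::
    "real \<Rightarrow> (real \<Rightarrow> real) \<Rightarrow> (real \<Rightarrow> real) \<Rightarrow> (real \<Rightarrow> real) \<Rightarrow> real \<Rightarrow> real \<Rightarrow> real \<Rightarrow> real \<Rightarrow>
     (real \<Rightarrow> real) \<Rightarrow> (real \<Rightarrow> real) \<Rightarrow> (real \<Rightarrow> real) \<Rightarrow> (real \<Rightarrow> real) \<Rightarrow> bool" where
  "weak_beam l \<rho> \<mu> r kr ka kd kv p q v a \<longleftrightarrow>
     (\<forall>h\<in>L2 l. wip l \<rho> a (prim2 l h) + wip l \<mu> v (prim2 l h) + wip l r p h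
        + (kd * prim2 l p l + kv * prim2 l q l) * prim2 l h l
        + (kr * prim l p l + ka * prim l q l) * prim l h l = 0)"

text \<open>Everything the energy argument uses about the solution. The weak equation is needed at
  almost every time, but the relation between displacement and \<open>P\<close> at every time,
  because the energy is evaluated at every time.\<close>

lemma regular_weak_solution_state:
  assumes l: "0 < l" and T: "0 < T"
    and basic: "basic_conditions l \<rho> \<mu> r u0 u1 \<rho>0 \<rho>1 \<mu>0 \<mu>1 r0 r1 kr ka kd kv"
    and sol: "regular_weak_solution l T \<rho> \<mu> r u0 u1 kr ka kd kv u ut utt"
  obtains P q where
    "L2_AC l T (continuous_rep l T u) ut" "L2_AC l T (continuous_rep l T ut) utt" "L2_AC l T P q"
    "\<And>t. t \<in> {0..T} \<Longrightarrow> AE x in leb l. continuous_rep l T u t x = prim2 l (P t) x"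
    "AE t in leb T. q t \<in> L2 l \<and> ut t \<in> L2 l \<and> utt t \<in> L2 l \<and>
       (AE x in leb l. continuous_rep l T ut t x = ut t x) \<and>
       (AE x in leb l. ut t x = prim2 l (q t) x) \<and>
       weak_beam l \<rho> \<mu> r kr ka kd kv (P t) (q t) (ut t) (utt t)"
proof -
  note S = sol[unfolded regular_weak_solution_def]
  have w1: "has_weak_time_deriv l T u ut" and w2: "has_weak_time_deriv l T ut utt"
    and uB: "u \<in> Bochner_L2 T (Sobolev l 4) (Sobolev_norm l 4)"
    and vB: "ut \<in> Bochner_L2 T (V2 l) (Sobolev_norm l 2)"
    and aB: "utt \<in> BL2 l T"
    using S by blast+
  have pde: "AE t in leb T. AE x in leb l. \<rho> x * utt t x + \<mu> x * ut t x + wderiv l 2 (\<lambda>y. r y * wderiv l 2 (u t) y) x = 0"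
    and bc: "AE t in leb T. trace l (u t) 0 = 0 \<and> trace l (wderiv l 1 (u t)) 0 = 0 \<and>
        - trace l (\<lambda>x. r x * wderiv l 2 (u t) x) l = kr * trace l (wderiv l 1 (u t)) l + ka * trace l (wderiv l 1 (ut t)) l \<and>
        - trace l (wderiv l 1 (\<lambda>x. r x * wderiv l 2 (u t) x)) l = - kd * trace l (u t) l - kv * trace l (ut t) l"
    using S by blast+
  note rS = basic_conditionsD(1)[OF basic] and rm = basic_conditionsD(2)[OF basic]
    and \<rho>m = basic_conditionsD(3)[OF basic] and \<mu>m = basic_conditionsD(4)[OF basic]
    and \<rho>b = basic_conditionsD(5)[OF basic] and \<mu>b = basic_conditionsD(6)[OF basic]
  have V2: "V2 l \<subseteq> Sobolev l 2" by (auto simp: V2_def)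
  define p q where "p t = wderiv l 2 (u t)" and "q t = wderiv l 2 (ut t)" for t
  have w3: "has_weak_time_deriv l T p q"
    unfolding p_def q_def by (rule weak_time_deriv_wderiv2[OF l w1 uB _ _ vB V2]) simp_all
  define W V P where "W = continuous_rep l T u" and "V = continuous_rep l T ut" and "P = continuous_rep l T p"
  note Wc = continuous_rep[OF T w1, folded W_def] and Vc = continuous_rep[OF T w2, folded V_def]
    and Pc = continuous_rep[OF T w3, folded P_def]
  have WL: "W t \<in> L2 l" and PL: "P t \<in> L2 l" if "t \<in> {0..T}" for t
    using Wc(1) Pc(1) that by (auto simp: L2_continuous_def)
  have inT: "AE t in leb T. t \<in> {0<..<T}" using AE_space[of "leb T"] by simp
  have uS: "AE t in leb T. u t \<in> Sobolev l 4" and vS: "AE t in leb T. ut t \<in> V2 l" and aL: "AE t in leb T. utt t \<in> L2 l"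
    using uB vB aB by (auto simp: Bochner_L2_def)
  have prP: "prim l (P t) = prim l (p t)" if "AE x in leb l. P t x = p t x" "P t \<in> L2 l" for t
  proof
    show "prim l (P t) x = prim l (p t) x" for x
      by (rule prim_cong_AE) (use that L2_measurable[OF L2_cong_AE[OF that(2,1)]] L2_measurable[OF that(2)] in auto)
  qed
  have rep: "AE t in leb T. AE x in leb l. W t x = prim2 l (P t) x"
    using uS bc Wc(2) Pc(2) inT
  proof eventually_elim
    case (elim t)
    then have t: "t \<in> {0..T}" by simp
    have "AE x in leb l. u t x = prim2 l (p t) x"
      unfolding p_def by (rule prim_iterated_representation(1)[OF l Sobolev_mono[OF elim(1)]]) (use elim(2) in auto)
    with elim(3) show ?case
      unfolding prP[OF elim(4) PL[OF t]] by eventually_elim simp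
  qed
  \<comment> \<open>Both sides are continuous in time into L2, double integration being bounded
    there, so the identity passes from almost every time to each single one.\<close>
  have rep_all: "AE x in leb l. W t x = prim2 l (P t) x" if t: "t \<in> {0..T}" for t
  proof -
    \<comment> \<open>The time \<open>t\<close> itself is avoided because the limit within
      \<open>{0..T}\<close> is a punctured one.\<close>
    have "AE s in leb T. (AE x in leb l. W s x = prim2 l (P s) x) \<and> s \<noteq> t"
      using rep AE_leb_neq[where b = T and c = t] by eventually_elim blast
    then obtain X where X: "\<And>n. X n \<in> {0<..<T}"
      "\<And>n. (AE x in leb l. W (X n) x = prim l (prim l (P (X n))) x) \<and> X n \<noteq> t" "X \<longlonglongrightarrow> t"
      by (rule AE_leb_sequence[OF _ T t]) blast
    have X': "\<forall>n. X n \<in> {0..T} - {t}" using X(1,2) by (auto simp: less_imp_le)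
    have lim: "(\<lambda>n. dist2 l (F (X n)) (F t)) \<longlonglongrightarrow> 0" if "L2_continuous l T F" for F
    proof -
      have "((\<lambda>s. dist2 l (F s) (F t)) \<longlongrightarrow> 0) (at t within {0..T})"
        using that t by (simp add: L2_continuous_def)
      then show ?thesis using X' X(3) unfolding tendsto_at_iff_sequentially o_def by blast
    qed
    define G where "G h = prim2 l h" for h
    have GL: "G h \<in> L2 l" if "h \<in> L2 l" for h unfolding G_def by (rule prim_AC_L2(4)[OF l that])
    have Gd: "G f x - G g x = G (\<lambda>x. f x - g x) x" if "f \<in> L2 l" "g \<in> L2 l" for f g x
    proof -
      have "prim l (\<lambda>x. f x - g x) = (\<lambda>x. prim l f x - prim l g x)"
        by (rule ext) (rule prim_diff[OF L2_integrable L2_integrable], fact+)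
      then show ?thesis unfolding G_def
        using prim_diff[OF L2_integrable[OF prim_AC_L2(3)[OF l that(1)]] L2_integrable[OF prim_AC_L2(3)[OF l that(2)]]] by simp
    qed
    have Gn: "L2norm l (G h) \<le> sqrt (l ^ 4 / 8) * L2norm l h" if "h \<in> L2 l" for h
      unfolding L2norm_def real_sqrt_mult[symmetric] G_def
      by (rule real_sqrt_le_mono[OF prim_iterated_bounds(3)[OF l that]])
    have "dist2 l (W t) (G (P t)) \<le> 0"
    proof (rule LIMSEQ_le)
      show "(\<lambda>n. dist2 l (W t) (G (P t))) \<longlonglongrightarrow> dist2 l (W t) (G (P t))" by (rule tendsto_const)
      have "(\<lambda>n. dist2 l (W (X n)) (W t) + sqrt (l ^ 4 / 8) * dist2 l (P (X n)) (P t)) \<longlonglongrightarrow> 0 + sqrt (l ^ 4 / 8) * 0"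
        by (intro tendsto_add tendsto_mult tendsto_const lim Wc(1) Pc(1))
      then show "(\<lambda>n. dist2 l (W (X n)) (W t) + sqrt (l ^ 4 / 8) * dist2 l (P (X n)) (P t)) \<longlonglongrightarrow> 0" by simp
      have "dist2 l (W t) (G (P t)) \<le> dist2 l (W (X n)) (W t) + sqrt (l ^ 4 / 8) * dist2 l (P (X n)) (P t)" for n
      proof -
        have Xn: "X n \<in> {0..T}" using X' by blast
        note L = WL[OF t] WL[OF Xn] GL[OF PL[OF t]] GL[OF PL[OF Xn]]
        have "dist2 l (W t) (G (P t)) \<le> dist2 l (W t) (W (X n)) + dist2 l (W (X n)) (G (P t))"
          by (rule L2norm_diff_triangle[OF L(1,2,3)])
        also have "dist2 l (W (X n)) (G (P t)) = (dist2 l (G (P (X n))) (G (P t)))"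
          by (rule L2norm_cong_AE[OF L2_diff[OF L(2,3)]]) (use X(2)[of n] in \<open>auto simp: G_def elim: eventually_mono\<close>)
        also have "\<dots> \<le> sqrt (l ^ 4 / 8) * dist2 l (P (X n)) (P t)"
          unfolding Gd[OF PL[OF Xn] PL[OF t]] by (rule Gn[OF L2_diff[OF PL[OF Xn] PL[OF t]]])
        finally show ?thesis unfolding L2norm_minus_commute[of l "W t"] by simp
      qed
      then show "\<exists>N. \<forall>n\<ge>N. dist2 l (W t) (G (P t)) \<le> dist2 l (W (X n)) (W t) + sqrt (l ^ 4 / 8) * dist2 l (P (X n)) (P t)"
        by blast
    qed
    then have "dist2 l (W t) (G (P t)) = 0"
      using L2norm_nonneg[of l "\<lambda>x. W t x - G (P t) x"] by linarith
    from L2norm_zero_imp_AE[OF WL[OF t] GL[OF PL[OF t]] this] show ?thesis unfolding G_def .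
  qed
  have main: "AE t in leb T. q t \<in> L2 l \<and> ut t \<in> L2 l \<and> utt t \<in> L2 l \<and>
       (AE x in leb l. V t x = ut t x) \<and> (AE x in leb l. ut t x = prim2 l (q t) x) \<and>
       weak_beam l \<rho> \<mu> r kr ka kd kv (P t) (q t) (ut t) (utt t)"
    using uS vS aL pde bc Vc(2) Pc(2) inT
  proof eventually_elim
    case (elim t)
    have t: "t \<in> {0..T}" using elim(8) by simp
    have u2: "u t \<in> Sobolev l 2" by (rule Sobolev_mono[OF elim(1)]) simp
    have v2: "ut t \<in> Sobolev l 2" and vt: "trace l (ut t) 0 = 0" "trace l (wderiv l 1 (ut t)) 0 = 0"
      using elim(2) by (auto simp: V2_def)
    have ut: "trace l (u t) 0 = 0" "trace l (wderiv l 1 (u t)) 0 = 0" using elim(5) by auto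
    note U = prim_iterated_representation[OF l u2 ut, folded p_def] and Vr = prim_iterated_representation[OF l v2 vt, folded q_def]
    have qL: "q t \<in> L2 l" unfolding q_def by (rule Sobolev_wderiv(2)[OF l v2]) simp
    have vL: "ut t \<in> L2 l" by (rule Sobolev_L2[OF v2])
    have pS: "p t \<in> Sobolev l 2" unfolding p_def by (rule Sobolev4_wderiv2[OF l elim(1)])
    have "wip l \<rho> (utt t) (prim2 l h) + wip l \<mu> (ut t) (prim2 l h)
         + wip l r (P t) h
         + (kd * prim2 l (P t) l + kv * prim2 l (q t) l) * prim2 l h l
         + (kr * prim l (P t) l + ka * prim l (q t) l) * prim l h l = 0" if h: "h \<in> L2 l" for h
    proof -
      note B = beam_operator_by_parts[OF l rS pS h]
      have HL: "prim2 l h \<in> L2 l" by (rule prim_AC_L2(4)[OF l h])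
      have i: "integrable (leb l) (\<lambda>x. \<rho> x * utt t x * prim2 l h x)" "integrable (leb l) (\<lambda>x. \<mu> x * ut t x * prim2 l h x)"
        by (intro L2_mult_integrable L2_mult_bounded[OF elim(3) \<rho>m \<rho>b] L2_mult_bounded[OF vL \<mu>m \<mu>b] HL)+
      have "0 = (\<integral>x. \<rho> x * utt t x * prim2 l h x + \<mu> x * ut t x * prim2 l h x + wderiv l 2 (\<lambda>y. r y * p t y) x * prim2 l h x \<partial>leb l)"
      proof (rule integral_eq_zero_AE[symmetric])
        show "AE x in leb l. \<rho> x * utt t x * prim2 l h x + \<mu> x * ut t x * prim2 l h x + wderiv l 2 (\<lambda>y. r y * p t y) x * prim2 l h x = 0"
          using elim(4)
        proof eventually_elim
          case (elim x)
          then show ?case by (simp only: p_def distrib_right[symmetric])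
        qed
      qed
      also have "\<dots> = wip l \<rho> (utt t) (prim2 l h) + wip l \<mu> (ut t) (prim2 l h)
          + (\<integral>x. wderiv l 2 (\<lambda>y. r y * p t y) x * prim2 l h x \<partial>leb l)"
        using i B(2) by simp
      also have "(\<integral>x. wderiv l 2 (\<lambda>y. r y * p t y) x * prim2 l h x \<partial>leb l) =
          trace l (wderiv l 1 (\<lambda>y. r y * p t y)) l * prim2 l h l - trace l (\<lambda>y. r y * p t y) l * prim l h l
          + wip l r (p t) h" by (rule B(1))
      \<comment> \<open>The conditions at the free end express the traces of shear force and bending
        moment by the springs and dampers.\<close>
      also have "trace l (wderiv l 1 (\<lambda>y. r y * p t y)) l = kd * prim2 l (p t) l + kv * prim2 l (q t) l"
        using elim(5) U Vr unfolding p_def[symmetric] by simp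
      also have "trace l (\<lambda>y. r y * p t y) l = - (kr * prim l (p t) l + ka * prim l (q t) l)"
        using elim(5) U Vr unfolding p_def[symmetric] by simp
      also have "wip l r (p t) h = wip l r (P t) h"
        by (rule integral_cong_AE)
           (use rm L2_measurable[OF h] L2_measurable[OF PL[OF t]] L2_measurable[OF Sobolev_L2[OF pS]] elim(7) in \<open>auto elim: eventually_mono\<close>)
      finally show ?thesis unfolding prP[OF elim(7) PL[OF t]] by (simp add: algebra_simps)
    qed
    then show ?case using qL vL elim(3,6) Vr(1) unfolding weak_beam_def by blast
  qed
  show ?thesis
    by (rule that[OF continuous_rep_L2_AC[OF T w1] continuous_rep_L2_AC[OF T w2] continuous_rep_L2_AC[OF T w3]
      rep_all[unfolded W_def P_def] main[unfolded V_def P_def]])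
qed

section \<open>The energy as a function of the state\<close>

lemma has_weak_deriv_left_cong_AE:
  assumes "AE x in leb b. f x = f' x" shows "has_weak_deriv b j f = has_weak_deriv b j f'"
proof
  have s: "AE x in leb b. f' x = f x" using assms by (auto elim: eventually_mono)
  show "has_weak_deriv b j f g = has_weak_deriv b j f' g" for g
    by (blast intro: has_weak_deriv_cong_AE[OF _ assms, of j g g] has_weak_deriv_cong_AE[OF _ s, of j g g])
qed

text \<open>Here even equality of functions holds, since both choices are made from the same
  predicate.\<close>

lemma wderiv_cong_AE: "AE x in leb b. f x = f' x \<Longrightarrow> wderiv b j f = wderiv b j f'"
  unfolding wderiv_def by (simp only: has_weak_deriv_left_cong_AE)

lemma trace_cong_AE:
  assumes "AE x in leb l. f x = f' x" shows "trace l f = trace l f'"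
proof -
  have "(AE x in leb l. F x = f x) \<longleftrightarrow> (AE x in leb l. F x = f' x)" for F
    using assms by (intro iffI) (auto elim: eventually_elim2)
  then show ?thesis unfolding trace_def by simp
qed

text \<open>The initial data are attained only up to null sets; this identifies the energy at time 0
  with that of the data.\<close>

lemma state_energy_cong_AE:
  assumes w: "AE x in leb l. w x = w' x" and v: "AE x in leb l. v x = v' x"
    and m: "\<rho> \<in> borel_measurable (leb l)" "r \<in> borel_measurable (leb l)"
      "v \<in> borel_measurable (leb l)" "wderiv l 2 w \<in> borel_measurable (leb l)"
  shows "state_energy l \<rho> r kr kd w v = state_energy l \<rho> r kr kd w' v'"
proof -
  have m': "v' \<in> borel_measurable (leb l)" by (rule borel_measurable_leb_AE[OF m(3) v])
  have "(\<integral>x. \<rho> x * (v x)\<^sup>2 + r x * (wderiv l 2 w x)\<^sup>2 \<partial>leb l) = (\<integral>x. \<rho> x * (v' x)\<^sup>2 + r x * (wderiv l 2 w x)\<^sup>2 \<partial>leb l)"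
    by (rule integral_cong_AE) (use m m' v in \<open>auto elim: eventually_mono\<close>)
  then show ?thesis
    unfolding state_energy_def wderiv_cong_AE[OF w] trace_cong_AE[OF w] by simp
qed

text \<open>The displacement at a single time is known only through its representation as a double
  integral, which also evaluates \<open>wderiv\<close> and the traces.\<close>

lemma state_energy_prim:
  assumes l: "0 < l" and h: "h \<in> L2 l" and w: "AE x in leb l. w x = prim2 l h x" and v: "v \<in> L2 l"
    and \<rho>: "\<rho> \<in> borel_measurable (leb l)" "AE x in leb l. \<bar>\<rho> x\<bar> \<le> \<rho>1"
    and r: "r \<in> borel_measurable (leb l)" "AE x in leb l. \<bar>r x\<bar> \<le> r1"
  shows "state_energy l \<rho> r kr kd w v = 1 / 2 * wip l \<rho> v v + 1 / 2 * wip l r h h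
    + 1 / 2 * kr * (prim l h l * prim l h l) + 1 / 2 * kd * (prim2 l h l * prim2 l h l)"
    "wderiv l 2 w \<in> borel_measurable (leb l)"
proof -
  note W = prim_iterated_wderiv[OF l h w]
  show wm: "wderiv l 2 w \<in> borel_measurable (leb l)"
    by (rule borel_measurable_leb_AE[OF L2_measurable[OF h]]) (use W(1) in \<open>auto elim: eventually_mono\<close>)
  have i: "integrable (leb l) (\<lambda>x. \<rho> x * v x * v x)" "integrable (leb l) (\<lambda>x. r x * h x * h x)"
    by (intro L2_mult_integrable L2_mult_bounded[OF v \<rho>] L2_mult_bounded[OF h r] v h)+
  have "(\<integral>x. \<rho> x * (v x)\<^sup>2 + r x * (wderiv l 2 w x)\<^sup>2 \<partial>leb l) = (\<integral>x. \<rho> x * v x * v x + r x * h x * h x \<partial>leb l)"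
    by (rule integral_cong_AE)
       (use wm \<rho>(1) r(1) L2_measurable[OF v] L2_measurable[OF h] W(1) in \<open>auto simp: power2_eq_square mult.assoc elim: eventually_mono\<close>)
  then show "state_energy l \<rho> r kr kd w v = 1 / 2 * wip l \<rho> v v + 1 / 2 * wip l r h h
    + 1 / 2 * kr * (prim l h l * prim l h l) + 1 / 2 * kd * (prim2 l h l * prim2 l h l)"
    unfolding state_energy_def W(2,3) using i by (simp add: power2_eq_square algebra_simps)
qed

section \<open>Decay and comparison estimates\<close>

lemma Gronwall_AC:
  assumes T: "0 < T" and L: "AC T L m" and m: "AE t in leb T. m t \<le> - \<sigma> * L t" and t: "t \<in> {0..T}"
  shows "L t \<le> exp (- \<sigma> * t) * L 0"
proof -
  \<comment> \<open>The integrating factor: its product with \<open>L\<close> has a density that is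
    nonpositive almost everywhere.\<close>
  have "AC T (\<lambda>t. exp (\<sigma> * t)) (\<lambda>t. \<sigma> * exp (\<sigma> * t))"
    by (rule AC_smooth[OF _ _ T]) (auto intro!: derivative_eq_intros continuous_intros)
  note A = AC_mult[OF this L T]
  have "exp (\<sigma> * t) * L t = exp (\<sigma> * 0) * L 0 + prim T (\<lambda>t. \<sigma> * exp (\<sigma> * t) * L t + exp (\<sigma> * t) * m t) t"
    by (rule AC_eq[OF A t])
  moreover have "prim T (\<lambda>t. \<sigma> * exp (\<sigma> * t) * L t + exp (\<sigma> * t) * m t) t \<le> 0"
  proof -
    have "0 \<le> (\<integral>s. indicator {..<t} s * - (\<sigma> * exp (\<sigma> * s) * L s + exp (\<sigma> * s) * m s) \<partial>leb T)"
    proof (rule integral_nonneg_AE)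
      show "AE s in leb T. 0 \<le> indicator {..<t} s * - (\<sigma> * exp (\<sigma> * s) * L s + exp (\<sigma> * s) * m s)"
        using m
      proof eventually_elim
        case (elim s)
        then have "exp (\<sigma> * s) * (m s + \<sigma> * L s) \<le> 0" by (intro mult_nonneg_nonpos) auto
        then show ?case by (simp add: algebra_simps split: split_indicator)
      qed
    qed
    also have "\<dots> = - prim T (\<lambda>t. \<sigma> * exp (\<sigma> * t) * L t + exp (\<sigma> * t) * m t) t"
      unfolding prim_def by (simp only: mult_minus_right Bochner_Integration.integral_minus)
    finally show ?thesis by simp
  qed
  ultimately have "exp (\<sigma> * t) * L t \<le> L 0" by simp
  then have "exp (- \<sigma> * t) * (exp (\<sigma> * t) * L t) \<le> exp (- \<sigma> * t) * L 0" by (intro mult_left_mono) auto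
  then show ?thesis by (simp add: mult.assoc[symmetric] exp_add[symmetric])
qed

text \<open>The real inequalities between energy and multiplier functional. \<open>k1\<close>,
  \<open>k2\<close> stand for twice the kinetic and bending energy, \<open>K\<close> for the
  integral of u_xx^2, \<open>A2\<close>, \<open>B2\<close> for the squared slope and displacement at
  \<open>l\<close>, \<open>j1\<close> for the mixed term and \<open>j2\<close> for the damping term
  of the multiplier.\<close>

lemma lyapunov_bounds:
  fixes l \<rho>1 r0 \<mu>1 ka kv kr kd K k1 k2 A2 B2 j1 j2 \<beta>0 \<beta>1 :: real
  assumes pos: "0 < l" "0 < \<rho>1" "0 < r0" "0 \<le> \<mu>1" "0 \<le> ka" "0 \<le> kv" "0 \<le> kr" "0 \<le> kd"
    and K: "r0 * K \<le> k2" "0 \<le> K" "0 \<le> k1"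
    and A2: "0 \<le> A2" "A2 \<le> l * K" and B2: "0 \<le> B2" "B2 \<le> l ^ 3 / 2 * K"
    and j2: "0 \<le> j2" "j2 \<le> \<mu>1 * (l ^ 4 / 8 * K)" and j1: "\<bar>j1\<bar> \<le> \<beta>0 / 2 * (k1 + k2)"
    and \<beta>: "\<beta>0 = l\<^sup>2 / 2 * sqrt (\<rho>1 / r0)"
      "\<beta>1 = \<beta>0 * (1 + 1 / sqrt (\<rho>1 * r0) * (l\<^sup>2 / 2 * \<mu>1 + 2 / l * ka + l * kv))"
  defines "E \<equiv> 1 / 2 * k1 + 1 / 2 * k2 + 1 / 2 * kr * A2 + 1 / 2 * kd * B2"
    and "J \<equiv> j1 + 1 / 2 * j2 + 1 / 2 * ka * A2 + 1 / 2 * kv * B2"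
  shows "0 \<le> E" "J \<le> \<beta>1 * E" "- (\<beta>0 * E) \<le> J" "0 \<le> \<beta>0" "\<beta>0 \<le> \<beta>1"
proof -
  have k2: "0 \<le> k2" using K pos by (intro order_trans[OF _ K(1)]) simp
  have kAB: "0 \<le> kr * A2" "0 \<le> kd * B2" "0 \<le> ka * A2" "0 \<le> kv * B2" using pos A2 B2 by simp_all
  show b0: "0 \<le> \<beta>0" using pos by (simp add: \<beta>(1))
  have E2: "1 / 2 * (k1 + k2) \<le> E" unfolding E_def using kAB by simp
  have "0 \<le> 1 / 2 * (k1 + k2)" using k2 K(3) by simp
  then show E0: "0 \<le> E" using E2 by (rule order_trans)
  have bE: "\<beta>0 / 2 * (k1 + k2) \<le> \<beta>0 * E" using mult_left_mono[OF E2 b0] by simp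
  show "- (\<beta>0 * E) \<le> J" unfolding J_def using j1 bE kAB j2(1) by linarith
  define c where "c = l\<^sup>2 / 2 * \<mu>1 + 2 / l * ka + l * kv"
  have c: "0 \<le> c" using pos by (simp add: c_def)
  \<comment> \<open>The square roots cancel, so the excess of \<beta>1 over \<beta>0 depends on
    \<open>r0\<close> but not on \<open>\<rho>1\<close>.\<close>
  have e: "\<beta>0 * (1 / sqrt (\<rho>1 * r0)) = l\<^sup>2 / (2 * r0)"
    using pos by (simp add: \<beta>(1) real_sqrt_divide real_sqrt_mult field_simps)
  have b1: "\<beta>1 = \<beta>0 + l\<^sup>2 / (2 * r0) * c"
    unfolding \<beta>(2) c_def[symmetric] by (simp only: distrib_left mult_1_right mult.assoc[symmetric] e)
  show "\<beta>0 \<le> \<beta>1" unfolding b1 using c pos by simp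
  have K2: "K \<le> k2 / r0" using K(1) pos by (simp add: field_simps)
  have "j2 + ka * A2 + kv * B2 \<le> \<mu>1 * (l ^ 4 / 8 * K) + ka * (l * K) + kv * (l ^ 3 / 2 * K)"
    using j2(2) mult_left_mono[OF A2(2) pos(5)] mult_left_mono[OF B2(2) pos(6)] by linarith
  \<comment> \<open>Relaxing l^4/8 to l^4/4 makes the three terms add up to exactly
    \<open>l^2 / 2 * c * K\<close>.\<close>
  also have "\<dots> \<le> \<mu>1 * (l ^ 4 / 4 * K) + ka * (l * K) + kv * (l ^ 3 / 2 * K)"
    using pos K(2) by (intro add_right_mono mult_left_mono mult_right_mono) simp_all
  also have "\<dots> = l\<^sup>2 / 2 * c * K"
    using pos by (simp add: c_def field_simps power2_eq_square power3_eq_cube power4_eq_xxxx)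
  also have "\<dots> \<le> l\<^sup>2 / 2 * c * (k2 / r0)"
    using pos c by (intro mult_left_mono K2) simp
  also have "\<dots> = 2 * (l\<^sup>2 / (2 * r0) * c * (1 / 2 * k2))" using pos by (simp add: field_simps)
  also have "l\<^sup>2 / (2 * r0) * c * (1 / 2 * k2) \<le> l\<^sup>2 / (2 * r0) * c * E"
    using E2 K(3) pos c by (intro mult_left_mono) auto
  finally have "1 / 2 * j2 + 1 / 2 * ka * A2 + 1 / 2 * kv * B2 \<le> l\<^sup>2 / (2 * r0) * c * E" by linarith
  then show "J \<le> \<beta>1 * E" unfolding J_def b1 distrib_right using j1 bE by linarith
qed

text \<open>Young's inequality 2 |f| (c |g|) \<le> f^2 + c^2 g^2, multiplied by the weight and
  divided by 2c. The weight is kept in the term with \<open>g\<close>, where it forms the kinetic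
  energy, and replaced by its bound in the term with \<open>f\<close>.\<close>

lemma weighted_product_bound:
  assumes f: "f \<in> L2 l" and g: "g \<in> L2 l"
    and a: "a \<in> borel_measurable (leb l)" "AE x in leb l. 0 \<le> a x \<and> a x \<le> C" and c: "0 < c"
  shows "\<bar>wip l a f g\<bar> \<le> c / 2 * wip l a g g + C / (2 * c) * (\<integral>x. (f x)\<^sup>2 \<partial>leb l)"
proof -
  have ab: "AE x in leb l. \<bar>a x\<bar> \<le> C" using a(2) by eventually_elim auto
  have af: "(\<lambda>x. a x * f x) \<in> L2 l" and ag: "(\<lambda>x. a x * g x) \<in> L2 l"
    by (rule L2_mult_bounded[OF f a(1) ab] L2_mult_bounded[OF g a(1) ab])+
  note i = L2_mult_integrable[OF af g] L2_mult_integrable[OF ag g] L2_sq_integrable[OF f]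
  have "\<bar>wip l a f g\<bar> \<le> (\<integral>x. \<bar>a x * f x * g x\<bar> \<partial>leb l)"
    by (rule integral_abs_bound)
  also have "\<dots> \<le> (\<integral>x. c / 2 * (a x * g x * g x) + C / (2 * c) * (f x)\<^sup>2 \<partial>leb l)"
  proof (rule integral_mono_AE)
    show "AE x in leb l. \<bar>a x * f x * g x\<bar> \<le> c / 2 * (a x * g x * g x) + C / (2 * c) * (f x)\<^sup>2"
      using a(2)
    proof eventually_elim
      case (elim x)
      have "2 * (\<bar>f x\<bar> * (c * \<bar>g x\<bar>)) \<le> (f x)\<^sup>2 + (c * g x)\<^sup>2"
        using sum_squares_bound[of "\<bar>f x\<bar>" "c * \<bar>g x\<bar>"] by (simp add: power_mult_distrib)
      then have "a x * (2 * (\<bar>f x\<bar> * (c * \<bar>g x\<bar>))) \<le> a x * ((f x)\<^sup>2 + (c * g x)\<^sup>2)"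
        using elim by (intro mult_left_mono) auto
      also have "\<dots> \<le> C * (f x)\<^sup>2 + a x * (c * g x)\<^sup>2"
        using elim mult_right_mono[of "a x" C "(f x)\<^sup>2"] by (simp add: distrib_left)
      finally have S: "a x * (2 * (\<bar>f x\<bar> * (c * \<bar>g x\<bar>))) \<le> C * (f x)\<^sup>2 + a x * (c * g x)\<^sup>2" .
      have "\<bar>a x * f x * g x\<bar> = a x * (2 * (\<bar>f x\<bar> * (c * \<bar>g x\<bar>))) / (2 * c)"
        using elim c by (simp add: abs_mult)
      also have "\<dots> \<le> (C * (f x)\<^sup>2 + a x * (c * g x)\<^sup>2) / (2 * c)"
        using c by (intro divide_right_mono S) simp
      also have "\<dots> = c / 2 * (a x * g x * g x) + C / (2 * c) * (f x)\<^sup>2"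
        using c by (simp add: field_simps power2_eq_square)
      finally show ?case .
    qed
  qed (use i in auto)
  also have "\<dots> = c / 2 * wip l a g g + C / (2 * c) * (\<integral>x. (f x)\<^sup>2 \<partial>leb l)"
    using i by simp
  finally show ?thesis .
qed

text \<open>One comparison of weights serves for positivity, for the constant bounds on
  \<open>r\<close> and \<mu>, and for the domination of \<rho> by the damping.\<close>

lemma weighted_square_mono:
  assumes f: "f \<in> L2 l" and a: "a \<in> borel_measurable (leb l)" "AE x in leb l. \<bar>a x\<bar> \<le> C"
    and b: "b \<in> borel_measurable (leb l)" "AE x in leb l. \<bar>b x\<bar> \<le> D" and le: "AE x in leb l. a x \<le> b x"
  shows "wip l a f f \<le> wip l b f f"
proof (rule integral_mono_AE)
  show "integrable (leb l) (\<lambda>x. a x * f x * f x)" "integrable (leb l) (\<lambda>x. b x * f x * f x)"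
    by (intro L2_mult_integrable L2_mult_bounded[OF f a] L2_mult_bounded[OF f b] f)+
  show "AE x in leb l. a x * f x * f x \<le> b x * f x * f x"
    using le
  proof eventually_elim
    case (elim x)
    then have "a x * (f x * f x) \<le> b x * (f x * f x)" by (intro mult_right_mono) auto
    then show ?case by (simp only: mult.assoc)
  qed
qed

section \<open>Exponential decay of the energy\<close>

theorem theorem1:
  fixes l T \<rho>0 \<rho>1 \<mu>0 \<mu>1 r0 r1 kr ka kd kv lam \<beta>0 \<beta>1 M_d \<sigma> t :: real
    and \<rho> \<mu> r u0 u1 :: "real \<Rightarrow> real"
    and u ut utt :: "real \<Rightarrow> real \<Rightarrow> real"
  assumes "0 < l" and "0 < T"
    and "basic_conditions l \<rho> \<mu> r u0 u1 \<rho>0 \<rho>1 \<mu>0 \<mu>1 r0 r1 kr ka kd kv"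
    and "0 < \<mu>0"
    and "regular_weak_solution l T \<rho> \<mu> r u0 u1 kr ka kd kv u ut utt"
    and "0 < state_energy l \<rho> r kr kd u0 u1"
    and "\<beta>0 = l\<^sup>2 / 2 * sqrt (\<rho>1 / r0)"
    and "\<beta>1 = \<beta>0 * (1 + 1 / sqrt (\<rho>1 * r0) * (l\<^sup>2 / 2 * \<mu>1 + 2 / l * ka + l * kv))"
    and "0 < lam" and "lam < min (1 / \<beta>0) (\<mu>0 / (2 * \<rho>1))"
    and "M_d = (1 + \<beta>1 * lam) / (1 - \<beta>0 * lam)"
    and "\<sigma> = 2 * lam / (1 + \<beta>1 * lam)"
    and "t \<in> {0..T}"
  shows "energy l T \<rho> r kr kd u ut t \<le> M_d * exp (- \<sigma> * t) * state_energy l \<rho> r kr kd u0 u1"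
proof -
  note l = assms(1) and T = assms(2) and basic = assms(3) and sol = assms(5) and \<beta> = assms(7,8) and lam = assms(9,10)
  note D = basic_conditionsD[OF basic]
  have bounds: "AE x in leb l. \<rho>0 \<le> \<rho> x \<and> \<rho> x \<le> \<rho>1" "AE x in leb l. r0 \<le> r x \<and> r x \<le> r1" "AE x in leb l. \<mu>0 \<le> \<mu> x \<and> \<mu> x \<le> \<mu>1"
    and pos: "0 < \<rho>0" "0 < r0" "0 \<le> kr" "0 \<le> ka" "0 \<le> kd" "0 \<le> kv"
    using basic unfolding basic_conditions_def by blast+
  have "0 < \<rho>1" "0 \<le> \<mu>1"
  proof -
    \<comment> \<open>Comparisons of constants that hold almost everywhere hold outright, as the
      interval has positive measure.\<close>
    have "AE x in leb l. \<rho>0 \<le> \<rho>1 \<and> \<mu>0 \<le> \<mu>1" using bounds(1,3) by eventually_elim auto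
    then obtain x :: real where "\<rho>0 \<le> \<rho>1 \<and> \<mu>0 \<le> \<mu>1" by (rule AE_leb_dense[where a = 0 and b = l and c = l]) (use l in auto)
    then show "0 < \<rho>1" "0 \<le> \<mu>1" using pos assms(4) by auto
  qed
  obtain P q where W: "L2_AC l T (continuous_rep l T u) ut" and V: "L2_AC l T (continuous_rep l T ut) utt" and P: "L2_AC l T P q"
    and WP: "\<And>t. t \<in> {0..T} \<Longrightarrow> AE x in leb l. continuous_rep l T u t x = prim2 l (P t) x"
    and ident: "AE t in leb T. q t \<in> L2 l \<and> ut t \<in> L2 l \<and> utt t \<in> L2 l \<and>
       (AE x in leb l. continuous_rep l T ut t x = ut t x) \<and>
       (AE x in leb l. ut t x = prim2 l (q t) x) \<and>
       weak_beam l \<rho> \<mu> r kr ka kd kv (P t) (q t) (ut t) (utt t)"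
    by (rule regular_weak_solution_state[OF l T basic sol]) blast
  define w v where "w = continuous_rep l T u" and "v = continuous_rep l T ut"
  note W = W[folded w_def] and V = V[folded v_def] and WP = WP[folded w_def] and ident = ident[folded v_def]
  have wL: "w t \<in> L2 l" and vL: "v t \<in> L2 l" and PL: "P t \<in> L2 l" if "t \<in> {0..T}" for t
    using W V P that by (auto simp: L2_AC_def)
  \<comment> \<open>Slope and displacement at the free end; the primed versions belong to the
    velocity.\<close>
  define A B A' B' where "A t = prim l (P t) l" and "B t = prim2 l (P t) l"
    and "A' t = prim l (q t) l" and "B' t = prim2 l (q t) l" for t
  have qL: "AE t in leb T. q t \<in> L2 l" using ident by eventually_elim blast
  have A: "AC T A A'"
  proof -
    note I = L2_AC_integral[OF P, of "\<lambda>x. 1", OF L2_const]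
    have ae: "AE t in leb T. (\<integral>x. q t x * 1 \<partial>leb l) = A' t"
      using qL by eventually_elim (simp only: A'_def prim_iterated_end(1)[OF l])
    show ?thesis
      by (rule AC_cong[OF I _ ae borel_measurable_leb_AE[OF borel_measurable_integrable[OF AC_integrable[OF I]] ae] T])
         (simp only: A_def prim_iterated_end(1)[OF l PL])
  qed
  have B: "AC T B B'"
  proof -
    have "AC l (\<lambda>x. l - x) (\<lambda>x. -1)"
      by (rule AC_smooth[OF _ _ l]) (auto intro!: derivative_eq_intros)
    note I = L2_AC_integral[OF P AC_L2[OF this l]]
    have ae: "AE t in leb T. (\<integral>x. q t x * (l - x) \<partial>leb l) = B' t"
      using qL by eventually_elim (simp only: B'_def prim_iterated_end(2)[OF l])
    show ?thesis
      by (rule AC_cong[OF I _ ae borel_measurable_leb_AE[OF borel_measurable_integrable[OF AC_integrable[OF I]] ae] T])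
         (simp only: B_def prim_iterated_end(2)[OF l PL])
  qed
  have \<rho>1: "0 \<le> \<rho>1" and r1: "0 \<le> r1" and \<mu>1: "0 \<le> \<mu>1"
  proof -
    have "AE x in leb l. 0 \<le> r1" using D(7) by eventually_elim auto
    then obtain x :: real where "0 \<le> r1" by (rule AE_leb_dense[where a = 0 and b = l and c = l]) (use l in auto)
    then show "0 \<le> r1" .
  qed (use \<open>0 < \<rho>1\<close> \<open>0 \<le> \<mu>1\<close> in auto)
  define k1 k2 j1 j2 where "k1 t = wip l \<rho> (v t) (v t)" and "k2 t = wip l r (P t) (P t)"
    and "j1 t = wip l \<rho> (w t) (v t)" and "j2 t = wip l \<mu> (w t) (w t)" for t
  note ACs = L2_AC_product[OF T L2_AC_mult[OF V D(3,5) \<rho>1] V, folded k1_def]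
    L2_AC_product[OF T L2_AC_mult[OF P D(2,7) r1] P, folded k2_def]
    L2_AC_product[OF T L2_AC_mult[OF W D(3,5) \<rho>1] V, folded j1_def]
    L2_AC_product[OF T L2_AC_mult[OF W D(4,6) \<mu>1] W, folded j2_def]
    AC_mult[OF A A T] AC_mult[OF B B T]
  define E J where "E t = 1 / 2 * k1 t + 1 / 2 * k2 t + 1 / 2 * kr * (A t * A t) + 1 / 2 * kd * (B t * B t)"
    and "J t = j1 t + 1 / 2 * j2 t + 1 / 2 * ka * (A t * A t) + 1 / 2 * kv * (B t * B t)" for t
  \<comment> \<open>The densities exactly as the product rule delivers them; the beam equation
    enters only in \<open>decay\<close>.\<close>
  define E' J' where "E' t = 1 / 2 * (wip l \<rho> (utt t) (v t) + wip l \<rho> (v t) (utt t))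
      + 1 / 2 * (wip l r (q t) (P t) + wip l r (P t) (q t))
      + 1 / 2 * kr * (A' t * A t + A t * A' t) + 1 / 2 * kd * (B' t * B t + B t * B' t)"
    and "J' t = (wip l \<rho> (ut t) (v t) + wip l \<rho> (w t) (utt t))
      + 1 / 2 * (wip l \<mu> (ut t) (w t) + wip l \<mu> (w t) (ut t))
      + 1 / 2 * ka * (A' t * A t + A t * A' t) + 1 / 2 * kv * (B' t * B t + B t * B' t)" for t
  have E: "AC T E E'" unfolding E_def E'_def by (intro AC_add AC_scale ACs)
  have J: "AC T J J'" unfolding J_def J'_def by (intro AC_add AC_scale ACs)
  have L: "AC T (\<lambda>t. E t + lam * J t) (\<lambda>t. E' t + lam * J' t)" by (intro AC_add AC_scale E J)
  have lam1: "lam * \<beta>0 < 1" and lam2: "2 * lam * \<rho>1 \<le> \<mu>0"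
  proof -
    have "0 < \<beta>0" using l \<open>0 < \<rho>1\<close> pos by (simp add: \<beta>(1))
    then show "lam * \<beta>0 < 1" using lam by (simp add: field_simps)
    have "lam < \<mu>0 / (2 * \<rho>1)" using lam by simp
    then show "2 * lam * \<rho>1 \<le> \<mu>0" using \<open>0 < \<rho>1\<close> by (simp add: field_simps)
  qed
  have bnd: "0 \<le> E t" "J t \<le> \<beta>1 * E t" "- (\<beta>0 * E t) \<le> J t" "0 \<le> \<beta>0" "\<beta>0 \<le> \<beta>1" if t: "t \<in> {0..T}" for t
  proof -
    define K where "K = (\<integral>x. (P t x)\<^sup>2 \<partial>leb l)"
    note pb = prim_iterated_bounds[OF l PL[OF t], folded K_def]
    have wK: "(\<integral>x. (w t x)\<^sup>2 \<partial>leb l) \<le> l ^ 4 / 8 * K"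
    proof -
      have "(\<integral>x. (w t x)\<^sup>2 \<partial>leb l) = (\<integral>x. (prim2 l (P t) x)\<^sup>2 \<partial>leb l)"
        using L2norm_cong_AE[OF wL[OF t] WP[OF t]] by (simp add: L2norm_def)
      with pb(3) show ?thesis by simp
    qed
    have K0: "0 \<le> K" by (simp add: K_def)
    have rK: "r0 * K \<le> k2 t"
    proof -
      have "(\<integral>x. r0 * P t x * P t x \<partial>leb l) \<le> k2 t"
        unfolding k2_def
        by (rule weighted_square_mono[OF PL[OF t] _ _ D(2,7), of _ r0]) (use bounds(2) pos in \<open>auto elim: eventually_mono\<close>)
      then show ?thesis by (simp add: K_def power2_eq_square mult.assoc)
    qed
    have \<rho>nn: "AE x in leb l. 0 \<le> \<rho> x" using bounds(1) by eventually_elim (use pos in auto)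
    have \<mu>nn: "AE x in leb l. 0 \<le> \<mu> x" using bounds(3) by eventually_elim (use assms(4) in auto)
    have k1: "0 \<le> k1 t"
      unfolding k1_def using weighted_square_mono[OF vL[OF t] _ _ D(3,5), of "\<lambda>x. 0" 0] \<rho>nn by auto
    have j2: "0 \<le> j2 t" "j2 t \<le> \<mu>1 * (l ^ 4 / 8 * K)"
    proof -
      show "0 \<le> j2 t"
        unfolding j2_def using weighted_square_mono[OF wL[OF t] _ _ D(4,6), of "\<lambda>x. 0" 0] \<mu>nn by auto
      have "j2 t \<le> (\<integral>x. \<mu>1 * w t x * w t x \<partial>leb l)"
        unfolding j2_def
        by (rule weighted_square_mono[OF wL[OF t] D(4,6), of _ \<mu>1]) (use bounds(3) \<mu>1 in \<open>auto elim: eventually_mono\<close>)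
      also have "\<dots> = \<mu>1 * (\<integral>x. (w t x)\<^sup>2 \<partial>leb l)" by (simp add: power2_eq_square mult.assoc)
      also have "\<dots> \<le> \<mu>1 * (l ^ 4 / 8 * K)" by (rule mult_left_mono[OF wK \<mu>1])
      finally show "j2 t \<le> \<mu>1 * (l ^ 4 / 8 * K)" .
    qed
    have b0: "0 < \<beta>0" using l \<open>0 < \<rho>1\<close> pos by (simp add: \<beta>(1))
    have b02: "\<beta>0\<^sup>2 = l ^ 4 / 4 * (\<rho>1 / r0)"
      using \<open>0 < \<rho>1\<close> pos by (simp add: \<beta>(1) power_mult_distrib power_divide)
    have j1: "\<bar>j1 t\<bar> \<le> \<beta>0 / 2 * (k1 t + k2 t)"
    proof -
      \<comment> \<open>With weight \<beta>0, the value of \<open>\<beta>0^2\<close> in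
        \<open>b02\<close> turns the displacement term into at most
        \<open>\<beta>0 / 4 * k2 t\<close>, half of what is allowed.\<close>
      have "\<bar>j1 t\<bar> \<le> \<beta>0 / 2 * k1 t + \<rho>1 / (2 * \<beta>0) * (\<integral>x. (w t x)\<^sup>2 \<partial>leb l)"
        unfolding j1_def k1_def
        by (rule weighted_product_bound[OF wL[OF t] vL[OF t] D(3) _ b0]) (use bounds(1) pos in \<open>auto elim: eventually_mono\<close>)
      also have "\<rho>1 / (2 * \<beta>0) * (\<integral>x. (w t x)\<^sup>2 \<partial>leb l) \<le> \<rho>1 / (2 * \<beta>0) * (l ^ 4 / 8 * (k2 t / r0))"
      proof (rule mult_left_mono)
        have "K \<le> k2 t / r0" using rK pos by (simp add: field_simps)
        then have "l ^ 4 / 8 * K \<le> l ^ 4 / 8 * (k2 t / r0)" by (intro mult_left_mono) simp_all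
        with wK show "(\<integral>x. (w t x)\<^sup>2 \<partial>leb l) \<le> l ^ 4 / 8 * (k2 t / r0)" by linarith
      qed (use \<open>0 < \<rho>1\<close> b0 in simp)
      also have "\<dots> = \<beta>0\<^sup>2 * k2 t / (4 * \<beta>0)" unfolding b02 by (simp add: ac_simps)
      also have "\<dots> = \<beta>0 / 4 * k2 t" using b0 by (simp add: power2_eq_square)
      also have "\<dots> \<le> \<beta>0 / 2 * k2 t"
      proof (rule mult_right_mono)
        show "0 \<le> k2 t" using rK K0 pos by (intro order_trans[OF _ rK]) simp
      qed (use b0 in simp)
      finally show ?thesis by (simp add: distrib_left)
    qed
    show "0 \<le> E t" "J t \<le> \<beta>1 * E t" "- (\<beta>0 * E t) \<le> J t" "0 \<le> \<beta>0" "\<beta>0 \<le> \<beta>1"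
      unfolding E_def J_def
      by (rule lyapunov_bounds[OF l \<open>0 < \<rho>1\<close> pos(2) \<mu>1 pos(4,6,3,5) rK K0 k1 _ _ _ _ j2 j1 \<beta>];
          use pb in \<open>simp add: A_def B_def power2_eq_square\<close>)+
  qed
  have b1: "0 \<le> \<beta>1" using bnd(4,5)[of 0] T by simp
  have den: "0 < 1 + \<beta>1 * lam" "0 < 1 - \<beta>0 * lam"
    using b1 lam lam1 by (auto intro: add_pos_nonneg simp: mult.commute)
  have decay: "AE t in leb T. E' t + lam * J' t \<le> - \<sigma> * (E t + lam * J t)"
  proof -
    have "AE t in leb T. t \<in> {0<..<T}" using AE_space[of "leb T"] by simp
    with ident show ?thesis
    proof eventually_elim
      case (elim t)
      have t: "t \<in> {0..T}" using elim(2) by simp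
      have qt: "q t \<in> L2 l" and ut: "ut t \<in> L2 l" and utt: "utt t \<in> L2 l"
        and vu: "AE x in leb l. v t x = ut t x" and uq: "AE x in leb l. ut t x = prim2 l (q t) x"
        and id: "\<And>h. h \<in> L2 l \<Longrightarrow> (wip l \<rho> (utt t) (prim2 l h)) + wip l \<mu> (ut t) (prim2 l h)
         + wip l r (P t) h + (kd * B t + kv * B' t) * prim2 l h l + (kr * A t + ka * A' t) * prim l h l = 0"
        using elim(1) unfolding A_def B_def A'_def B'_def weak_beam_def by blast+
      note vt = vL[OF t] and wt = wL[OF t] and Pt = PL[OF t]
      have vq: "AE x in leb l. v t x = prim2 l (q t) x" using vu uq by eventually_elim simp
      have cong: "wip l a f g = wip l a f' g'"
        if "a \<in> borel_measurable (leb l)" "f \<in> L2 l" "g \<in> L2 l" "AE x in leb l. f x = f' x" "AE x in leb l. g x = g' x" for a f g f' g'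
      proof (rule integral_cong_AE)
        have "f' \<in> L2 l" "g' \<in> L2 l" by (rule L2_cong_AE[OF that(2,4)] L2_cong_AE[OF that(3,5)])+
        then show "(\<lambda>x. a x * f x * g x) \<in> borel_measurable (leb l)" "(\<lambda>x. a x * f' x * g' x) \<in> borel_measurable (leb l)"
          using that(1-3) by (auto intro!: borel_measurable_times dest: L2_measurable)
        show "AE x in leb l. a x * f x * g x = a x * f' x * g' x" using that(4,5) by eventually_elim simp
      qed
      have refl: "AE x in leb l. f x = f x" for f :: "real \<Rightarrow> real" by simp
      have uv: "AE x in leb l. ut t x = v t x" using vu by eventually_elim simp
      define c1 c2 c3 c5 d where "c1 = wip l \<rho> (utt t) (v t)" and "c2 = wip l r (P t) (q t)"
        and "c3 = wip l \<rho> (utt t) (w t)" and "c5 = wip l \<mu> (ut t) (w t)"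
        and "d = wip l \<mu> (v t) (v t)"
      \<comment> \<open>The velocity as virtual displacement, \<open>h = q t\<close>: the energy
        balance.\<close>
      have I1: "c1 + d + c2 + (kd * B t + kv * B' t) * B' t + (kr * A t + ka * A' t) * A' t = 0"
        using id[OF qt] cong[OF D(3) utt vt refl vq] cong[OF D(4) vt vt vu vq]
        unfolding c1_def c2_def d_def A'_def[symmetric] B'_def[symmetric] by simp
      \<comment> \<open>The displacement itself as virtual displacement, \<open>h = P t\<close>: the
        multiplier identity.\<close>
      have I2: "c3 + c5 + k2 t + (kd * B t + kv * B' t) * B t + (kr * A t + ka * A' t) * A t = 0"
        using id[OF Pt] cong[OF D(3) utt wt refl WP[OF t]] cong[OF D(4) ut wt refl WP[OF t]]
        unfolding c3_def c5_def k2_def A_def[symmetric] B_def[symmetric] by simp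
      have s: "wip l \<rho> (v t) (utt t) = c1" "wip l r (q t) (P t) = c2"
        "wip l \<rho> (w t) (utt t) = c3" "wip l \<mu> (w t) (ut t) = c5"
        unfolding c1_def c2_def c3_def c5_def by (simp_all add: ac_simps)
      have s1: "wip l \<rho> (ut t) (v t) = k1 t"
        unfolding k1_def by (rule cong[OF D(3) ut vt uv refl])
      \<comment> \<open>In \<open>E'\<close> the inertial, bending and spring terms cancel, leaving
        dissipation; in \<open>J'\<close> the damping terms cancel against those from testing with
        the displacement.\<close>
      have m: "E' t + lam * J' t = - d - ka * (A' t * A' t) - kv * (B' t * B' t)
          + lam * (k1 t - k2 t - kr * (A t * A t) - kd * (B t * B t))"
      proof -
        have e: "E' t = c1 + c2 + kr * (A t * A' t) + kd * (B t * B' t)"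
          unfolding E'_def s c1_def[symmetric] c2_def[symmetric] by (simp add: algebra_simps)
        have j: "J' t = k1 t + c3 + c5 + ka * (A t * A' t) + kv * (B t * B' t)"
          unfolding J'_def s s1 c5_def[symmetric] by (simp add: algebra_simps)
        have e': "E' t = - d - ka * (A' t * A' t) - kv * (B' t * B' t)"
          unfolding e using I1 by (simp add: algebra_simps)
        have j': "J' t = k1 t - k2 t - kr * (A t * A t) - kd * (B t * B t)"
          unfolding j using I2 by (simp add: algebra_simps)
        show ?thesis unfolding e' j' by simp
      qed
      \<comment> \<open>The kinetic term \<open>lam * k1 t\<close> is the one of the wrong sign. The
        internal damping covers it twice: once to cancel it and once to supply the kinetic part of
        \<open>- 2 * lam * E t\<close>.\<close>
      have dk: "2 * lam * k1 t \<le> d"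
      proof -
        have "(\<integral>x. (2 * lam * \<rho> x) * v t x * v t x \<partial>leb l) \<le> d"
          unfolding d_def
        proof (rule weighted_square_mono[OF vt _ _ D(4,6)])
          show "(\<lambda>x. 2 * lam * \<rho> x) \<in> borel_measurable (leb l)" using D(3) by simp
          show "AE x in leb l. \<bar>2 * lam * \<rho> x\<bar> \<le> 2 * lam * \<rho>1"
            using D(5) by eventually_elim (use lam in \<open>simp add: abs_mult\<close>)
          show "AE x in leb l. 2 * lam * \<rho> x \<le> \<mu> x"
            using bounds(1,3)
          proof eventually_elim
            case (elim x)
            have "2 * lam * \<rho> x \<le> 2 * lam * \<rho>1" using elim lam by simp
            then show ?case using elim lam2 by linarith
          qed
        qed
        moreover have "(\<integral>x. (2 * lam * \<rho> x) * v t x * v t x \<partial>leb l) = 2 * lam * k1 t"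
          unfolding k1_def by (simp only: mult.assoc integral_mult_right_zero)
        ultimately show ?thesis by simp
      qed
      have "0 \<le> ka * (A' t * A' t)" "0 \<le> kv * (B' t * B' t)" using pos by simp_all
      then have "E' t + lam * J' t \<le> - 2 * lam * E t"
        unfolding m E_def using dk by (simp add: algebra_simps)
      \<comment> \<open>\<sigma> is the rate for which
        \<open>\<sigma> * (1 + \<beta>1 * lam) = 2 * lam\<close>; it converts decay relative to the
        energy into decay relative to the Lyapunov function.\<close>
      also have "\<dots> = - \<sigma> * ((1 + \<beta>1 * lam) * E t)"
        unfolding assms(12) using den by simp
      also have "\<dots> \<le> - \<sigma> * (E t + lam * J t)"
      proof -
        have "E t + lam * J t \<le> (1 + \<beta>1 * lam) * E t"
          using mult_left_mono[OF bnd(2)[OF t], of lam] lam by (simp add: algebra_simps)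
        moreover have "0 \<le> \<sigma>" unfolding assms(12) using lam den by simp
        ultimately show ?thesis by (simp add: mult_left_mono)
      qed
      finally show ?case .
    qed
  qed
  have z: "0 \<in> {0..T}" using T by simp
  have E_energy: "energy l T \<rho> r kr kd u ut t = E t" if t: "t \<in> {0..T}" for t
    unfolding energy_def w_def[symmetric] v_def[symmetric] E_def k1_def k2_def A_def B_def
    by (rule state_energy_prim(1)[OF l PL[OF t] WP[OF t] vL[OF t] D(3,5) D(2,7)])
  have E0: "energy l T \<rho> r kr kd u ut 0 = state_energy l \<rho> r kr kd u0 u1"
    unfolding energy_def w_def[symmetric] v_def[symmetric]
  proof (rule state_energy_cong_AE[OF _ _ D(3,2)])
    show "AE x in leb l. w 0 x = u0 x" "AE x in leb l. v 0 x = u1 x"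
      using sol unfolding regular_weak_solution_def w_def v_def by blast+
    show "v 0 \<in> borel_measurable (leb l)" by (rule L2_measurable[OF vL[OF z]])
    show "wderiv l 2 (w 0) \<in> borel_measurable (leb l)"
      by (rule state_energy_prim(2)[OF l PL[OF z] WP[OF z] vL[OF z] D(3,5) D(2,7)])
  qed
  note t = assms(13)
  \<comment> \<open>The Lyapunov function is bounded below at time \<open>t\<close> and above at
    time 0; the quotient of the two factors is \<open>M_d\<close>.\<close>
  have "(1 - \<beta>0 * lam) * E t \<le> E t + lam * J t"
    using mult_left_mono[OF bnd(3)[OF t], of lam] lam by (simp add: algebra_simps)
  also have "\<dots> \<le> exp (- \<sigma> * t) * (E 0 + lam * J 0)"
    by (rule Gronwall_AC[OF T L decay t])
  also have "\<dots> \<le> exp (- \<sigma> * t) * ((1 + \<beta>1 * lam) * E 0)"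
    using mult_left_mono[OF bnd(2)[OF z], of lam] lam by (intro mult_left_mono) (simp_all add: algebra_simps)
  finally have "E t \<le> exp (- \<sigma> * t) * ((1 + \<beta>1 * lam) * E 0) / (1 - \<beta>0 * lam)"
    using den by (simp add: pos_le_divide_eq mult.commute)
  then show ?thesis
    unfolding E_energy[OF t] E0[symmetric] E_energy[OF z] assms(11) by (simp add: ac_simps)
qed

end
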